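(* For every integer $g \geq 0$, the radius of convergence of the formal power series \[ \vec{\mathbf{F}}_g(z) = \sum_{d=1}^{\infty} \Big( \sum_{\alpha,\beta \vdash d} \vec{H}_g(\alpha,\beta) \Big) \frac{z^d}{d!} \] is at least $1/54$ and at most $2/27$.
   Context: For $d \geq 1$, the symmetric group $S(d)$ is viewed as its right Cayley graph with respect to all transpositions. Each transposition is written $(s\ t)$ with $s<t$, and $t$ is called its colour. An $r$-step walk from $\rho \in S(d)$ is a sequence of transpositions $((s_1\ t_1),\dots,(s_r\ t_r))$, $s_i<t_i$; it ends at $\sigma = \rho (s_1\ t_1)\cdots(s_r\ t_r)$. The walk is monotone if $t_1 \leq t_2 \leq \dots \leq t_r$. It is transitive if the subgroup of $S(d)$ generated by $\rho$, $\sigma$ and the transpositions $(s_i\ t_i)$ acts transitively on $\{1,\dots,d\}$. For partitions $\alpha,\beta$ of $d$, with $\ell(\cdot)$ denoting the number of parts, and for an integer $g \geq 0$, put $r_g(\alpha,\beta) = 2g-2+\ell(\alpha)+\ell(\beta)$. The monotone double Hurwitz number $\vec{H}_g(\alpha,\beta)$ is the number of pairs consisting of a starting permutation $\rho$ of cycle type $\alpha$ and a monotone transitive $r_g(\alpha,\beta)$-step walk from $\rho$ whose endpoint has cycle type $\beta$. *)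

theory Defs
  imports "HOL-Analysis.Analysis" "HOL-Algebra.Sym_Groups" "HOL-Combinatorics.Orbits"
begin

text \<open>Permutations of {1..d} are functions nat => nat permuting {1..d} (carrier of sym_group d).
  A transposition (s t), s < t, is encoded as the pair (s,t); t is its colour.
  Products are read left to right as in the right Cayley graph: rho (s1 t1) ... (sr tr)
  is the function composition rho o transpose s1 t1 o ... o transpose sr tr.\<close>

definition cycle_type :: "nat \<Rightarrow> (nat \<Rightarrow> nat) \<Rightarrow> nat multiset" where
  "cycle_type d p = image_mset card (mset_set ((\<lambda>x. Orbits.orbit p x) ` {1..d}))"

definition partitions_of :: "nat \<Rightarrow> nat multiset set" where
  "partitions_of d = {\<alpha>. (\<forall>k\<in>#\<alpha>. 0 < k) \<and> sum_mset \<alpha> = d}"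

definition is_walk :: "nat \<Rightarrow> (nat \<times> nat) list \<Rightarrow> bool" where
  "is_walk d w \<longleftrightarrow> (\<forall>(s,t)\<in>set w. 1 \<le> s \<and> s < t \<and> t \<le> d)"

definition walk_end :: "(nat \<Rightarrow> nat) \<Rightarrow> (nat \<times> nat) list \<Rightarrow> (nat \<Rightarrow> nat)" where
  "walk_end \<rho> w = foldl (\<lambda>p (s,t). p \<circ> Transposition.transpose s t) \<rho> w"

definition monotone_walk :: "(nat \<times> nat) list \<Rightarrow> bool" where
  "monotone_walk w \<longleftrightarrow> sorted (map snd w)"

definition transitive_walk :: "nat \<Rightarrow> (nat \<Rightarrow> nat) \<Rightarrow> (nat \<times> nat) list \<Rightarrow> bool" where
  "transitive_walk d \<rho> w \<longleftrightarrow>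
     (\<forall>x\<in>{1..d}. \<forall>y\<in>{1..d}. \<exists>p\<in>generate (sym_group d)
        ({\<rho>, walk_end \<rho> w} \<union> (\<lambda>(s,t). Transposition.transpose s t) ` set w). p x = y)"

definition monotone_hurwitz :: "nat \<Rightarrow> nat multiset \<Rightarrow> nat multiset \<Rightarrow> nat" where
  "monotone_hurwitz g \<alpha> \<beta> = (let d = sum_mset \<alpha> in
     card {(\<rho>, w). \<rho> permutes {1..d} \<and> cycle_type d \<rho> = \<alpha> \<and>
        int (length w) = 2 * int g - 2 + int (size \<alpha>) + int (size \<beta>) \<and>
        is_walk d w \<and> monotone_walk w \<and> transitive_walk d \<rho> w \<and>
        cycle_type d (walk_end \<rho> w) = \<beta>})"

definition F_coeff :: "nat \<Rightarrow> nat \<Rightarrow> real" where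
  "F_coeff g d = (if d = 0 then 0 else
     real (\<Sum>\<alpha>\<in>partitions_of d. \<Sum>\<beta>\<in>partitions_of d. monotone_hurwitz g \<alpha> \<beta>) / fact d)"

end

theory Submission
  imports Defs "HOL-Real_Asymp.Real_Asymp"
begin

text \<open>
Sorting colours by the Hurwitz move \<open>(t j)(s i) = (s i)(t' j)\<close>, where \<open>s < i < j\<close> and
\<open>t'\<close> is the image of \<open>t\<close> under \<open>(s i)\<close>, preserves the product and the orbits of the generated
group. A permutation with \<open>c\<close> cycles is a product of \<open>d - c\<close> transpositions with strictly
increasing colours, so a transitive walk from \<open>\<rho>\<close> to \<open>\<sigma>\<close> is sandwiched into a closed walk at the
identity of length \<open>2g - 2 + 2d\<close>; after sorting, at most \<open>4^d\<close> sandwiches share a closed walk.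
Hence the coefficients lie between those of the simple monotone Hurwitz numbers and \<open>4^d\<close>
times them, and it remains to find the growth rate \<open>27/2\<close> of the latter.

Removing the last step of a walk either joins or cuts the cycle of the largest element; in the
second case the rest of the walk may fall apart into two components. In genus zero this recursion
is solved exactly by \<open>(2d + l - 3)! / (2d)!\<close> times the product of \<open>a * binomial (2a) a\<close> over the
\<open>l\<close> cycle lengths \<open>a\<close>. In genus \<open>g\<close> the same product times a large multiple of \<open>n^(5g-1)\<close>,
\<open>n = 2d + l - 2\<close>, is a supersolution: the linear part of the recursion replaces \<open>n\<close> by \<open>n - 1\<close>,
and the gap pays for the terms of lower genus.
\<close>


unbundle fps_syntax
unbundle no vec_syntax

section \<open>Power series for central binomial coefficients\<close>

definition cbin :: "nat \<Rightarrow> real" where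
  "cbin n = real ((2 * n) choose n)"

lemma cbin_0 [simp]: "cbin 0 = 1"
  by (simp add: cbin_def)

lemma cbin_pos: "cbin n > 0"
  by (simp add: cbin_def)

lemma cbin_Suc: "real (Suc n) * cbin (Suc n) = 2 * (2 * real n + 1) * cbin n"
proof -
  have "Suc n * (Suc (2 * n + 1) choose Suc n) = Suc (2 * n + 1) * ((2 * n + 1) choose n)"
    by (rule Suc_times_binomial)
  also have "\<dots> = 2 * (Suc n * (Suc (n + n) choose n))"
    by (simp only: mult_2 One_nat_def add_Suc_right add_0_right) (simp add: algebra_simps)
  also have "Suc n * (Suc (n + n) choose n) = Suc n * (Suc (n + n) choose Suc n)"
    by (rule Suc_times_binomial_add[symmetric])
  also have "\<dots> = Suc (n + n) * ((n + n) choose n)"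
    by (rule Suc_times_binomial)
  finally have "Suc n * ((2 * Suc n) choose Suc n) = 2 * (Suc (2 * n) * ((2 * n) choose n))"
    by (simp only: mult_2 add_Suc_right add_Suc add_0_right One_nat_def)
  hence "real (Suc n * ((2 * Suc n) choose Suc n)) = real (2 * (Suc (2 * n) * ((2 * n) choose n)))"
    by (simp only:)
  thus ?thesis
    unfolding cbin_def by (simp only: of_nat_mult) (simp add: algebra_simps)
qed

definition cbin_fps :: "real fps" where
  "cbin_fps = Abs_fps cbin"

definition sqrt_fps :: "real fps" where
  "sqrt_fps = (1 - 4 * fps_X) * cbin_fps"

lemma cbin_fps_nth [simp]: "cbin_fps $ n = cbin n"
  by (simp add: cbin_fps_def)

lemma cbin_fps_ODE: "(1 - 4 * fps_X) * fps_deriv cbin_fps = 2 * cbin_fps"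
proof (rule fps_ext)
  fix n
  have "((1 - 4 * fps_X) * fps_deriv cbin_fps) $ n
      = real (Suc n) * cbin (Suc n) - 4 * (real n * cbin n)"
    by (cases n) (simp_all add: left_diff_distrib mult.assoc numeral_fps_const)
  also have "\<dots> = (2 * cbin_fps) $ n"
    unfolding cbin_Suc by (simp add: numeral_fps_const algebra_simps)
  finally show "((1 - 4 * fps_X) * fps_deriv cbin_fps) $ n = (2 * cbin_fps) $ n" .
qed

lemma sqrt_fps_deriv: "fps_deriv sqrt_fps = - 2 * cbin_fps"
proof -
  have "fps_deriv sqrt_fps = (1 - 4 * fps_X) * fps_deriv cbin_fps - 4 * cbin_fps"
    by (simp add: sqrt_fps_def)
  thus ?thesis by (simp add: cbin_fps_ODE)
qed

lemma sqrt_fps_cbin_fps: "sqrt_fps * cbin_fps = 1"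
proof -
  have "fps_deriv (sqrt_fps * cbin_fps)
     = cbin_fps * ((1 - 4 * fps_X) * fps_deriv cbin_fps) - 2 * cbin_fps * cbin_fps"
    by (simp add: sqrt_fps_deriv) (simp add: sqrt_fps_def algebra_simps)
  also have "\<dots> = 0" by (simp add: cbin_fps_ODE)
  finally have "fps_deriv (sqrt_fps * cbin_fps) = 0" .
  hence "sqrt_fps * cbin_fps = fps_const ((sqrt_fps * cbin_fps) $ 0)"
    by (simp only: fps_deriv_eq_0_iff)
  also have "(sqrt_fps * cbin_fps) $ 0 = 1" by (simp add: sqrt_fps_def)
  finally show ?thesis by simp
qed

lemma sqrt_fps_square: "sqrt_fps * sqrt_fps = 1 - 4 * fps_X"
proof -
  have "sqrt_fps * sqrt_fps = (1 - 4 * fps_X) * (sqrt_fps * cbin_fps)"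
    by (simp add: sqrt_fps_def algebra_simps)
  thus ?thesis by (simp add: sqrt_fps_cbin_fps)
qed

lemma sqrt_fps_nth: "sqrt_fps $ 0 = 1" "sqrt_fps $ Suc m = - 2 * cbin m / real (Suc m)"
proof -
  have "fps_deriv sqrt_fps $ m = (- 2 * cbin_fps) $ m" by (simp only: sqrt_fps_deriv)
  thus "sqrt_fps $ Suc m = - 2 * cbin m / real (Suc m)"
    by (simp add: numeral_fps_const field_simps)
  show "sqrt_fps $ 0 = 1" by (simp add: sqrt_fps_def)
qed

text \<open>The polynomial \<open>p\<close> of degree \<open>a\<close> for which \<open>sqrt (1 - 4 X) * p\<close> is an antiderivative of
\<open>- (2 a + 1) X^a / sqrt (1 - 4 X)\<close>.\<close>

definition cut_fps :: "nat \<Rightarrow> real fps" where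
  "cut_fps a = Abs_fps (\<lambda>t. if t \<le> a then cbin t / (2 * cbin a) else 0)"

lemma cut_fps_ODE:
  "(1 - 4 * fps_X) * fps_deriv (cut_fps a) - 2 * cut_fps a = - fps_const (2 * real a + 1) * fps_X ^ a"
proof (rule fps_ext)
  fix n
  have "((1 - 4 * fps_X) * fps_deriv (cut_fps a) - 2 * cut_fps a) $ n
      = real (Suc n) * cut_fps a $ Suc n - (4 * real n + 2) * cut_fps a $ n"
    by (cases n) (simp_all add: left_diff_distrib mult.assoc numeral_fps_const algebra_simps)
  also have "\<dots> = (- fps_const (2 * real a + 1) * fps_X ^ a) $ n"
  proof -
    consider "n < a" | "n = a" | "n > a" by linarith
    thus ?thesis
    proof cases
      case 1
      thus ?thesis using cbin_Suc[of n] by (simp add: cut_fps_def field_simps fps_X_power_nth)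
    next
      case 2
      thus ?thesis using cbin_pos[of a] by (simp add: cut_fps_def field_simps fps_X_power_nth)
    next
      case 3
      thus ?thesis by (simp add: cut_fps_def)
    qed
  qed
  finally show "((1 - 4 * fps_X) * fps_deriv (cut_fps a) - 2 * cut_fps a) $ n
      = (- fps_const (2 * real a + 1) * fps_X ^ a) $ n" .
qed

definition sing_fps :: "nat \<Rightarrow> real fps" where
  "sing_fps a = sqrt_fps * cut_fps a"

lemma sing_fps_deriv: "fps_deriv (sing_fps a) = - fps_const (2 * real a + 1) * fps_X ^ a * cbin_fps"
proof -
  have "fps_deriv (sing_fps a)
     = cbin_fps * ((1 - 4 * fps_X) * fps_deriv (cut_fps a) - 2 * cut_fps a)"
    by (simp add: sing_fps_def sqrt_fps_deriv) (simp add: sqrt_fps_def algebra_simps)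
  thus ?thesis by (simp only: cut_fps_ODE) (simp only: mult_ac)
qed

lemma sing_fps_nth:
  "sing_fps a $ m = (if m = 0 then 1 / (2 * cbin a) else if m \<le> a then 0
     else - (2 * real a + 1) * cbin (m - a - 1) / real m)"
proof (cases m)
  case 0
  thus ?thesis by (simp add: sing_fps_def sqrt_fps_nth cut_fps_def)
next
  case (Suc k)
  have "fps_deriv (sing_fps a) $ k = (- fps_const (2 * real a + 1) * fps_X ^ a * cbin_fps) $ k"
    by (simp only: sing_fps_deriv)
  also have "\<dots> = - (2 * real a + 1) * (if k < a then 0 else cbin (k - a))"
    by (simp add: mult.assoc fps_X_power_mult_nth)
  finally have "sing_fps a $ m = (- (2 * real a + 1) * (if k < a then 0 else cbin (k - a))) / real m"
    using Suc by (simp add: eq_divide_eq mult.commute)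
  thus ?thesis using Suc by simp
qed

definition half_sqrt :: "real fps" where
  "half_sqrt = - fps_const (1/2) * sqrt_fps"

lemma half_sqrt_nth: "half_sqrt $ 0 = - 1 / 2" "half_sqrt $ Suc m = cbin m / real (Suc m)"
  by (simp_all add: half_sqrt_def sqrt_fps_nth mult.assoc)

lemma half_sqrt_square:
  "half_sqrt * half_sqrt = fps_const (1/4) - fps_X"
proof -
  have "half_sqrt * half_sqrt
     = fps_const (1/4) * (sqrt_fps * sqrt_fps)"
    by (simp add: half_sqrt_def mult_ac)
  also have "\<dots> = fps_const (1/4) - fps_const (1/4) * fps_const 4 * fps_X"
    unfolding sqrt_fps_square by (simp only: numeral_fps_const right_diff_distrib mult.assoc mult_1_right)
  also have "\<dots> = fps_const (1/4) - fps_X" by simp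
  finally show ?thesis .
qed

lemma half_sqrt_sing_nth:
  assumes "m > a"
  shows "(half_sqrt * sing_fps a) $ m = (if m = a + 1 then 1 else 0)"
proof -
  have "half_sqrt * sing_fps a
     = - fps_const (1/2) * ((sqrt_fps * sqrt_fps) * cut_fps a)"
    by (simp add: half_sqrt_def sing_fps_def mult_ac)
  also have "\<dots> = - fps_const (1/2) * cut_fps a + fps_const (1/2) * fps_const 4 * (fps_X * cut_fps a)"
  proof -
    have "- h * ((1 - f * x) * c) = - h * c + h * f * (x * c)" for h f x c :: "real fps"
      by (simp add: algebra_simps)
    thus ?thesis unfolding sqrt_fps_square numeral_fps_const .
  qed
  finally show ?thesis using assms cbin_pos[of a]
    by (cases m) (auto simp: cut_fps_def numeral_fps_const)
qed

lemma cut_fps_mult_nth: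
  assumes "m \<ge> a + b"
  shows "(cut_fps a * cut_fps b) $ m = (if m = a + b then 1/4 else 0)"
proof -
  have "(cut_fps a * cut_fps b) $ m = (\<Sum>i=0..m. if i = a then cut_fps a $ a * cut_fps b $ (m - a) else 0)"
    unfolding fps_mult_nth
  proof (rule sum.cong)
    fix i assume "i \<in> {0..m}"
    show "cut_fps a $ i * cut_fps b $ (m - i) = (if i = a then cut_fps a $ a * cut_fps b $ (m - a) else 0)"
    proof (cases "i = a")
      case False
      hence "i > a \<or> m - i > b" using assms by auto
      thus ?thesis using False by (auto simp: cut_fps_def)
    qed simp
  qed simp
  also have "\<dots> = cut_fps a $ a * cut_fps b $ (m - a)" using assms by (simp add: sum.delta)
  also have "\<dots> = (if m = a + b then 1/4 else 0)"
    using assms cbin_pos[of a] cbin_pos[of b] by (auto simp: cut_fps_def)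
  finally show ?thesis .
qed

lemma sing_sing_nth:
  assumes "m > a + b"
  shows "(sing_fps a * sing_fps b) $ m = (if m = a + b + 1 then -1 else 0)"
proof -
  have "sing_fps a * sing_fps b = (sqrt_fps * sqrt_fps) * (cut_fps a * cut_fps b)"
    by (simp add: sing_fps_def mult_ac)
  also have "\<dots> = cut_fps a * cut_fps b - 4 * (fps_X * (cut_fps a * cut_fps b))"
    unfolding sqrt_fps_square by (simp add: algebra_simps)
  finally show ?thesis using assms
    by (cases m) (auto simp: cut_fps_mult_nth numeral_fps_const simp del: fps_mult_nth_0)
qed

text \<open>If \<open>z = 1 + (\<Sum>i. e i * z ^ (b i + 1))\<close>, then \<open>lagrange b A x\<close> is the coefficient of
\<open>\<Prod>i\<in>A. e i\<close> in \<open>z\<close> to the power \<open>x\<close>; multiplicativity in \<open>x\<close> is the Rothe--Hagen identity.\<close>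

definition lagrange :: "('c \<Rightarrow> nat) \<Rightarrow> 'c set \<Rightarrow> real \<Rightarrow> real" where
  "lagrange b A x = (if A = {} then 1 else x * pochhammer (x + real (sum b A) + 1) (card A - 1))"

lemma lagrange_empty [simp]: "lagrange b {} x = 1"
  by (simp add: lagrange_def)

lemma lagrange_0: "A \<noteq> {} \<Longrightarrow> lagrange b A 0 = 0"
  by (simp add: lagrange_def)

lemma lagrange_rec:
  assumes "finite I"
  shows "lagrange b I x = lagrange b I (x - 1) + (\<Sum>i\<in>I. lagrange b (I - {i}) (x + real (b i)))"
proof (cases "card I")
  case 0
  thus ?thesis using assms by simp
next
  case (Suc n)
  hence ne: "I \<noteq> {}" by auto
  show ?thesis
  proof (cases n)
    case 0
    then obtain i where "I = {i}" using Suc card_1_singletonE by auto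
    thus ?thesis by (simp add: lagrange_def)
  next
    case (Suc k)
    define B where "B = real (sum b I)"
    have cI: "card I = Suc (Suc k)" using Suc \<open>card I = Suc n\<close> by simp
    have *: "lagrange b (I - {i}) (x + real (b i)) = (x + real (b i)) * pochhammer (x + B + 1) k" if "i \<in> I" for i
    proof -
      have "card (I - {i}) = Suc k" using that cI assms by simp
      moreover from this have "I - {i} \<noteq> {}" by (metis card.empty nat.distinct(1))
      moreover have "real (b i) + real (sum b (I - {i})) = B"
        unfolding B_def using that assms by (simp add: sum.remove)
      ultimately show ?thesis by (simp add: lagrange_def add.assoc)
    qed
    have "(\<Sum>i\<in>I. lagrange b (I - {i}) (x + real (b i))) = (\<Sum>i\<in>I. (x + real (b i)) * pochhammer (x + B + 1) k)"
      using * by (intro sum.cong) auto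
    also have "\<dots> = (real (Suc (Suc k)) * x + B) * pochhammer (x + B + 1) k"
      by (simp add: sum_distrib_right[symmetric] sum.distrib cI B_def)
    finally have 1: "(\<Sum>i\<in>I. lagrange b (I - {i}) (x + real (b i))) = (real (Suc (Suc k)) * x + B) * pochhammer (x + B + 1) k" .
    have 2: "lagrange b I x = x * (pochhammer (x + B + 1) k * (x + B + 1 + real k))"
      using ne cI by (simp add: lagrange_def B_def pochhammer_Suc)
    have 3: "lagrange b I (x - 1) = (x - 1) * ((x + B) * pochhammer (x + B + 1) k)"
      using ne cI by (simp add: lagrange_def B_def pochhammer_rec)
    show ?thesis unfolding 1 2 3 by (simp add: algebra_simps)
  qed
qed

lemma sum_Pow_remove:
  assumes "finite I"
  shows "(\<Sum>A\<in>Pow I. \<Sum>i\<in>A. F A i) = (\<Sum>i\<in>I. \<Sum>A\<in>Pow (I - {i}). F (insert i A) i)"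
proof -
  have "(\<Sum>A\<in>Pow I. \<Sum>i\<in>A. F A i) = (\<Sum>(A,i)\<in>Sigma (Pow I) (\<lambda>A. A). F A i)"
    using assms by (subst sum.Sigma) (auto intro: finite_subset)
  also have "\<dots> = (\<Sum>(i,A)\<in>Sigma I (\<lambda>i. Pow (I - {i})). F (insert i A) i)"
    by (rule sum.reindex_bij_witness[of _ "\<lambda>(i,A). (insert i A, i)" "\<lambda>(A,i). (i, A - {i})"])
       (auto simp: insert_absorb)
  also have "\<dots> = (\<Sum>i\<in>I. \<Sum>A\<in>Pow (I - {i}). F (insert i A) i)"
    using assms by (subst sum.Sigma) auto
  finally show ?thesis .
qed

lemma sum_Pow_compl:
  assumes "finite I"
  shows "(\<Sum>A\<in>Pow I. F A (I - A)) = (\<Sum>A\<in>Pow I. F (I - A) A)"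
  by (rule sum.reindex_bij_witness[of _ "\<lambda>A. I - A" "\<lambda>A. I - A"]) (auto simp: double_diff)

lemma lagrange_convolution:
  assumes "finite I"
  shows "(\<Sum>A\<in>Pow I. lagrange b A (real x) * lagrange b (I - A) y) = lagrange b I (real x + y)"
  using assms
proof (induction I arbitrary: x y rule: finite_psubset_induct)
  case (psubset I)
  show ?case
  proof (induction x)
    case 0
    have "(\<Sum>A\<in>Pow I. lagrange b A (real 0) * lagrange b (I - A) y) = (\<Sum>A\<in>Pow I. if A = {} then lagrange b I y else 0)"
      by (intro sum.cong) (auto simp: lagrange_0)
    also have "\<dots> = lagrange b I y" using psubset.hyps by (subst sum.delta) auto
    finally show ?case by simp
  next
    case (Suc x)
    have "(\<Sum>A\<in>Pow I. lagrange b A (real (Suc x)) * lagrange b (I - A) y)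
        = (\<Sum>A\<in>Pow I. lagrange b A (real x) * lagrange b (I - A) y
             + (\<Sum>i\<in>A. lagrange b (A - {i}) (real (Suc x + b i)) * lagrange b (I - A) y))"
    proof (rule sum.cong)
      fix A assume "A \<in> Pow I"
      hence "finite A" using psubset.hyps finite_subset by auto
      thus "lagrange b A (real (Suc x)) * lagrange b (I - A) y = lagrange b A (real x) * lagrange b (I - A) y
             + (\<Sum>i\<in>A. lagrange b (A - {i}) (real (Suc x + b i)) * lagrange b (I - A) y)"
        by (subst lagrange_rec) (simp_all add: distrib_right sum_distrib_right sum_distrib_left algebra_simps)
    qed simp
    also have "\<dots> = lagrange b I (real x + y)
       + (\<Sum>i\<in>I. \<Sum>A\<in>Pow (I - {i}). lagrange b (insert i A - {i}) (real (Suc x + b i)) * lagrange b (I - insert i A) y)"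
      unfolding sum.distrib Suc.IH sum_Pow_remove[OF psubset.hyps(1)] ..
    also have "(\<Sum>i\<in>I. \<Sum>A\<in>Pow (I - {i}). lagrange b (insert i A - {i}) (real (Suc x + b i)) * lagrange b (I - insert i A) y)
       = (\<Sum>i\<in>I. \<Sum>A\<in>Pow (I - {i}). lagrange b A (real (Suc x + b i)) * lagrange b (I - {i} - A) y)"
    proof (intro sum.cong refl)
      fix i A assume "i \<in> I" "A \<in> Pow (I - {i})"
      hence "insert i A - {i} = A" "I - insert i A = I - {i} - A" by auto
      thus "lagrange b (insert i A - {i}) (real (Suc x + b i)) * lagrange b (I - insert i A) y
          = lagrange b A (real (Suc x + b i)) * lagrange b (I - {i} - A) y" by simp
    qed
    also have "\<dots> = (\<Sum>i\<in>I. lagrange b (I - {i}) (real (Suc x) + y + real (b i)))"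
    proof (intro sum.cong refl)
      fix i assume "i \<in> I"
      hence "I - {i} \<subset> I" by auto
      from psubset.IH[OF this, of "Suc x + b i" y]
      show "(\<Sum>A\<in>Pow (I - {i}). lagrange b A (real (Suc x + b i)) * lagrange b (I - {i} - A) y)
          = lagrange b (I - {i}) (real (Suc x) + y + real (b i))"
        by (simp add: algebra_simps)
    qed
    also have "lagrange b I (real x + y) + \<dots> = lagrange b I (real (Suc x) + y)"
      using lagrange_rec[OF psubset.hyps(1), of b "real (Suc x) + y"] by (simp add: algebra_simps)
    finally show ?case .
  qed
qed

section \<open>The genus zero identity\<close>

definition lagrange_fps :: "('c \<Rightarrow> nat) \<Rightarrow> 'c set \<Rightarrow> real fps \<Rightarrow> real fps" where
  "lagrange_fps a I f = fps_X ^ sum a I * Abs_fps (\<lambda>m. lagrange (\<lambda>i. 2 * a i) I (2 * real m) * f $ m)"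

lemma lagrange_fps_nth:
  "lagrange_fps a I f $ N = (if N < sum a I then 0
     else lagrange (\<lambda>i. 2 * a i) I (2 * real (N - sum a I)) * f $ (N - sum a I))"
  by (simp add: lagrange_fps_def fps_X_power_mult_nth)

lemma lagrange_fps_mult:
  assumes "finite I"
  shows "(\<Sum>A\<in>Pow I. lagrange_fps a A f * lagrange_fps a (I - A) g) = lagrange_fps a I (f * g)"
proof -
  define P where "P = lagrange (\<lambda>i. 2 * a i)"
  define T where "T A f = Abs_fps (\<lambda>m. P A (2 * real m) * f $ m)" for A and f :: "real fps"
  have conv: "(\<Sum>A\<in>Pow I. T A f * T (I - A) g) = T I (f * g)"
  proof (rule fps_ext)
    fix n
    have "(\<Sum>A\<in>Pow I. T A f * T (I - A) g) $ n
        = (\<Sum>A\<in>Pow I. \<Sum>i=0..n. (P A (2 * real i) * f $ i) * (P (I - A) (2 * real (n - i)) * g $ (n - i)))"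
      by (simp add: fps_sum_nth fps_mult_nth T_def)
    also have "\<dots> = (\<Sum>i=0..n. \<Sum>A\<in>Pow I. (P A (2 * real i) * f $ i) * (P (I - A) (2 * real (n - i)) * g $ (n - i)))"
      by (rule sum.swap)
    also have "\<dots> = (\<Sum>i=0..n. P I (2 * real n) * (f $ i * g $ (n - i)))"
    proof (rule sum.cong)
      fix i assume i: "i \<in> {0..n}"
      have "(\<Sum>A\<in>Pow I. (P A (2 * real i) * f $ i) * (P (I - A) (2 * real (n - i)) * g $ (n - i)))
          = (\<Sum>A\<in>Pow I. P A (real (2 * i)) * P (I - A) (2 * real (n - i))) * (f $ i * g $ (n - i))"
        unfolding sum_distrib_right by (intro sum.cong) (simp_all add: mult_ac)
      also have "(\<Sum>A\<in>Pow I. P A (real (2 * i)) * P (I - A) (2 * real (n - i))) = P I (2 * real n)"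
        unfolding P_def by (subst lagrange_convolution[OF assms]) (use i in \<open>simp add: of_nat_diff\<close>)
      finally show "(\<Sum>A\<in>Pow I. (P A (2 * real i) * f $ i) * (P (I - A) (2 * real (n - i)) * g $ (n - i)))
          = P I (2 * real n) * (f $ i * g $ (n - i))" .
    qed simp
    also have "\<dots> = T I (f * g) $ n"
      by (simp add: T_def fps_mult_nth sum_distrib_left)
    finally show "(\<Sum>A\<in>Pow I. T A f * T (I - A) g) $ n = T I (f * g) $ n" .
  qed
  have "lagrange_fps a A f * lagrange_fps a (I - A) g = fps_X ^ sum a I * (T A f * T (I - A) g)" if "A \<in> Pow I" for A
  proof -
    have "sum a I = sum a A + sum a (I - A)"
      using that assms sum.subset_diff[of A I a] by simp
    thus ?thesis by (simp add: lagrange_fps_def T_def P_def power_add mult_ac)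
  qed
  hence "(\<Sum>A\<in>Pow I. lagrange_fps a A f * lagrange_fps a (I - A) g)
      = (\<Sum>A\<in>Pow I. fps_X ^ sum a I * (T A f * T (I - A) g))" by (intro sum.cong) auto
  also have "\<dots> = fps_X ^ sum a I * T I (f * g)" by (simp only: sum_distrib_left[symmetric] conv)
  finally show ?thesis by (simp add: lagrange_fps_def T_def P_def)
qed

definition sing_sum :: "('c \<Rightarrow> nat) \<Rightarrow> 'c set \<Rightarrow> real fps" where
  "sing_sum a I = (\<Sum>i\<in>I. lagrange_fps a (I - {i}) (sing_fps (a i)))"

text \<open>Up to constants this is the generating function of the genus zero counts with one marked cycle.
Both summands carry exactly one factor \<open>sqrt (1 - 4 X)\<close> before Lagrange substitution, so the
convolution square involves polynomials only, which is what makes almost all of its coefficients vanish.\<close>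

definition disk_fps :: "('c \<Rightarrow> nat) \<Rightarrow> 'c set \<Rightarrow> real fps" where
  "disk_fps a I = lagrange_fps a I half_sqrt + sing_sum a I"

lemma sing_sum_mult:
  assumes "finite I"
  shows "(\<Sum>A\<in>Pow I. sing_sum a A * F (I - A))
     = (\<Sum>i\<in>I. \<Sum>A\<in>Pow (I - {i}). lagrange_fps a A (sing_fps (a i)) * F (I - {i} - A))"
proof -
  have "(\<Sum>A\<in>Pow I. sing_sum a A * F (I - A))
      = (\<Sum>A\<in>Pow I. \<Sum>i\<in>A. lagrange_fps a (A - {i}) (sing_fps (a i)) * F (I - A))"
    by (simp add: sing_sum_def sum_distrib_right)
  also have "\<dots> = (\<Sum>i\<in>I. \<Sum>A\<in>Pow (I - {i}).
      lagrange_fps a (insert i A - {i}) (sing_fps (a i)) * F (I - insert i A))"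
    by (rule sum_Pow_remove[OF assms])
  also have "\<dots> = (\<Sum>i\<in>I. \<Sum>A\<in>Pow (I - {i}). lagrange_fps a A (sing_fps (a i)) * F (I - {i} - A))"
  proof (intro sum.cong refl)
    fix i A assume "i \<in> I" "A \<in> Pow (I - {i})"
    hence "insert i A - {i} = A" "I - insert i A = I - {i} - A" by auto
    thus "lagrange_fps a (insert i A - {i}) (sing_fps (a i)) * F (I - insert i A)
        = lagrange_fps a A (sing_fps (a i)) * F (I - {i} - A)" by simp
  qed
  finally show ?thesis .
qed

lemma disk_fps_convolution:
  assumes "finite I"
  shows "(\<Sum>A\<in>Pow I. disk_fps a A * disk_fps a (I - A)) = lagrange_fps a I (half_sqrt * half_sqrt)
     + 2 * (\<Sum>i\<in>I. lagrange_fps a (I - {i}) (half_sqrt * sing_fps (a i)))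
     + (\<Sum>i\<in>I. \<Sum>j\<in>I - {i}. lagrange_fps a (I - {i} - {j}) (sing_fps (a j) * sing_fps (a i)))"
proof -
  have hs: "(\<Sum>A\<in>Pow I. sing_sum a A * lagrange_fps a (I - A) half_sqrt)
     = (\<Sum>i\<in>I. lagrange_fps a (I - {i}) (half_sqrt * sing_fps (a i)))"
    unfolding sing_sum_mult[OF assms, of a "\<lambda>B. lagrange_fps a B half_sqrt"]
    using assms by (simp add: lagrange_fps_mult mult.commute[of half_sqrt])
  have sh: "(\<Sum>A\<in>Pow I. lagrange_fps a A half_sqrt * sing_sum a (I - A))
     = (\<Sum>A\<in>Pow I. sing_sum a A * lagrange_fps a (I - A) half_sqrt)"
    using sum_Pow_compl[OF assms, of "\<lambda>A B. lagrange_fps a A half_sqrt * sing_sum a B"] by (simp add: mult.commute)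
  have ss: "(\<Sum>A\<in>Pow I. sing_sum a A * sing_sum a (I - A))
     = (\<Sum>i\<in>I. \<Sum>j\<in>I - {i}. lagrange_fps a (I - {i} - {j}) (sing_fps (a j) * sing_fps (a i)))"
  proof -
    have "(\<Sum>A\<in>Pow I. sing_sum a A * sing_sum a (I - A))
       = (\<Sum>i\<in>I. \<Sum>A\<in>Pow (I - {i}). lagrange_fps a A (sing_fps (a i)) * sing_sum a (I - {i} - A))"
      by (rule sing_sum_mult[OF assms])
    also have "\<dots> = (\<Sum>i\<in>I. \<Sum>A\<in>Pow (I - {i}). sing_sum a A * lagrange_fps a (I - {i} - A) (sing_fps (a i)))"
    proof (rule sum.cong[OF refl])
      fix i assume "i \<in> I"
      have "finite (I - {i})" using assms by simp
      from sum_Pow_compl[OF this, of "\<lambda>A B. lagrange_fps a A (sing_fps (a i)) * sing_sum a B"]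
      show "(\<Sum>A\<in>Pow (I - {i}). lagrange_fps a A (sing_fps (a i)) * sing_sum a (I - {i} - A))
          = (\<Sum>A\<in>Pow (I - {i}). sing_sum a A * lagrange_fps a (I - {i} - A) (sing_fps (a i)))"
        by (simp add: mult.commute)
    qed
    also have "\<dots> = (\<Sum>i\<in>I. \<Sum>j\<in>I - {i}. lagrange_fps a (I - {i} - {j}) (sing_fps (a j) * sing_fps (a i)))"
    proof (rule sum.cong[OF refl])
      fix i assume "i \<in> I"
      have fin: "finite (I - {i})" using assms by simp
      show "(\<Sum>A\<in>Pow (I - {i}). sing_sum a A * lagrange_fps a (I - {i} - A) (sing_fps (a i)))
         = (\<Sum>j\<in>I - {i}. lagrange_fps a (I - {i} - {j}) (sing_fps (a j) * sing_fps (a i)))"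
        unfolding sing_sum_mult[OF fin, of a "\<lambda>B. lagrange_fps a B (sing_fps (a i))"]
        using assms by (simp add: lagrange_fps_mult)
    qed
    finally show ?thesis .
  qed
  have "(\<Sum>A\<in>Pow I. disk_fps a A * disk_fps a (I - A))
     = (\<Sum>A\<in>Pow I. lagrange_fps a A half_sqrt * lagrange_fps a (I - A) half_sqrt)
       + (\<Sum>A\<in>Pow I. lagrange_fps a A half_sqrt * sing_sum a (I - A))
       + (\<Sum>A\<in>Pow I. sing_sum a A * lagrange_fps a (I - A) half_sqrt)
       + (\<Sum>A\<in>Pow I. sing_sum a A * sing_sum a (I - A))"
    by (simp only: disk_fps_def distrib_left distrib_right sum.distrib add_ac)
  also have "\<dots> = lagrange_fps a I (half_sqrt * half_sqrt)
     + 2 * (\<Sum>i\<in>I. lagrange_fps a (I - {i}) (half_sqrt * sing_fps (a i)))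
     + (\<Sum>i\<in>I. \<Sum>j\<in>I - {i}. lagrange_fps a (I - {i} - {j}) (sing_fps (a j) * sing_fps (a i)))"
    unfolding sh hs ss lagrange_fps_mult[OF assms] by (simp only: mult_2 add.assoc)
  finally show ?thesis .
qed

definition disk_coeff :: "('c \<Rightarrow> nat) \<Rightarrow> 'c set \<Rightarrow> nat \<Rightarrow> real" where
  "disk_coeff a I m = real m * cbin m * fact (2 * m + 2 * sum a I + card I - 2) / fact (2 * m + 2 * sum a I)"

definition disk_const :: "('c \<Rightarrow> nat) \<Rightarrow> 'c set \<Rightarrow> real" where
  "disk_const a I = (if I = {} then - 1/2 else 0) + (\<Sum>i\<in>I. if I = {i} then 1 / (2 * cbin (a i)) else 0)"

lemma fact_quot_pochhammer:
  "(fact (N + k) :: real) / fact N = pochhammer (real N + 1) k"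
  by (induction k) (simp_all add: pochhammer_Suc field_simps)

lemma disk_fps_high:
  assumes "finite I" "m \<ge> 1"
  shows "disk_fps a I $ (sum a I + m) = disk_coeff a I m"
proof -
  obtain k where m: "m = Suc k" using assms(2) by (cases m) auto
  define D where "D = sum a I"
  define M where "M = real m"
  define c where "c = cbin k"
  have M: "M \<ge> 1" using assms(2) by (simp add: M_def)
  have cb: "2 * (2 * M - 1) * c = M * cbin m"
    using cbin_Suc[of k] by (simp add: m M_def c_def)
  define R where "R = pochhammer (2 * M + 2 * real D + 1) (card I - 2)"
  have s2: "real (\<Sum>i\<in>A. 2 * a i) = 2 * real (sum a A)" for A
    by (simp add: sum_distrib_left)
  have sing: "lagrange_fps a (I - {i}) (sing_fps (a i)) $ (D + m)
      = - (lagrange (\<lambda>i. 2 * a i) (I - {i}) (2 * (M + real (a i))) * ((2 * real (a i) + 1) * c / (M + real (a i))))" if "i \<in> I" for i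
  proof -
    have D: "D = a i + sum a (I - {i})" unfolding D_def using assms(1) that by (simp add: sum.remove)
    have "sing_fps (a i) $ (a i + m) = - ((2 * real (a i) + 1) * c / (M + real (a i)))"
    proof -
      have "sing_fps (a i) $ (a i + m) = - (2 * real (a i) + 1) * c / (M + real (a i))"
        by (simp add: sing_fps_nth m M_def c_def add_ac)
      thus ?thesis by (simp only: minus_mult_left minus_divide_left)
    qed
    thus ?thesis unfolding lagrange_fps_nth
      by (simp add: D M_def add_ac)
  qed
  have half: "lagrange_fps a I half_sqrt $ (D + m) = lagrange (\<lambda>i. 2 * a i) I (2 * M) * c / M"
  proof -
    have "half_sqrt $ m = c / M" by (simp add: m half_sqrt_nth M_def c_def)
    thus ?thesis unfolding lagrange_fps_nth by (simp add: D_def M_def)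
  qed
  show ?thesis
  proof (cases "card I \<le> 1")
    case True
    hence "card I = 0 \<or> card I = 1" by linarith
    then consider "I = {}" | i where "I = {i}" using assms(1) by (auto simp: card_1_singleton_iff)
    thus ?thesis
    proof cases
      case 1
      have "(fact (2 * m) :: real) = real (2 * m) * (real (2 * m - 1) * fact (2 * m - 2))"
        using fact_reduce[of "2 * m", where 'a = real] fact_reduce[of "2 * m - 1", where 'a = real] m by simp
      hence f: "(fact (2 * m) :: real) = 2 * M * (2 * M - 1) * fact (2 * m - 2)"
        using assms(2) by (simp add: M_def of_nat_diff)
      have *: "c / M = M * C * F / (2 * M * (2 * M - 1) * F)" if "F > 0" "2 * (2 * M - 1) * c = M * C" for C F :: real
        using that(1) M by (simp add: that(2)[symmetric]) (simp add: field_simps)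
      have "disk_fps a I $ (D + m) = c / M"
        using half 1 by (simp add: disk_fps_def sing_sum_def)
      also have "\<dots> = disk_coeff a I m"
        unfolding disk_coeff_def 1 using *[OF _ cb, of "fact (2 * m - 2)"] by (simp add: f M_def)
      finally show ?thesis by (simp add: D_def)
    next
      case 2
      define y where "y = real D"
      have y: "y \<ge> 0" "real (a i) = y" using 2 by (simp_all add: y_def D_def)
      have "(fact (2 * m + 2 * D) :: real) = real (2 * m + 2 * D) * fact (2 * m + 2 * D - 1)"
        using assms(2) by (intro fact_reduce) simp
      hence f: "(fact (2 * m + 2 * D) :: real) = 2 * (M + y) * fact (2 * m + 2 * D - 1)"
        by (simp add: M_def y_def)
      have *: "2 * c - (2 * y + 1) * c / (M + y) = M * C * F / (2 * (M + y) * F)" if "F > 0" "2 * (2 * M - 1) * c = M * C" for C F :: real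
        using that(1) M y(1) by (simp add: that(2)[symmetric]) (simp add: field_simps)
      have "lagrange (\<lambda>i. 2 * a i) I (2 * M) = 2 * M" using 2 by (simp add: lagrange_def)
      hence "disk_fps a I $ (D + m) = 2 * c - (2 * y + 1) * c / (M + y)"
        using half sing[of i] 2 M unfolding disk_fps_def sing_sum_def by (simp add: y)
      also have "\<dots> = disk_coeff a I m"
        unfolding disk_coeff_def D_def[symmetric] f *[OF fact_gt_zero cb, of "2 * m + 2 * D - 1"] using 2
        by (simp add: M_def)
      finally show ?thesis by (simp add: D_def)
    qed
  next
    case False
    define n where "n = card I - 2"
    have n: "card I = Suc (Suc n)" using False by (simp add: n_def)
    have li: "lagrange_fps a (I - {i}) (sing_fps (a i)) $ (D + m) = - 2 * R * c * (2 * real (a i) + 1)" if "i \<in> I" for i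
    proof -
      have cd: "card (I - {i}) = Suc n" using n that assms(1) by simp
      hence ne: "I - {i} \<noteq> {}" by (metis card.empty nat.distinct(1))
      have D: "D = a i + sum a (I - {i})" unfolding D_def using assms(1) that by (simp add: sum.remove)
      have "lagrange (\<lambda>i. 2 * a i) (I - {i}) (2 * (M + real (a i))) = 2 * (M + real (a i)) * R"
        unfolding lagrange_def s2 if_not_P[OF ne] cd R_def D n by (simp add: algebra_simps)
      moreover have "M + real (a i) > 0" using M by linarith
      ultimately show ?thesis unfolding sing[OF that] by (simp add: field_simps)
    qed
    have "lagrange (\<lambda>i. 2 * a i) I (2 * M) = 2 * M * pochhammer (2 * M + 2 * real D + 1) (Suc n)"
      using n unfolding lagrange_def s2 D_def by auto
    hence l0: "lagrange (\<lambda>i. 2 * a i) I (2 * M) = 2 * M * (R * (2 * M + 2 * real D + 1 + real n))"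
      by (simp add: R_def n pochhammer_Suc)
    have "sing_sum a I $ (D + m) = (\<Sum>i\<in>I. - 2 * R * c * (2 * real (a i) + 1))"
      unfolding sing_sum_def fps_sum_nth by (intro sum.cong refl) (simp add: li)
    also have "\<dots> = - 2 * R * c * (2 * (\<Sum>i\<in>I. real (a i)) + (\<Sum>i\<in>I. 1))"
      unfolding sum_distrib_left[symmetric] sum.distrib ..
    also have "\<dots> = - 2 * R * c * (2 * real D + real n + 2)"
      by (simp add: n D_def)
    finally have "disk_fps a I $ (D + m) = R * (2 * (2 * M - 1) * c)"
      unfolding disk_fps_def using half M by (simp add: l0) (simp add: algebra_simps)
    also have "\<dots> = R * M * cbin m" unfolding cb by simp
    also have "R = fact (2 * m + 2 * D + n) / fact (2 * m + 2 * D)"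
      unfolding fact_quot_pochhammer R_def n M_def by simp
    finally show ?thesis unfolding disk_coeff_def by (simp add: D_def n M_def)
  qed
qed

lemma disk_fps_low:
  assumes "finite I" "N \<le> sum a I"
  shows "disk_fps a I $ N = (if N = 0 then disk_const a I else 0)"
proof -
  have "lagrange_fps a (I - {i}) (sing_fps (a i)) $ N = (if N = 0 \<and> I = {i} then 1 / (2 * cbin (a i)) else 0)"
    if "i \<in> I" for i
  proof -
    define t where "t = sum a (I - {i})"
    have le: "N \<le> a i + t" using assms that by (simp add: sum.remove t_def)
    have nth: "lagrange_fps a (I - {i}) (sing_fps (a i)) $ N = (if N < t then 0
       else lagrange (\<lambda>i. 2 * a i) (I - {i}) (2 * real (N - t)) * sing_fps (a i) $ (N - t))"
      by (simp only: lagrange_fps_nth t_def)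
    show ?thesis
    proof (cases "I = {i}")
      case True
      hence "t = 0" by (simp add: t_def)
      thus ?thesis unfolding nth using le True by (auto simp: sing_fps_nth)
    next
      case False
      hence "I - {i} \<noteq> {}" using that by auto
      hence "lagrange (\<lambda>i. 2 * a i) (I - {i}) 0 = 0" by (rule lagrange_0)
      thus ?thesis unfolding nth using le False by (cases "N = t") (auto simp: sing_fps_nth)
    qed
  qed
  hence 1: "sing_sum a I $ N = (\<Sum>i\<in>I. if N = 0 \<and> I = {i} then 1 / (2 * cbin (a i)) else 0)"
    unfolding sing_sum_def fps_sum_nth by (intro sum.cong) auto
  have 2: "lagrange_fps a I half_sqrt $ N = (if N = 0 \<and> I = {} then - 1/2 else 0)"
  proof (cases "I = {}")
    case True
    thus ?thesis using assms(2) by (simp add: lagrange_fps_nth half_sqrt_nth)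
  next
    case False
    thus ?thesis using assms(2) by (auto simp: lagrange_fps_nth lagrange_0 not_less dest: le_antisym)
  qed
  show ?thesis unfolding disk_fps_def disk_const_def using 1 2 by (cases "N = 0") auto
qed

definition disk_tail :: "('c \<Rightarrow> nat) \<Rightarrow> 'c set \<Rightarrow> real fps" where
  "disk_tail a I = Abs_fps (\<lambda>m. if m = 0 then 0 else disk_coeff a I m)"

lemma disk_fps_split:
  assumes "finite I"
  shows "disk_fps a I = fps_const (disk_const a I) + fps_X ^ sum a I * disk_tail a I"
proof (rule fps_ext)
  fix N
  show "disk_fps a I $ N = (fps_const (disk_const a I) + fps_X ^ sum a I * disk_tail a I) $ N"
  proof (cases "N \<le> sum a I")
    case True
    thus ?thesis using disk_fps_low[OF assms True]
      by (auto simp: disk_tail_def fps_X_power_mult_nth)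
  next
    case False
    then obtain m where N: "N = sum a I + m" and m: "m \<ge> 1"
      by (metis add.commute add_diff_inverse_nat diff_is_0_eq less_one linorder_not_less nat_le_linear)
    show ?thesis unfolding N disk_fps_high[OF assms m] using m
      by (auto simp: disk_tail_def fps_X_power_mult_nth)
  qed
qed

lemma disk_fps_mult_nth:
  assumes "finite I" "A \<subseteq> I" "m \<ge> 1"
  shows "(disk_fps a A * disk_fps a (I - A)) $ (sum a I + m)
     = disk_const a A * disk_coeff a (I - A) (sum a A + m)
       + disk_const a (I - A) * disk_coeff a A (sum a (I - A) + m)
       + (\<Sum>i\<in>{1..<m}. disk_coeff a A i * disk_coeff a (I - A) (m - i))"
proof -
  define p q where "p = sum a A" and "q = sum a (I - A)"
  define S T where "S = disk_tail a A" and "T = disk_tail a (I - A)"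
  define c e where "c = disk_const a A" and "e = disk_const a (I - A)"
  have fin: "finite A" "finite (I - A)" using assms by (auto intro: finite_subset)
  have sum: "sum a I = p + q"
    unfolding p_def q_def using assms sum.subset_diff[of A I a] by simp
  have "disk_fps a A * disk_fps a (I - A) = fps_const (c * e) + fps_const c * (fps_X ^ q * T)
      + fps_const e * (fps_X ^ p * S) + fps_X ^ (p + q) * (S * T)"
    unfolding disk_fps_split[OF fin(1)] disk_fps_split[OF fin(2)] p_def[symmetric] q_def[symmetric]
      S_def[symmetric] T_def[symmetric] c_def[symmetric] e_def[symmetric]
    by (simp add: algebra_simps power_add)
  also have "\<dots> $ (p + q + m) = c * T $ (p + m) + e * S $ (q + m) + (S * T) $ m"
    using assms(3) by (simp add: fps_X_power_mult_nth add_ac)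
  also have "(S * T) $ m = (\<Sum>i\<in>{1..<m}. disk_coeff a A i * disk_coeff a (I - A) (m - i))"
    unfolding fps_mult_nth
    by (rule sum.mono_neutral_cong_right) (auto simp: S_def T_def disk_tail_def)
  finally show ?thesis using assms(3)
    by (simp add: sum S_def T_def disk_tail_def c_def e_def p_def[symmetric] q_def[symmetric])
qed

lemma sum_disk_const:
  assumes "finite I"
  shows "(\<Sum>A\<in>Pow I. disk_const a A * F A) = - F {} / 2 + (\<Sum>i\<in>I. F {i} / (2 * cbin (a i)))"
proof -
  have "(\<Sum>A\<in>Pow I. disk_const a A * F A) = (\<Sum>A\<in>Pow I. (if A = {} then - F {} / 2 else 0))
      + (\<Sum>A\<in>Pow I. \<Sum>i\<in>A. if A = {i} then F {i} / (2 * cbin (a i)) else 0)"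
    unfolding sum.distrib[symmetric] disk_const_def distrib_right sum_distrib_right
    by (intro sum.cong arg_cong2[where f = "(+)"]) auto
  also have "(\<Sum>A\<in>Pow I. (if A = {} then - F {} / 2 else 0)) = - F {} / 2"
    using assms by (subst sum.delta) auto
  also have "(\<Sum>A\<in>Pow I. \<Sum>i\<in>A. if A = {i} then F {i} / (2 * cbin (a i)) else 0)
      = (\<Sum>i\<in>I. \<Sum>A\<in>Pow (I - {i}). if insert i A = {i} then F {i} / (2 * cbin (a i)) else 0)"
    by (rule sum_Pow_remove[OF assms])
  also have "\<dots> = (\<Sum>i\<in>I. \<Sum>A\<in>Pow (I - {i}). if A = {} then F {i} / (2 * cbin (a i)) else 0)"
    by (intro sum.cong refl) auto
  also have "\<dots> = (\<Sum>i\<in>I. F {i} / (2 * cbin (a i)))"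
    using assms by (intro sum.cong refl) (subst sum.delta, auto)
  finally show ?thesis .
qed

lemma lagrange_cancellation:
  assumes "finite I"
  shows "2 * (\<Sum>i\<in>I. lagrange b (I - {i}) (2 + real (b i))) - lagrange b I 2
     - (\<Sum>i\<in>I. \<Sum>j\<in>I - {i}. lagrange b (I - {i} - {j}) (2 + real (b i) + real (b j)))
     = (if I = {} then - 1 else 0)"
proof -
  have "lagrange b I 2 = lagrange b I 1 + (\<Sum>i\<in>I. lagrange b (I - {i}) (2 + real (b i)))"
    using lagrange_rec[OF assms, of b 2] by simp
  moreover have "lagrange b I 1 = lagrange b I 0 + (\<Sum>i\<in>I. lagrange b (I - {i}) (1 + real (b i)))"
    using lagrange_rec[OF assms, of b 1] by simp
  moreover have "(\<Sum>i\<in>I. lagrange b (I - {i}) (2 + real (b i))) = (\<Sum>i\<in>I. lagrange b (I - {i}) (1 + real (b i)))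
      + (\<Sum>i\<in>I. \<Sum>j\<in>I - {i}. lagrange b (I - {i} - {j}) (2 + real (b i) + real (b j)))"
    unfolding sum.distrib[symmetric]
  proof (rule sum.cong[OF refl])
    fix i
    show "lagrange b (I - {i}) (2 + real (b i)) = lagrange b (I - {i}) (1 + real (b i))
        + (\<Sum>j\<in>I - {i}. lagrange b (I - {i} - {j}) (2 + real (b i) + real (b j)))"
      using lagrange_rec[of "I - {i}" b "2 + real (b i)"] assms by simp
  qed
  moreover have "lagrange b I 0 = (if I = {} then 1 else 0)" by (simp add: lagrange_0)
  ultimately show ?thesis by simp
qed

theorem disk_coeff_rec:
  assumes "finite I" "m \<ge> 1"
  shows "disk_coeff a I m = (if I = {} \<and> m = 1 then 1 else 0)
     + (\<Sum>i\<in>I. disk_coeff a (I - {i}) (a i + m) / cbin (a i))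
     + (\<Sum>A\<in>Pow I. \<Sum>i\<in>{1..<m}. disk_coeff a A i * disk_coeff a (I - A) (m - i))"
proof -
  define D where "D = sum a I"
  define b where "b i = 2 * a i" for i
  have cc: "(\<Sum>A\<in>Pow I. disk_const a A * disk_coeff a (I - A) (sum a A + m))
      = - disk_coeff a I m / 2 + (\<Sum>i\<in>I. disk_coeff a (I - {i}) (a i + m) / (2 * cbin (a i)))"
    using sum_disk_const[OF assms(1), of a "\<lambda>A. disk_coeff a (I - A) (sum a A + m)"] by simp
  have cc': "(\<Sum>A\<in>Pow I. disk_const a (I - A) * disk_coeff a A (sum a (I - A) + m))
      = (\<Sum>A\<in>Pow I. disk_const a A * disk_coeff a (I - A) (sum a A + m))"
    using sum_Pow_compl[OF assms(1), of "\<lambda>A B. disk_const a B * disk_coeff a A (sum a B + m)"] by simp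
  have "(\<Sum>A\<in>Pow I. disk_fps a A * disk_fps a (I - A)) $ (D + m)
     = - disk_coeff a I m + 2 * (\<Sum>i\<in>I. disk_coeff a (I - {i}) (a i + m) / (2 * cbin (a i)))
       + (\<Sum>A\<in>Pow I. \<Sum>i\<in>{1..<m}. disk_coeff a A i * disk_coeff a (I - A) (m - i))"
  proof -
    have "(\<Sum>A\<in>Pow I. disk_fps a A * disk_fps a (I - A)) $ (D + m)
       = (\<Sum>A\<in>Pow I. disk_const a A * disk_coeff a (I - A) (sum a A + m)
       + disk_const a (I - A) * disk_coeff a A (sum a (I - A) + m)
       + (\<Sum>i\<in>{1..<m}. disk_coeff a A i * disk_coeff a (I - A) (m - i)))"
      unfolding fps_sum_nth D_def using assms by (intro sum.cong refl disk_fps_mult_nth) auto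
    thus ?thesis unfolding sum.distrib cc' cc by simp
  qed
  also have "2 * (\<Sum>i\<in>I. disk_coeff a (I - {i}) (a i + m) / (2 * cbin (a i)))
      = (\<Sum>i\<in>I. disk_coeff a (I - {i}) (a i + m) / cbin (a i))"
    by (simp add: sum_distrib_left)
  finally have left: "(\<Sum>A\<in>Pow I. disk_fps a A * disk_fps a (I - A)) $ (D + m)
     = - disk_coeff a I m + (\<Sum>i\<in>I. disk_coeff a (I - {i}) (a i + m) / cbin (a i))
       + (\<Sum>A\<in>Pow I. \<Sum>i\<in>{1..<m}. disk_coeff a A i * disk_coeff a (I - A) (m - i))" .
  have Di: "D = a i + sum a (I - {i})" if "i \<in> I" for i
    unfolding D_def using assms(1) that by (simp add: sum.remove)
  have Dij: "D = a i + (a j + sum a (I - {i} - {j}))" if "i \<in> I" "j \<in> I - {i}" for i j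
    using Di[OF that(1)] sum.remove[OF _ that(2), of a] assms(1) by simp
  have t1: "lagrange_fps a I (half_sqrt * half_sqrt) $ (D + m) = (if m = 1 then - lagrange b I 2 else 0)"
    using assms(2) by (auto simp: lagrange_fps_nth D_def half_sqrt_square b_def[abs_def] fps_X_nth)
  have t2: "lagrange_fps a (I - {i}) (half_sqrt * sing_fps (a i)) $ (D + m)
     = (if m = 1 then lagrange b (I - {i}) (2 + real (b i)) else 0)" if "i \<in> I" for i
  proof -
    have "(half_sqrt * sing_fps (a i)) $ (a i + m) = (if m = 1 then 1 else 0)"
      using assms(2) by (subst half_sqrt_sing_nth) auto
    thus ?thesis by (simp add: lagrange_fps_nth Di[OF that] b_def[abs_def] add.commute)
  qed
  have t3: "lagrange_fps a (I - {i} - {j}) (sing_fps (a j) * sing_fps (a i)) $ (D + m)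
     = (if m = 1 then - lagrange b (I - {i} - {j}) (2 + real (b i) + real (b j)) else 0)"
     if "i \<in> I" "j \<in> I - {i}" for i j
  proof -
    have "(sing_fps (a j) * sing_fps (a i)) $ (a i + (a j + m)) = (if m = 1 then - 1 else 0)"
      using assms(2) by (subst sing_sing_nth) auto
    thus ?thesis by (simp add: lagrange_fps_nth Dij[OF that] b_def[abs_def] add_ac)
  qed
  have "(\<Sum>A\<in>Pow I. disk_fps a A * disk_fps a (I - A)) $ (D + m)
     = (if m = 1 then - lagrange b I 2 else 0)
       + 2 * (\<Sum>i\<in>I. if m = 1 then lagrange b (I - {i}) (2 + real (b i)) else 0)
       + (\<Sum>i\<in>I. \<Sum>j\<in>I - {i}. if m = 1 then - lagrange b (I - {i} - {j}) (2 + real (b i) + real (b j)) else 0)"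
    unfolding disk_fps_convolution[OF assms(1)] fps_add_nth numeral_fps_const fps_mult_left_const_nth fps_sum_nth t1
    using t2 t3 by simp
  also have "\<dots> = (if I = {} \<and> m = 1 then - 1 else 0)"
    using lagrange_cancellation[OF assms(1), of b] by (auto simp: sum_negf)
  finally have "- disk_coeff a I m + (\<Sum>i\<in>I. disk_coeff a (I - {i}) (a i + m) / cbin (a i))
       + (\<Sum>A\<in>Pow I. \<Sum>i\<in>{1..<m}. disk_coeff a A i * disk_coeff a (I - A) (m - i))
     = (if I = {} \<and> m = 1 then - 1 else 0)" by (rule trans[OF left[symmetric]])
  thus ?thesis by (smt (verit))
qed

section \<open>Monotone walks and their decomposition\<close>

abbreviation transp :: "nat \<Rightarrow> nat \<Rightarrow> nat \<Rightarrow> nat" where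
  "transp \<equiv> Transposition.transpose"

abbreviation inside :: "'b set \<Rightarrow> ('a \<times> 'b) list \<Rightarrow> ('a \<times> 'b) list" where
  "inside A \<equiv> filter (\<lambda>e. snd e \<in> A)"

abbreviation outside :: "'b set \<Rightarrow> ('a \<times> 'b) list \<Rightarrow> ('a \<times> 'b) list" where
  "outside A \<equiv> filter (\<lambda>e. snd e \<notin> A)"

abbreviation separators :: "'a set \<Rightarrow> 'a \<Rightarrow> 'a \<Rightarrow> 'a set set" where
  "separators S m s \<equiv> {A. A \<subseteq> S \<and> m \<in> A \<and> s \<notin> A}"

fun wprod :: "(nat \<times> nat) list \<Rightarrow> nat \<Rightarrow> nat" where
  "wprod [] = id"
| "wprod ((s, t) # w) = transp s t \<circ> wprod w"

lemma wprod_append: "wprod (u @ v) = wprod u \<circ> wprod v"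
  by (induction u rule: wprod.induct) (simp_all add: comp_assoc)

definition steps_in :: "nat set \<Rightarrow> (nat \<times> nat) list \<Rightarrow> bool" where
  "steps_in S w \<longleftrightarrow> (\<forall>(s, t)\<in>set w. s \<in> S \<and> t \<in> S \<and> s < t)"

definition closed_under :: "(nat \<times> nat) list \<Rightarrow> nat set \<Rightarrow> bool" where
  "closed_under w A \<longleftrightarrow> (\<forall>(s, t)\<in>set w. s \<in> A \<longleftrightarrow> t \<in> A)"

definition linked :: "nat set \<Rightarrow> (nat \<times> nat) list \<Rightarrow> bool" where
  "linked S w \<longleftrightarrow> (\<forall>A. A \<subseteq> S \<longrightarrow> A \<noteq> {} \<longrightarrow> closed_under w A \<longrightarrow> A = S)"

definition monotone_walks :: "nat set \<Rightarrow> nat \<Rightarrow> (nat \<Rightarrow> nat) \<Rightarrow> (nat \<times> nat) list set" where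
  "monotone_walks S r p = {w. length w = r \<and> steps_in S w \<and> sorted (map snd w) \<and>
     (\<forall>x\<in>S. wprod w x = p x) \<and> linked S w}"

lemma closed_under_Cons:
  "closed_under ((s, t) # w) A \<longleftrightarrow> (s \<in> A \<longleftrightarrow> t \<in> A) \<and> closed_under w A"
  by (simp add: closed_under_def)

lemma transpose_in_iff:
  "(s \<in> A \<longleftrightarrow> t \<in> A) \<Longrightarrow> transp s t x \<in> A \<longleftrightarrow> x \<in> A"
  by (cases "x = s"; cases "x = t") simp_all

lemma wprod_in_closed:
  "closed_under w A \<Longrightarrow> wprod w x \<in> A \<longleftrightarrow> x \<in> A"
  by (induction w rule: wprod.induct) (simp_all add: closed_under_Cons transpose_in_iff)

lemma wprod_filter:
  assumes "closed_under w A" "x \<in> A"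
  shows "wprod w x = wprod (inside A w) x"
  using assms(1)
proof (induction w rule: wprod.induct)
  case (2 s t w)
  hence cl: "s \<in> A \<longleftrightarrow> t \<in> A" "closed_under w A" by (simp_all add: closed_under_Cons)
  have A: "wprod w x \<in> A" using wprod_in_closed[OF cl(2)] assms(2) by simp
  have IH: "wprod w x = wprod (inside A w) x" using 2 cl by simp
  show ?case
  proof (cases "t \<in> A")
    case True
    thus ?thesis by (simp add: IH)
  next
    case False
    hence "wprod w x \<noteq> s" "wprod w x \<noteq> t" using A cl by auto
    thus ?thesis using False by (simp add: IH)
  qed
qed simp

lemma closed_under_Int: "closed_under w A \<Longrightarrow> closed_under w B \<Longrightarrow> closed_under w (A \<inter> B)"
  by (auto simp: closed_under_def)

lemma closed_under_Un: "closed_under w A \<Longrightarrow> closed_under w B \<Longrightarrow> closed_under w (A \<union> B)"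
  by (auto simp: closed_under_def)

lemma closed_under_Diff: "closed_under w A \<Longrightarrow> closed_under w B \<Longrightarrow> closed_under w (A - B)"
  by (auto simp: closed_under_def)

lemma closed_under_steps_in: "steps_in S w \<Longrightarrow> closed_under w S"
  by (auto simp: closed_under_def steps_in_def)

lemma closed_under_filter:
  assumes "closed_under w A" "B \<subseteq> A"
  shows "closed_under (inside A w) B \<longleftrightarrow> closed_under w B"
proof
  assume B: "closed_under (inside A w) B"
  show "closed_under w B"
    unfolding closed_under_def
  proof safe
    fix s t assume st: "(s, t) \<in> set w"
    hence A: "s \<in> A \<longleftrightarrow> t \<in> A" using assms(1) by (auto simp: closed_under_def)
    have "t \<in> A \<Longrightarrow> s \<in> B \<longleftrightarrow> t \<in> B" using B st by (auto simp: closed_under_def)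
    thus "s \<in> B \<Longrightarrow> t \<in> B" "t \<in> B \<Longrightarrow> s \<in> B" using A assms(2) by blast+
  qed
qed (auto simp: closed_under_def)

lemma linked_filter_split:
  assumes "steps_in S w" "closed_under w A" "A \<subseteq> S"
  shows "linked A (inside A w) \<longleftrightarrow> (\<forall>B. B \<subseteq> A \<longrightarrow> B \<noteq> {} \<longrightarrow> closed_under w B \<longrightarrow> B = A)"
  using assms(2) unfolding linked_def by (auto simp: closed_under_filter)

lemma sort_key_split:
  fixes w :: "('a \<times> 'b :: linorder) list"
  assumes "sorted (map snd w)"
  shows "sort_key snd (inside A w @ outside A w) = w"
proof (rule properties_for_sort_key)
  show "mset w = mset (inside A w @ outside A w)"
    by (simp flip: multiset_partition)
  fix k assume "k \<in> set w"
  show "filter (\<lambda>x. snd k = snd x) w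
      = filter (\<lambda>x. snd k = snd x) (inside A w @ outside A w)"
  proof (cases "snd k \<in> A")
    case True
    hence "(\<lambda>x :: 'a \<times> 'b. snd x \<in> A \<and> snd k = snd x) = (\<lambda>x. snd k = snd x)"
      "(\<lambda>x :: 'a \<times> 'b. snd x \<notin> A \<and> snd k = snd x) = (\<lambda>x. False)" by auto
    thus ?thesis by (simp only: filter_append filter_filter) simp
  next
    case False
    hence "(\<lambda>x :: 'a \<times> 'b. snd x \<notin> A \<and> snd k = snd x) = (\<lambda>x. snd k = snd x)"
      "(\<lambda>x :: 'a \<times> 'b. snd x \<in> A \<and> snd k = snd x) = (\<lambda>x. False)" by auto
    thus ?thesis by (simp only: filter_append filter_filter) simp
  qed
qed (use assms in simp)

definition split_walks :: "nat set \<Rightarrow> nat set \<Rightarrow> nat \<Rightarrow> (nat \<Rightarrow> nat) \<Rightarrow> (nat \<times> nat) list set" where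
  "split_walks S A r p = {w. length w = r \<and> steps_in S w \<and> sorted (map snd w) \<and>
     (\<forall>x\<in>S. wprod w x = p x) \<and> closed_under w A \<and>
     linked A (inside A w) \<and> linked (S - A) (outside A w)}"

lemma finite_walks_length:
  assumes "finite S"
  shows "finite {w. length w = r \<and> steps_in S w}"
proof -
  have "{w. length w = r \<and> steps_in S w} \<subseteq> {w. set w \<subseteq> S \<times> S \<and> length w = r}"
    by (auto simp: steps_in_def)
  moreover have "finite {w. set w \<subseteq> S \<times> S \<and> length w = r}"
    using assms by (intro finite_lists_length_eq) auto
  ultimately show ?thesis by (rule finite_subset)
qed

lemma finite_monotone_walks: "finite S \<Longrightarrow> finite (monotone_walks S r p)"
  by (rule finite_subset[OF _ finite_walks_length[of S r]]) (auto simp: monotone_walks_def)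

lemma finite_split_walks: "finite S \<Longrightarrow> finite (split_walks S A r p)"
  by (rule finite_subset[OF _ finite_walks_length[of S r]]) (auto simp: split_walks_def)

lemma card_split_walks:
  assumes "finite S" "A \<subseteq> S"
  shows "card (split_walks S A r p)
     = (\<Sum>k\<le>r. card (monotone_walks A k p) * card (monotone_walks (S - A) (r - k) p))"
proof -
  have fin: "finite A" "finite (S - A)" using assms finite_subset by auto
  define T where "T = (SIGMA k:{..r}. monotone_walks A k p \<times> monotone_walks (S - A) (r - k) p)"
  have "bij_betw (\<lambda>w. (length (inside A w), inside A w, outside A w))
      (split_walks S A r p) T"
  proof (rule bij_betw_byWitness[where f' = "\<lambda>(k, u, v). sort_key snd (u @ v)"])
    show "\<forall>w\<in>split_walks S A r p. (case (length (inside A w), inside A w,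
        outside A w) of (k, u, v) \<Rightarrow> sort_key snd (u @ v)) = w"
      by (simp add: split_walks_def sort_key_split)
    have fl: "inside A (sort_key snd (u @ v)) = u"
         "outside A (sort_key snd (u @ v)) = v"
      if "u \<in> monotone_walks A k p" "v \<in> monotone_walks (S - A) l p" for u v k l
    proof -
      have "steps_in A u" "steps_in (S - A) v" using that by (auto simp: monotone_walks_def)
      hence "\<forall>e\<in>set u. snd e \<in> A" "\<forall>e\<in>set v. snd e \<notin> A" by (auto simp: steps_in_def)
      hence "inside A u = u" "inside A v = []"
        "outside A u = []" "outside A v = v"
        by (simp_all add: filter_id_conv filter_empty_conv)
      moreover have "sort_key snd u = u" "sort_key snd v = v"
        using that by (auto simp: monotone_walks_def sort_key_id_if_sorted)
      ultimately show "inside A (sort_key snd (u @ v)) = u"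
         "outside A (sort_key snd (u @ v)) = v"
        by (simp_all add: filter_sort)
    qed
    show "\<forall>x\<in>T. (\<lambda>w. (length (inside A w), inside A w, outside A w))
        (case x of (k, u, v) \<Rightarrow> sort_key snd (u @ v)) = x"
    proof (rule ballI)
      fix x assume "x \<in> T"
      then obtain k u v where x: "x = (k, u, v)" and "(k, u, v) \<in> T" by (cases x) auto
      hence uv: "u \<in> monotone_walks A k p" "v \<in> monotone_walks (S - A) (r - k) p"
        by (auto simp: T_def)
      hence "length u = k" by (simp add: monotone_walks_def)
      thus "(\<lambda>w. (length (inside A w), inside A w, outside A w))
        (case x of (k, u, v) \<Rightarrow> sort_key snd (u @ v)) = x"
        using fl[OF uv] by (simp add: x)
    qed
    show "(\<lambda>w. (length (inside A w), inside A w, outside A w))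
        ` split_walks S A r p \<subseteq> T"
    proof safe
      fix w assume w: "w \<in> split_walks S A r p"
      define u v where "u = inside A w" and "v = outside A w"
      have cl: "closed_under w A" and st: "steps_in S w" and len: "length w = r" using w by (auto simp: split_walks_def)
      have v: "v = inside (S - A) w"
        unfolding v_def using st by (intro filter_cong) (auto simp: steps_in_def)
      have cl': "closed_under w (S - A)" using cl closed_under_steps_in[OF st] by (rule closed_under_Diff[rotated])
      have "length u + length v = r" unfolding u_def v_def using len sum_length_filter_compl by blast
      hence "length v = r - length u" "length u \<le> r" by auto
      moreover have "sorted (map snd u)" "sorted (map snd v)"
        using w unfolding u_def v_def by (auto simp: split_walks_def intro: sorted_filter)
      moreover have "steps_in A u" "steps_in (S - A) v"
        using st cl by (auto simp: u_def v_def steps_in_def closed_under_def)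
      moreover have "\<forall>x\<in>A. wprod u x = p x"
        using w subsetD[OF assms(2)] wprod_filter[OF cl, symmetric] by (simp add: u_def split_walks_def)
      moreover have "\<forall>x\<in>S-A. wprod v x = p x"
        using w wprod_filter[OF cl'] by (auto simp: v split_walks_def)
      moreover have "linked A u" "linked (S - A) v" using w by (auto simp: u_def v_def split_walks_def)
      ultimately have "(length u, u, v) \<in> T" by (auto simp: T_def monotone_walks_def)
      thus "(length (inside A w), inside A w, outside A w) \<in> T"
        by (simp add: u_def v_def)
    qed
    show "(\<lambda>(k, u, v). sort_key snd (u @ v)) ` T \<subseteq> split_walks S A r p"
    proof safe
      fix k u v assume T: "(k, u, v) \<in> T"
      hence u: "u \<in> monotone_walks A k p" and v: "v \<in> monotone_walks (S - A) (r - k) p" and k: "k \<le> r"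
        by (auto simp: T_def)
      define w where "w = sort_key snd (u @ v)"
      have fu: "inside A w = u" and fv: "outside A w = v"
        using fl[OF u v] by (auto simp: w_def)
      have set: "set w = set u \<union> set v" by (simp add: w_def)
      have suv: "steps_in A u" "steps_in (S - A) v" using u v by (auto simp: monotone_walks_def)
      hence cl: "closed_under w A" by (auto simp: closed_under_def set steps_in_def)
      have st: "steps_in S w" using suv assms(2) by (auto simp: set steps_in_def)
      have cl': "closed_under w (S - A)" using cl closed_under_steps_in[OF st] by (rule closed_under_Diff[rotated])
      have v': "v = inside (S - A) w"
        unfolding fv[symmetric] using st by (intro filter_cong) (auto simp: steps_in_def)
      have "length w = r" using u v k by (simp add: w_def monotone_walks_def)
      moreover have "sorted (map snd w)" unfolding w_def by (rule sorted_sort_key)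
      moreover have "wprod w x = p x" if "x \<in> S" for x
      proof (cases "x \<in> A")
        case True
        thus ?thesis using wprod_filter[OF cl True] u by (simp add: fu monotone_walks_def)
      next
        case False
        hence x: "x \<in> S - A" using that by simp
        thus ?thesis using wprod_filter[OF cl' x, folded v'] v x by (simp add: monotone_walks_def)
      qed
      moreover have "linked A u" "linked (S - A) v" using u v by (auto simp: monotone_walks_def)
      ultimately show "sort_key snd (u @ v) \<in> split_walks S A r p"
        using st cl unfolding w_def[symmetric] by (simp add: split_walks_def fu fv)
    qed
  qed
  hence "card (split_walks S A r p) = card T" by (rule bij_betw_same_card)
  also have "\<dots> = (\<Sum>k\<le>r. card (monotone_walks A k p) * card (monotone_walks (S - A) (r - k) p))"
    unfolding T_def using fin by (subst card_SigmaI) (auto simp: finite_monotone_walks card_cartesian_product)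
  finally show ?thesis .
qed

lemma steps_in_snoc: "steps_in S (w @ [(s, t)]) \<longleftrightarrow> steps_in S w \<and> s \<in> S \<and> t \<in> S \<and> s < t"
  by (auto simp: steps_in_def)

lemma closed_under_snoc:
  "closed_under (w @ [(s, t)]) A \<longleftrightarrow> closed_under w A \<and> (s \<in> A \<longleftrightarrow> t \<in> A)"
  by (auto simp: closed_under_def)

lemma linkedD: "linked S w \<Longrightarrow> A \<subseteq> S \<Longrightarrow> x \<in> A \<Longrightarrow> closed_under w A \<Longrightarrow> A = S"
  by (auto simp: linked_def)

lemma linked_snoc_mono: "linked S w \<Longrightarrow> linked S (w @ [e])"
  unfolding linked_def by (cases e) (simp add: closed_under_snoc)

lemma linked_snoc_iff:
  assumes "steps_in S w" "s \<in> S" "m \<in> S"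
  shows "linked S (w @ [(s, m)]) \<longleftrightarrow> linked S w \<or>
     (\<exists>A. A \<subseteq> S \<and> m \<in> A \<and> s \<notin> A \<and> closed_under w A \<and>
       linked A (inside A w) \<and> linked (S - A) (outside A w))"
    (is "?L \<longleftrightarrow> linked S w \<or> ?R")
proof (intro iffI disjCI)
  note split = linked_filter_split[OF assms(1)]
  have compl: "outside A w = inside (S - A) w" for A
    using assms(1) by (intro filter_cong refl) (auto simp: steps_in_def)
  have clS: "closed_under w S" using assms(1) by (rule closed_under_steps_in)
  {
    assume L: ?L and not: "\<not> ?R"
    show "linked S w"
      unfolding linked_def
    proof (intro allI impI, rule ccontr)
      fix B assume B: "B \<subseteq> S" "B \<noteq> {}" "closed_under w B" "B \<noteq> S"
      define A where "A = (if m \<in> B then B else S - B)"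
      have A: "A \<subseteq> S" "m \<in> A" "closed_under w A" "A \<noteq> S"
        unfolding A_def using B assms(3) closed_under_Diff[OF clS B(3)] by (cases "m \<in> B"; force)+
      have sA: "s \<notin> A"
        using linkedD[OF L A(1,2)] A by (auto simp: closed_under_snoc)
      have notboth: "C = S" if "C \<subseteq> S" "C \<noteq> {}" "closed_under w C" "s \<in> C \<longleftrightarrow> m \<in> C" for C
        using that L by (simp add: linked_def closed_under_snoc)
      have "linked A (inside A w)"
        unfolding split[OF A(3,1)]
      proof (intro allI impI, rule ccontr)
        fix C assume C: "C \<subseteq> A" "C \<noteq> {}" "closed_under w C" "C \<noteq> A"
        show False
        proof (cases "m \<in> C")
          case True
          have "A - C = S"
            using C(1,4) A(1) sA True by (intro notboth closed_under_Diff[OF A(3) C(3)]) blast+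
          thus False using True assms(3) by blast
        next
          case False
          have "C = S" using C A(1) sA False by (intro notboth C(3)) blast+
          thus False using False assms(3) by simp
        qed
      qed
      moreover have "linked (S - A) (inside (S - A) w)"
        unfolding split[OF closed_under_Diff[OF clS A(3)] Diff_subset]
      proof (intro allI impI, rule ccontr)
        fix C assume C: "C \<subseteq> S - A" "C \<noteq> {}" "closed_under w C" "C \<noteq> S - A"
        show False
        proof (cases "s \<in> C")
          case True
          have "A \<union> C = S"
            using C(1) A(1,2) True by (intro notboth closed_under_Un[OF A(3) C(3)]) blast+
          thus False using C(1,4) by blast
        next
          case False
          have "C = S" using C(1,2) A(2) False by (intro notboth C(3)) blast+
          thus False using False assms(2) by simp
        qed
      qed
      ultimately show False using not A sA compl by auto
    qed
  }
  {
    assume "linked S w \<or> ?R"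
    thus ?L
    proof
      assume "linked S w" thus ?L by (rule linked_snoc_mono)
    next
      assume ?R
      then obtain A where A: "A \<subseteq> S" "m \<in> A" "s \<notin> A" "closed_under w A"
        "linked A (inside A w)" "linked (S - A) (inside (S - A) w)"
        unfolding compl by auto
      note clA = closed_under_Diff[OF clS A(4)]
      show ?L
        unfolding linked_def closed_under_snoc
      proof (intro allI impI)
        fix C assume C: "C \<subseteq> S" "C \<noteq> {}" "closed_under w C \<and> (s \<in> C \<longleftrightarrow> m \<in> C)"
        have clC: "closed_under w C" using C(3) ..
        have 1: "C \<inter> A = {} \<or> C \<inter> A = A"
          using A(5) closed_under_Int[OF clC A(4)] unfolding split[OF A(4,1)] by (metis Int_lower2)
        have 2: "C \<inter> (S - A) = {} \<or> C \<inter> (S - A) = S - A"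
          using A(6) closed_under_Int[OF clC clA] unfolding split[OF clA Diff_subset] by (metis Int_lower2)
        have "m \<in> C"
        proof (rule ccontr)
          assume m: "m \<notin> C"
          hence "s \<notin> C" using C(3) by simp
          hence "C \<inter> (S - A) = {}" using 2 A(3) assms(2) by blast
          moreover have "C \<inter> A = {}" using 1 m A(2) by blast
          ultimately show False using C(1,2) by blast
        qed
        moreover from this have "s \<in> C" using C(3) by simp
        ultimately have "A \<subseteq> C" "S - A \<subseteq> C" using 1 2 A(2,3) assms(2) by blast+
        thus "C = S" using C(1) by blast
      qed
    qed
  }
qed

lemma split_walks_unique:
  assumes "w \<in> split_walks S A r p" "w \<in> split_walks S B r p" "A \<subseteq> S" "B \<subseteq> S" "m \<in> A" "m \<in> B"
  shows "A = B"
proof -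
  have "A \<inter> B = A" if "w \<in> split_walks S A r p" "w \<in> split_walks S B r p" "A \<subseteq> S" "m \<in> A" "m \<in> B" for A B
  proof -
    have "steps_in S w" "closed_under w A" "closed_under w B" "linked A (inside A w)"
      using that by (auto simp: split_walks_def)
    thus ?thesis using closed_under_Int[of w A B] that by (auto simp: linked_filter_split)
  qed
  from this[of A B] this[of B A] show ?thesis using assms by auto
qed

lemma monotone_walks_Suc:
  assumes "finite S" "m \<in> S" "\<forall>x\<in>S. x \<le> m" "S \<noteq> {m}"
  shows "monotone_walks S (Suc r) p = (\<Union>s\<in>S-{m}. (\<lambda>w. w @ [(s, m)]) `
     (monotone_walks S r (p \<circ> transp s m) \<union>
      (\<Union>A\<in>separators S m s. split_walks S A r (p \<circ> transp s m))))"
proof -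
  have prod: "(\<forall>x\<in>S. wprod (w @ [(s, m)]) x = p x) \<longleftrightarrow> (\<forall>x\<in>S. wprod w x = (p \<circ> transp s m) x)"
    if "s \<in> S" for w s
  proof -
    have tr: "transp s m x \<in> S" if "x \<in> S" for x
      using transpose_in_iff[of s S m x] that \<open>s \<in> S\<close> assms(2) by simp
    show ?thesis
    proof (intro iffI ballI)
      fix x assume *: "\<forall>x\<in>S. wprod (w @ [(s, m)]) x = p x" and x: "x \<in> S"
      have "wprod w x = wprod (w @ [(s, m)]) (transp s m x)" by (simp add: wprod_append)
      thus "wprod w x = (p \<circ> transp s m) x"
        using bspec[OF *, OF tr[OF x]] by simp
    next
      fix x assume "\<forall>x\<in>S. wprod w x = (p \<circ> transp s m) x" "x \<in> S"
      with tr[of x] show "wprod (w @ [(s, m)]) x = p x"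
        by (simp add: wprod_append)
    qed
  qed
  have snoc: "w @ [(s, m)] \<in> monotone_walks S (Suc r) p \<longleftrightarrow>
     w \<in> monotone_walks S r (p \<circ> transp s m) \<union>
      (\<Union>A\<in>separators S m s. split_walks S A r (p \<circ> transp s m))"
    if s: "s \<in> S - {m}" for w s
  proof (cases "steps_in S w")
    case True
    have "s < m" using s assms(3) by (auto simp: order.strict_iff_order)
    moreover have "\<forall>x\<in>set (map snd w). x \<le> m"
      using True assms(3) by (auto simp: steps_in_def)
    hence "sorted (map snd (w @ [(s, m)])) \<longleftrightarrow> sorted (map snd w)" by (simp add: sorted_append)
    moreover define base where "base \<longleftrightarrow> length w = r \<and> steps_in S w \<and> sorted (map snd w) \<and>
      (\<forall>x\<in>S. wprod w x = (p \<circ> transp s m) x)"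
    ultimately have "w @ [(s, m)] \<in> monotone_walks S (Suc r) p \<longleftrightarrow> base \<and> linked S (w @ [(s, m)])"
      unfolding monotone_walks_def mem_Collect_eq prod[of s, OF DiffD1[OF s]] steps_in_snoc
      using s assms(2) by simp
    moreover have "w \<in> monotone_walks S r (p \<circ> transp s m) \<longleftrightarrow> base \<and> linked S w"
      unfolding monotone_walks_def base_def by simp
    moreover have "w \<in> split_walks S A r (p \<circ> transp s m) \<longleftrightarrow> base \<and> closed_under w A \<and>
       linked A (inside A w) \<and> linked (S - A) (outside A w)" for A
      unfolding split_walks_def base_def by simp
    ultimately show ?thesis
      unfolding linked_snoc_iff[OF True DiffD1[OF s] assms(2)] Un_iff UN_iff by blast
  next
    case False
    hence "w @ [(s, m)] \<notin> monotone_walks S (Suc r) p" "w \<notin> monotone_walks S r q" "w \<notin> split_walks S A r q" for q A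
      by (simp_all add: monotone_walks_def split_walks_def steps_in_snoc)
    thus ?thesis by blast
  qed
  have last: "\<exists>w s. v = w @ [(s, m)] \<and> s \<in> S - {m}" if v: "v \<in> monotone_walks S (Suc r) p" for v
  proof -
    from v have len: "length v = Suc r" and st: "steps_in S v" and sorted: "sorted (map snd v)" and link: "linked S v"
      by (auto simp: monotone_walks_def)
    obtain w e where "v = w @ [e]" using len by (cases v rule: rev_cases) simp_all
    then obtain s t where v': "v = w @ [(s, t)]" by (cases e) simp
    have t: "t \<in> S" "s \<in> S" "s < t" using st by (auto simp: v' steps_in_snoc)
    have "t = m"
    proof (rule ccontr)
      assume "t \<noteq> m"
      hence "t < m" using assms(3) t(1) by (auto simp: order.strict_iff_order)
      have "fst e \<noteq> m \<and> snd e \<noteq> m" if e: "e \<in> set v" for e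
      proof -
        have "snd e \<le> t" using sorted e by (auto simp: v' sorted_append)
        moreover have "fst e < snd e" using st e by (simp add: steps_in_def split_beta)
        ultimately show ?thesis using \<open>t < m\<close> by linarith
      qed
      hence "closed_under v {m}" by (simp add: closed_under_def split_beta)
      thus False using linkedD[OF link, of "{m}" m] assms(2,4) by auto
    qed
    thus ?thesis using v' t by auto
  qed
  show ?thesis
  proof (intro Set.set_eqI iffI)
    fix v assume v: "v \<in> monotone_walks S (Suc r) p"
    then obtain w s where v': "v = w @ [(s, m)]" and s: "s \<in> S - {m}" using last by blast
    show "v \<in> (\<Union>s\<in>S-{m}. (\<lambda>w. w @ [(s, m)]) `
     (monotone_walks S r (p \<circ> transp s m) \<union>
      (\<Union>A\<in>separators S m s. split_walks S A r (p \<circ> transp s m))))"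
      using v snoc[OF s, of w] s unfolding v' by blast
  next
    fix v assume "v \<in> (\<Union>s\<in>S-{m}. (\<lambda>w. w @ [(s, m)]) `
     (monotone_walks S r (p \<circ> transp s m) \<union>
      (\<Union>A\<in>separators S m s. split_walks S A r (p \<circ> transp s m))))"
    then obtain s w where s: "s \<in> S - {m}" and v': "v = w @ [(s, m)]" and
      w: "w \<in> monotone_walks S r (p \<circ> transp s m) \<union>
      (\<Union>A\<in>separators S m s. split_walks S A r (p \<circ> transp s m))"
      by blast
    show "v \<in> monotone_walks S (Suc r) p" unfolding v' using snoc[OF s, of w] w by blast
  qed
qed

lemma card_monotone_walks_Suc:
  assumes "finite S" "m \<in> S" "\<forall>x\<in>S. x \<le> m" "S \<noteq> {m}"
  shows "card (monotone_walks S (Suc r) p) = (\<Sum>s\<in>S-{m}.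
     let q = p \<circ> transp s m in
     card (monotone_walks S r q) +
     (\<Sum>A\<in>separators S m s.
        \<Sum>k\<le>r. card (monotone_walks A k q) * card (monotone_walks (S - A) (r - k) q)))"
proof -
  define q where "q s = p \<circ> transp s m" for s
  define F where "F s = separators S m s" for s
  have finF: "finite (F s)" for s unfolding F_def using assms(1) by simp
  define V where "V s = monotone_walks S r (q s) \<union> (\<Union>A\<in>F s. split_walks S A r (q s))" for s
  have finV: "finite (V s)" for s
    unfolding V_def using assms(1) finF by (auto intro: finite_monotone_walks finite_split_walks)
  have "card (monotone_walks S (Suc r) p) = card (\<Union>s\<in>S-{m}. (\<lambda>w. w @ [(s, m)]) ` V s)"
    using monotone_walks_Suc[OF assms, of r p] by (simp only: V_def q_def F_def)
  also have "\<dots> = (\<Sum>s\<in>S-{m}. card ((\<lambda>w. w @ [(s, m)]) ` V s))"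
    using assms(1) finV by (intro card_UN_disjoint) auto
  also have "\<dots> = (\<Sum>s\<in>S-{m}. card (V s))"
    by (intro sum.cong refl card_image) (auto simp: inj_on_def)
  also have "\<dots> = (\<Sum>s\<in>S-{m}. card (monotone_walks S r (q s)) +
     (\<Sum>A\<in>F s. \<Sum>k\<le>r. card (monotone_walks A k (q s)) * card (monotone_walks (S - A) (r - k) (q s))))"
  proof (intro sum.cong refl)
    fix s assume s: "s \<in> S - {m}"
    have "monotone_walks S r (q s) \<inter> (\<Union>A\<in>F s. split_walks S A r (q s)) = {}"
    proof -
      have False if "w \<in> monotone_walks S r (q s)" "w \<in> split_walks S A r (q s)" "A \<in> F s" for w A
      proof -
        have "linked S w" "closed_under w A" "m \<in> A" "A \<subseteq> S" "s \<notin> A"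
          using that by (auto simp: F_def monotone_walks_def split_walks_def)
        thus False using linkedD[of S w A m] s by auto
      qed
      thus ?thesis by blast
    qed
    hence "card (V s) = card (monotone_walks S r (q s)) + card (\<Union>A\<in>F s. split_walks S A r (q s))"
      unfolding V_def using assms(1) finF
      by (intro card_Un_disjoint) (auto intro: finite_monotone_walks finite_split_walks)
    also have "card (\<Union>A\<in>F s. split_walks S A r (q s)) = (\<Sum>A\<in>F s. card (split_walks S A r (q s)))"
    proof (intro card_UN_disjoint finF ballI impI)
      fix A assume "A \<in> F s"
      show "finite (split_walks S A r (q s))" using assms(1) by (rule finite_split_walks)
      fix B assume "B \<in> F s" "A \<noteq> B"
      thus "split_walks S A r (q s) \<inter> split_walks S B r (q s) = {}"
        using split_walks_unique[of _ S A r "q s" B m] \<open>A \<in> F s\<close> unfolding F_def by blast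
    qed
    also have "\<dots> = (\<Sum>A\<in>F s. \<Sum>k\<le>r. card (monotone_walks A k (q s)) * card (monotone_walks (S - A) (r - k) (q s)))"
      using assms(1) by (intro sum.cong refl card_split_walks) (auto simp: F_def)
    finally show "card (V s) = card (monotone_walks S r (q s)) +
     (\<Sum>A\<in>F s. \<Sum>k\<le>r. card (monotone_walks A k (q s)) * card (monotone_walks (S - A) (r - k) (q s)))" .
  qed
  finally show ?thesis by (simp add: q_def F_def Let_def)
qed

lemma linked_Nil: "linked S [] \<longleftrightarrow> (\<forall>x\<in>S. S = {x})"
proof
  assume "linked S []"
  thus "\<forall>x\<in>S. S = {x}" using linkedD[of S "[]" "{x}" x for x] by (auto simp: closed_under_def)
qed (auto simp: linked_def)

lemma monotone_walks_0:
  "monotone_walks S 0 p = (if (\<forall>x\<in>S. S = {x}) \<and> (\<forall>x\<in>S. p x = x) then {[]} else {})"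
proof -
  have "monotone_walks S 0 p = {w. w = [] \<and> (\<forall>x\<in>S. x = p x) \<and> linked S []}"
    by (auto simp: monotone_walks_def steps_in_def)
  thus ?thesis unfolding linked_Nil by (simp add: eq_commute)
qed

lemma monotone_walks_singleton_Suc: "monotone_walks {x} (Suc r) p = {}"
proof -
  have "length w \<noteq> Suc r" if "steps_in {x} w" for w
    using that by (cases w) (auto simp: steps_in_def)
  thus ?thesis by (auto simp: monotone_walks_def)
qed

section \<open>Cycles of a permutation times a transposition\<close>

lemma orbit_eq_if_mem:
  assumes "permutation p" "y \<in> orbit p x"
  shows "orbit p y = orbit p x"
proof
  show "orbit p y \<subseteq> orbit p x" using assms(2) by (auto intro: orbit_trans)
  have "x \<in> orbit p y"
    using orbit_swap[OF permutation_self_in_orbit[OF assms(1)] assms(2)] .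
  thus "orbit p x \<subseteq> orbit p y" by (auto intro: orbit_trans)
qed

lemma finite_orbit_permutation: "permutation p \<Longrightarrow> finite (orbit p x)"
  by (intro finite_orbit permutation_self_in_orbit)

lemma permutation_comp_transpose:
  "permutation p \<Longrightarrow> permutation (p \<circ> transp x y)"
  by (intro permutation_compose permutation_swap_id)

lemma orbit_period:
  assumes "(f ^^ n) x = x" "0 < n"
  shows "orbit f x = (\<lambda>k. (f ^^ k) x) ` {1..n}"
proof
  show "(\<lambda>k. (f ^^ k) x) ` {1..n} \<subseteq> orbit f x"
    unfolding orbit_altdef by auto
  show "orbit f x \<subseteq> (\<lambda>k. (f ^^ k) x) ` {1..n}"
  proof
    fix y assume "y \<in> orbit f x"
    then obtain k where k: "y = (f ^^ (k mod n)) x"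
      using funpow_mod_eq[OF assms(1)] by (auto simp: orbit_altdef)
    show "y \<in> (\<lambda>k. (f ^^ k) x) ` {1..n}"
    proof (cases "k mod n = 0")
      case True
      hence "y = (f ^^ n) x" using k assms(1) by simp
      thus ?thesis using assms(2) by auto
    next
      case False
      moreover have "k mod n \<le> n" using assms(2) by (simp add: less_imp_le)
      ultimately show ?thesis using k by auto
    qed
  qed
qed

lemma orbit_enum:
  assumes "permutation p"
  shows "(p ^^ card (orbit p x)) x = x" "0 < card (orbit p x)"
    "inj_on (\<lambda>k. (p ^^ k) x) {1..card (orbit p x)}"
    "orbit p x = (\<lambda>k. (p ^^ k) x) ` {1..card (orbit p x)}"
proof -
  define n where "n = funpow_dist1 p x x"
  have self: "x \<in> orbit p x" by (rule permutation_self_in_orbit[OF assms])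
  have n: "(p ^^ n) x = x" unfolding n_def by (rule funpow_dist1_prop[OF self])
  have "card (orbit p x) = n"
    unfolding orbit_conv_funpow_dist1[OF self]
    by (subst card_image[OF inj_on_funpow_dist1[OF self]]) (simp add: n_def)
  thus *: "(p ^^ card (orbit p x)) x = x" "0 < card (orbit p x)"
    using n by (simp_all add: n_def)
  show **: "orbit p x = (\<lambda>k. (p ^^ k) x) ` {1..card (orbit p x)}"
    by (rule orbit_period[OF *])
  show "inj_on (\<lambda>k. (p ^^ k) x) {1..card (orbit p x)}"
    using arg_cong[OF **, of card, symmetric] by (intro eq_card_imp_inj_on) simp_all
qed

lemma orbit_cut:
  assumes p: "permutation p" and k: "0 < k" "k < card (orbit p x)" and y: "y = (p ^^ k) x"
  defines "q \<equiv> p \<circ> transp x y"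
  shows "orbit q x = (\<lambda>j. (p ^^ j) x) ` {k+1..card (orbit p x)}"
    and "orbit q y = (\<lambda>j. (p ^^ j) x) ` {1..k}"
proof -
  define a where "a = card (orbit p x)"
  define f where "f j = (p ^^ j) x" for j
  note en = orbit_enum[OF p, of x, folded a_def]
  have inj: "inj_on f {1..a}" using en(3) by (simp add: f_def[abs_def])
  have fa: "f a = x" using en(1) by (simp add: f_def)
  have fk: "f k = y" using y by (simp add: f_def)
  have fS: "f (Suc j) = p (f j)" for j by (simp add: f_def)
  have neq: "x \<noteq> y" using inj_onD[OF inj, of k a] k fa fk by (auto simp: a_def)
  have qf: "q (f j) = f (Suc j)" if "0 < j" "j < a" "j \<noteq> k" for j
  proof -
    have "f j \<noteq> y" using inj_onD[OF inj, of j k] that k fk by (auto simp: a_def)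
    moreover have "f j \<noteq> x" using inj_onD[OF inj, of j a] that fa by auto
    ultimately show ?thesis by (simp add: q_def fS)
  qed
  have qx: "q x = f (Suc k)" by (simp add: q_def fS fk)
  have qy: "q y = f 1" by (simp add: q_def f_def)
  have itx: "(q ^^ j) x = f (k + j)" if "1 \<le> j" "k + j \<le> a" for j
    using that
  proof (induction j rule: dec_induct)
    case base
    thus ?case by (simp add: qx)
  next
    case (step j)
    thus ?case using qf[of "k + j"] by simp
  qed
  have ity: "(q ^^ j) y = f j" if "1 \<le> j" "j \<le> k" for j
    using that
  proof (induction j rule: dec_induct)
    case base
    thus ?case by (simp add: qy)
  next
    case (step j)
    thus ?case using qf[of j] k by (simp add: a_def)
  qed
  have "(q ^^ (a - k)) x = x" using itx[of "a - k"] k fa by (simp add: a_def)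
  hence "orbit q x = (\<lambda>j. (q ^^ j) x) ` {1..a - k}" using k by (intro orbit_period) (auto simp: a_def)
  also have "\<dots> = (\<lambda>j. f (k + j)) ` {1..a - k}" using itx by (intro image_cong) auto
  also have "\<dots> = f ` ((+) k ` {1..a - k})" by (simp only: image_image)
  also have "(+) k ` {1..a - k} = {k+1..a}" using k by (simp add: a_def image_add_atLeastAtMost)
  finally show "orbit q x = (\<lambda>j. (p ^^ j) x) ` {k+1..card (orbit p x)}"
    by (simp add: f_def[abs_def] a_def)
  have "(q ^^ k) y = y" using ity[of k] k fk by simp
  hence "orbit q y = (\<lambda>j. (q ^^ j) y) ` {1..k}" using k by (intro orbit_period)
  also have "\<dots> = f ` {1..k}" using ity by (intro image_cong) auto
  finally show "orbit q y = (\<lambda>j. (p ^^ j) x) ` {1..k}" by (simp add: f_def[abs_def])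
qed

lemma orbit_cut_card:
  assumes p: "permutation p" and k: "0 < k" "k < card (orbit p x)" and y: "y = (p ^^ k) x"
  defines "q \<equiv> p \<circ> transp x y"
  shows "card (orbit q x) = card (orbit p x) - k" "card (orbit q y) = k"
    "orbit q x \<inter> orbit q y = {}" "orbit q x \<union> orbit q y = orbit p x"
proof -
  define a where "a = card (orbit p x)"
  define f where "f j = (p ^^ j) x" for j
  note en = orbit_enum[OF p, of x, folded a_def f_def]
  note cut = orbit_cut[OF p k y, folded a_def f_def q_def]
  have sub: "{k+1..a} \<subseteq> {1..a}" "{1..k} \<subseteq> {1..a}" using k by (auto simp: a_def)
  show "card (orbit q x) = card (orbit p x) - k" "card (orbit q y) = k"
    unfolding cut a_def[symmetric] using en(3) sub by (simp_all add: card_image inj_on_subset)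
  show "orbit q x \<inter> orbit q y = {}"
    unfolding cut using en(3) sub by (subst inj_on_image_Int[OF en(3), symmetric]) auto
  have "{k+1..a} \<union> {1..k} = {1..a}" using k by (auto simp: a_def)
  thus "orbit q x \<union> orbit q y = orbit p x"
    unfolding cut en(4) by (simp add: image_Un[symmetric])
qed

lemma orbit_cut_exists:
  assumes p: "permutation p" and y: "y \<in> orbit p x" "x \<noteq> y"
  obtains k where "0 < k" "k < card (orbit p x)" "y = (p ^^ k) x"
proof -
  have "y \<in> (\<lambda>k. (p ^^ k) x) ` {1..card (orbit p x)}"
    using y(1) by (simp only: orbit_enum(4)[OF p, of x, symmetric])
  then obtain k where k: "k \<in> {1..card (orbit p x)}" "y = (p ^^ k) x" by blast
  moreover have "k \<noteq> card (orbit p x)" using k y orbit_enum(1)[OF p, of x] by auto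
  ultimately show ?thesis using that[of k] by auto
qed

lemma orbit_transpose_other:
  assumes p: "permutation p" and "x \<notin> orbit p z" "y \<notin> orbit p z"
  shows "orbit (p \<circ> transp x y) z = orbit p z"
proof (rule orbit_cong)
  show "z \<in> orbit p z" by (rule permutation_self_in_orbit[OF p])
  fix s assume "s \<in> orbit p z"
  hence "s \<noteq> x" "s \<noteq> y" using assms by auto
  thus "(p \<circ> transp x y) s = p s" by simp
qed

lemma orbit_join:
  assumes p: "permutation p" and y: "y \<notin> orbit p x"
  defines "q \<equiv> p \<circ> transp x y"
  shows "orbit q x = orbit p x \<union> orbit p y" "orbit q y = orbit q x"
    and "orbit p x \<inter> orbit p y = {}"
proof -
  have q: "permutation q" unfolding q_def by (rule permutation_comp_transpose[OF p])
  have xy: "x \<noteq> y" using y permutation_self_in_orbit[OF p] by auto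
  have x: "x \<notin> orbit p y" using y orbit_eq_if_mem[OF p, of x y] permutation_self_in_orbit[OF p] by auto
  show "orbit p x \<inter> orbit p y = {}"
    using y orbit_eq_if_mem[OF p] permutation_self_in_orbit[OF p] by blast
  define b where "b = card (orbit p y)"
  note en = orbit_enum[OF p, of y, folded b_def]
  have it: "(q ^^ j) x = (p ^^ j) y" if "1 \<le> j" "j \<le> b" for j
    using that
  proof (induction j rule: dec_induct)
    case base
    thus ?case by (simp add: q_def)
  next
    case (step j)
    have "(p ^^ j) y \<noteq> y" using inj_onD[OF en(3), of j b] en(1) step by auto
    moreover have "(p ^^ j) y \<noteq> x"
      using x step en(4) by auto
    ultimately show ?case using step by (simp add: q_def)
  qed
  have "y = (q ^^ b) x" using it[of b] en(1,2) by simp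
  hence yq: "y \<in> orbit q x" using en(2) by (auto simp: orbit_altdef)
  thus "orbit q y = orbit q x" by (rule orbit_eq_if_mem[OF q])
  have qp: "q \<circ> transp x y = p" by (simp add: q_def comp_assoc)
  from yq xy obtain k where k: "0 < k" "k < card (orbit q x)" "y = (q ^^ k) x"
    by (rule orbit_cut_exists[OF q])
  show "orbit q x = orbit p x \<union> orbit p y"
    using orbit_cut_card(4)[OF q k] unfolding qp by simp
qed

definition cycles :: "nat set \<Rightarrow> (nat \<Rightarrow> nat) \<Rightarrow> nat set set" where
  "cycles S p = orbit p ` S"

definition stable_perm :: "nat set \<Rightarrow> (nat \<Rightarrow> nat) \<Rightarrow> bool" where
  "stable_perm S p \<longleftrightarrow> finite S \<and> permutation p \<and> (\<forall>x\<in>S. p x \<in> S)"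

lemma stable_perm_orbit:
  assumes "stable_perm S p" "x \<in> S"
  shows "orbit p x \<subseteq> S"
proof
  fix y assume "y \<in> orbit p x"
  thus "y \<in> S" using assms by induction (auto simp: stable_perm_def)
qed

lemma stable_perm_self: "stable_perm S p \<Longrightarrow> x \<in> orbit p x"
  by (auto simp: stable_perm_def intro: permutation_self_in_orbit)

lemma stable_perm_orbit_eq: "stable_perm S p \<Longrightarrow> y \<in> orbit p x \<Longrightarrow> orbit p y = orbit p x"
  by (simp add: stable_perm_def orbit_eq_if_mem)

lemma Union_cycles: "stable_perm S p \<Longrightarrow> \<Union> (cycles S p) = S"
  using stable_perm_orbit stable_perm_self by (auto simp: cycles_def)

lemma cycles_memD: "stable_perm S p \<Longrightarrow> C \<in> cycles S p \<Longrightarrow> x \<in> C \<Longrightarrow> C = orbit p x"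
  by (auto simp: cycles_def stable_perm_orbit_eq)

lemma cycles_disjoint:
  "stable_perm S p \<Longrightarrow> C \<in> cycles S p \<Longrightarrow> D \<in> cycles S p \<Longrightarrow> C \<noteq> D \<Longrightarrow> C \<inter> D = {}"
  by (metis cycles_memD disjoint_iff)

lemma cycles_nonempty: "stable_perm S p \<Longrightarrow> C \<in> cycles S p \<Longrightarrow> C \<noteq> {}"
  by (auto simp: cycles_def dest: stable_perm_self)

lemma finite_cycles: "stable_perm S p \<Longrightarrow> finite (cycles S p)"
  by (auto simp: cycles_def stable_perm_def)

lemma cycles_finite_mem: "stable_perm S p \<Longrightarrow> C \<in> cycles S p \<Longrightarrow> finite C"
  by (auto simp: cycles_def stable_perm_def finite_orbit_permutation)

lemma sum_card_cycles:
  assumes "stable_perm S p"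
  shows "sum card (cycles S p) = card S"
  using card_Union_disjoint[of "cycles S p"] assms
  by (simp add: Union_cycles pairwise_def disjnt_def cycles_disjoint cycles_finite_mem)

lemma stable_perm_comp:
  "stable_perm S p \<Longrightarrow> x \<in> S \<Longrightarrow> y \<in> S \<Longrightarrow> stable_perm S (p \<circ> transp x y)"
  unfolding stable_perm_def using transpose_in_iff[of x S y] by (auto intro: permutation_comp_transpose)

lemma cycles_others:
  assumes sp: "stable_perm S p" and xy: "x \<in> S" "y \<in> S"
  defines "q \<equiv> p \<circ> transp x y"
  shows "cycles S q = {orbit q x, orbit q y} \<union> (cycles S p - {orbit p x, orbit p y})"
proof -
  have p: "permutation p" using sp by (simp add: stable_perm_def)
  have q: "permutation q" unfolding q_def by (rule permutation_comp_transpose[OF p])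
  have pq: "p = q \<circ> transp x y" by (simp add: q_def comp_assoc)
  have qother: "orbit q z = orbit p z" if "x \<notin> orbit p z" "y \<notin> orbit p z" for z
    unfolding q_def using p that by (rule orbit_transpose_other)
  have pother: "orbit p z = orbit q z" if "x \<notin> orbit q z" "y \<notin> orbit q z" for z
    using orbit_transpose_other[OF q that] unfolding pq[symmetric] by simp
  show ?thesis
  proof (intro equalityI subsetI)
    fix C assume "C \<in> cycles S q"
    then obtain z where z: "z \<in> S" "C = orbit q z" by (auto simp: cycles_def)
    show "C \<in> {orbit q x, orbit q y} \<union> (cycles S p - {orbit p x, orbit p y})"
    proof (cases "x \<in> C \<or> y \<in> C")
      case True
      thus ?thesis using z orbit_eq_if_mem[OF q] by blast
    next
      case False
      hence "C = orbit p z" using pother[of z] z by auto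
      moreover have "C \<noteq> orbit p x" "C \<noteq> orbit p y"
        using False permutation_self_in_orbit[OF p] by auto
      ultimately show ?thesis using z by (auto simp: cycles_def)
    qed
  next
    fix C assume C: "C \<in> {orbit q x, orbit q y} \<union> (cycles S p - {orbit p x, orbit p y})"
    show "C \<in> cycles S q"
    proof (cases "C \<in> {orbit q x, orbit q y}")
      case True
      thus ?thesis using xy by (auto simp: cycles_def)
    next
      case False
      then obtain z where z: "z \<in> S" "C = orbit p z" "C \<noteq> orbit p x" "C \<noteq> orbit p y"
        using C by (auto simp: cycles_def)
      have "x \<notin> C" "y \<notin> C" using z orbit_eq_if_mem[OF p] by blast+
      hence "C = orbit q z" using qother[of z] z by auto
      thus ?thesis using z by (auto simp: cycles_def)
    qed
  qed
qed

lemma cycles_join: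
  assumes sp: "stable_perm S p" and m: "m \<in> S" and D: "D \<in> cycles S p" "D \<noteq> orbit p m" "s \<in> D"
  defines "q \<equiv> p \<circ> transp s m" and "C \<equiv> orbit p m"
  shows "orbit q m = C \<union> D" "s \<in> orbit q m" "s \<in> S"
    "cycles S q - {C \<union> D} = cycles S p - {C} - {D}"
    "Suc (card (cycles S q)) = card (cycles S p)" "card (C \<union> D) = card C + card D"
proof -
  have p: "permutation p" and fin: "finite S" using sp by (auto simp: stable_perm_def)
  have q': "q = p \<circ> transp m s" by (simp add: q_def transpose_commute)
  have Ds: "D = orbit p s" using cycles_memD[OF sp D(1,3)] .
  have CC: "C \<in> cycles S p" using m by (auto simp: C_def cycles_def)
  have disj: "C \<inter> D = {}" using cycles_disjoint[OF sp CC D(1)] D(2) by (simp add: C_def)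
  have s: "s \<notin> orbit p m" using disj D(3) by (auto simp: C_def)
  show sS: "s \<in> S" using Union_cycles[OF sp] D by auto
  show om: "orbit q m = C \<union> D"
    unfolding q' C_def Ds by (rule orbit_join[OF p s])
  thus "s \<in> orbit q m" using D(3) by simp
  have os: "orbit q s = C \<union> D"
    using orbit_join(2)[OF p s] om unfolding q' by simp
  have cyc: "cycles S q = insert (C \<union> D) (cycles S p - {C} - {D})"
    using cycles_others[OF sp m sS] unfolding q'[symmetric] om os Ds[symmetric] C_def[symmetric] by auto
  have ne: "C \<noteq> {}" "D \<noteq> {}" using cycles_nonempty[OF sp] CC D(1) by auto
  have notin: "C \<union> D \<notin> cycles S p"
  proof
    assume "C \<union> D \<in> cycles S p"
    from cycles_disjoint[OF sp this CC] cycles_disjoint[OF sp this D(1)] ne disj show False by blast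
  qed
  show "cycles S q - {C \<union> D} = cycles S p - {C} - {D}" unfolding cyc using notin by auto
  have "card (cycles S p - {C} - {D}) = card (cycles S p) - 2"
    using CC D(1,2) finite_cycles[OF sp] by (simp add: C_def)
  moreover have "card (cycles S p) \<ge> card {C, D}"
    using CC D(1) finite_cycles[OF sp] by (intro card_mono) auto
  ultimately show "Suc (card (cycles S q)) = card (cycles S p)"
    unfolding cyc using notin finite_cycles[OF sp] D(2) by (simp add: C_def)
  show "card (C \<union> D) = card C + card D"
    using disj cycles_finite_mem[OF sp] CC D(1) by (intro card_Un_disjoint) auto
qed

lemma cycles_cut:
  assumes sp: "stable_perm S p" and m: "m \<in> S" and k: "0 < k" "k < card (orbit p m)"
  defines "s \<equiv> (p ^^ k) m" and "C \<equiv> orbit p m"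
  defines "q \<equiv> p \<circ> transp s m"
  shows "s \<in> S" "card (orbit q m) = card C - k" "card (orbit q s) = k"
    "s \<notin> orbit q m" "orbit q m \<inter> orbit q s = {}"
    "orbit q m \<union> orbit q s = C"
    "cycles S q - {orbit q m} = insert (orbit q s) (cycles S p - {C})"
    "orbit q m \<notin> cycles S p - {C}" "orbit q s \<notin> cycles S p - {C}"
    "card (cycles S q) = Suc (card (cycles S p))"
proof -
  have p: "permutation p" and fin: "finite S" using sp by (auto simp: stable_perm_def)
  have q': "q = p \<circ> transp m s" by (simp add: q_def transpose_commute)
  note cut = orbit_cut_card[OF p k s_def[THEN meta_eq_to_obj_eq], folded q' C_def]
  have sC: "s \<in> C" unfolding s_def C_def
    by (rule funpow_in_orbit[OF permutation_self_in_orbit[OF p]])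
  have sq: "s \<in> orbit q s" and mq: "m \<in> orbit q m"
    using permutation_comp_transpose[OF p, of s m] by (auto simp: q_def intro: permutation_self_in_orbit)
  show sS: "s \<in> S" using sC stable_perm_orbit[OF sp m] by (auto simp: C_def)
  have os: "orbit p s = C" unfolding C_def using sC orbit_eq_if_mem[OF p] by (simp add: C_def)
  show "card (orbit q m) = card C - k" "card (orbit q s) = k"
     "orbit q m \<inter> orbit q s = {}" "orbit q m \<union> orbit q s = C"
    by (fact cut)+
  show "s \<notin> orbit q m" using cut(3) sq by auto
  have CC: "C \<in> cycles S p" using m by (auto simp: C_def cycles_def)
  have no: "X \<notin> cycles S p - {C}" if "X \<subseteq> C" "X \<noteq> {}" for X
    using that cycles_disjoint[OF sp CC, of X] by auto
  show 1: "orbit q m \<notin> cycles S p - {C}" and 2: "orbit q s \<notin> cycles S p - {C}"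
    using no cut(4) sq mq by blast+
  have cyc: "cycles S q = {orbit q m, orbit q s} \<union> (cycles S p - {C})"
    using cycles_others[OF sp m sS] unfolding q'[symmetric] os C_def[symmetric] by simp
  have 3: "orbit q m \<noteq> orbit q s" using cut(3) sq by auto
  show "cycles S q - {orbit q m} = insert (orbit q s) (cycles S p - {C})"
    unfolding cyc using 1 3 by auto
  have "card (cycles S p - {C}) = card (cycles S p) - 1" "card (cycles S p) > 0"
    using CC finite_cycles[OF sp] by (auto simp: card_gt_0_iff)
  thus "card (cycles S q) = Suc (card (cycles S p))"
    unfolding cyc using 1 2 3 finite_cycles[OF sp] by simp
qed

lemma stable_perm_subset:
  assumes "stable_perm S p" "A \<subseteq> S" "\<And>x. x \<in> A \<Longrightarrow> p x \<in> A"
  shows "stable_perm A p"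
  using assms finite_subset by (auto simp: stable_perm_def)

lemma stable_perm_Diff:
  assumes "stable_perm S p" "stable_perm A p"
  shows "stable_perm (S - A) p"
proof -
  have "p x \<notin> A" if "x \<notin> A" for x
  proof
    assume "p x \<in> A"
    hence "x \<in> orbit p (p x)"
      using assms permutation_self_in_orbit permutation_orbit_step by (metis stable_perm_def)
    thus False using stable_perm_orbit[OF assms(2) \<open>p x \<in> A\<close>] that by auto
  qed
  thus ?thesis using assms by (auto simp: stable_perm_def)
qed

lemma cycles_subset:
  assumes "stable_perm S p" "stable_perm A p" "A \<subseteq> S"
  shows "cycles A p = {C \<in> cycles S p. C \<subseteq> A}"
proof (intro equalityI subsetI)
  fix C assume "C \<in> cycles A p"
  thus "C \<in> {C \<in> cycles S p. C \<subseteq> A}"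
    using assms(3) stable_perm_orbit[OF assms(2)] by (auto simp: cycles_def)
next
  fix C assume "C \<in> {C \<in> cycles S p. C \<subseteq> A}"
  then obtain x where "C = orbit p x" "C \<subseteq> A" by (auto simp: cycles_def)
  moreover from this have "x \<in> A" using stable_perm_self[OF assms(1)] by blast
  ultimately show "C \<in> cycles A p" by (simp add: cycles_def)
qed

lemma cycles_Diff:
  assumes "stable_perm S p" "stable_perm A p" "A \<subseteq> S"
  shows "cycles (S - A) p = cycles S p - cycles A p"
proof -
  have sp: "stable_perm (S - A) p" using stable_perm_Diff assms by blast
  show ?thesis
  proof (intro equalityI subsetI)
    fix C assume "C \<in> cycles (S - A) p"
    hence C: "C \<in> cycles S p" "C \<subseteq> S - A" unfolding cycles_subset[OF assms(1) sp Diff_subset] by auto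
    moreover have "C \<noteq> {}" using cycles_nonempty[OF assms(1) C(1)] .
    ultimately show "C \<in> cycles S p - cycles A p" unfolding cycles_subset[OF assms] by auto
  next
    fix C assume "C \<in> cycles S p - cycles A p"
    then obtain x where x: "x \<in> S" "C = orbit p x" "C \<notin> cycles A p" by (auto simp: cycles_def)
    hence "x \<in> S - A" by (auto simp: cycles_def)
    thus "C \<in> cycles (S - A) p" using x by (auto simp: cycles_def)
  qed
qed

lemma card_cycles_Diff:
  assumes "stable_perm S p" "stable_perm A p" "A \<subseteq> S"
  shows "card (cycles A p) + card (cycles (S - A) p) = card (cycles S p)"
proof -
  have "cycles A p \<subseteq> cycles S p" unfolding cycles_subset[OF assms] by auto
  thus ?thesis unfolding cycles_Diff[OF assms] using finite_cycles[OF assms(1)]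
    by (metis card_Diff_subset card_mono finite_subset le_add_diff_inverse)
qed

lemma monotone_walks_stable:
  assumes "monotone_walks A k q \<noteq> {}" "x \<in> A"
  shows "q x \<in> A"
proof -
  from assms obtain w where "steps_in A w" "\<forall>x\<in>A. wprod w x = q x" by (auto simp: monotone_walks_def)
  thus ?thesis using assms(2) wprod_in_closed[OF closed_under_steps_in] by metis
qed

text \<open>A walk of length \<open>r\<close> with product \<open>p\<close> has genus \<open>g\<close> when \<open>r + 2 = 2 * g + complexity S p\<close>.\<close>

definition complexity :: "nat set \<Rightarrow> (nat \<Rightarrow> nat) \<Rightarrow> nat" where
  "complexity S p = card S + card (cycles S p)"

lemma complexity_ge:
  assumes "stable_perm S p" "S \<noteq> {}"
  shows "complexity S p \<ge> 2"
proof -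
  have "card S > 0" "card (cycles S p) > 0" using assms finite_cycles[OF assms(1)]
    by (auto simp: stable_perm_def card_gt_0_iff cycles_def)
  thus ?thesis by (simp add: complexity_def)
qed

lemma complexity_split:
  assumes "stable_perm S q" "stable_perm A q" "A \<subseteq> S"
  shows "complexity A q + complexity (S - A) q = complexity S q"
proof -
  have "card A + card (S - A) = card S" using assms
    by (metis card_Diff_subset card_mono finite_subset le_add_diff_inverse stable_perm_def)
  thus ?thesis using card_cycles_Diff[OF assms] by (simp add: complexity_def)
qed

lemma complexity_step:
  assumes sp: "stable_perm S p" and "m \<in> S" "s \<in> S" "s \<noteq> m"
  defines "q \<equiv> p \<circ> transp s m"
  shows "(s \<in> orbit p m \<and> s \<notin> orbit q m \<and> complexity S q = Suc (complexity S p)) \<or>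
    (s \<notin> orbit p m \<and> s \<in> orbit q m \<and> Suc (complexity S q) = complexity S p)"
proof (cases "s \<in> orbit p m")
  case True
  have "permutation p" using sp by (simp add: stable_perm_def)
  then obtain k where k: "0 < k" "k < card (orbit p m)" "s = (p ^^ k) m"
    using orbit_cut_exists[OF _ True] assms(4) by metis
  from cycles_cut(4,10)[OF sp assms(2) k(1,2)] True show ?thesis unfolding k(3)[symmetric] q_def
    by (simp add: complexity_def)
next
  case False
  have s: "s \<in> orbit p s" using stable_perm_self[OF sp] .
  have "orbit p s \<in> cycles S p" using assms by (auto simp: cycles_def)
  moreover have "orbit p s \<noteq> orbit p m" using False s by auto
  ultimately show ?thesis using cycles_join(2,5)[OF sp assms(2), of "orbit p s" s] s False
    unfolding q_def by (simp add: complexity_def)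
qed

lemma Max_singleton_or:
  assumes "finite (S :: nat set)" "S \<noteq> {}"
  obtains m where "S = {m}" | m where "m \<in> S" "\<forall>x\<in>S. x \<le> m" "S \<noteq> {m}"
  using Max_in[OF assms] Max_ge[OF assms(1)] by blast

theorem monotone_walks_length:
  assumes "monotone_walks S r p \<noteq> {}" "stable_perm S p" "S \<noteq> {}"
  shows "complexity S p \<le> r + 2 \<and> even (r + complexity S p)"
  using assms
proof (induction r arbitrary: S p rule: less_induct)
  case (less r)
  have fin: "finite S" using less.prems by (simp add: stable_perm_def)
  show ?case
  proof (cases r)
    case 0
    have *: "(\<forall>x\<in>S. S = {x}) \<and> (\<forall>x\<in>S. p x = x)"
    proof (rule ccontr)
      assume "\<not> ?thesis"
      hence "monotone_walks S 0 p = {}" unfolding monotone_walks_0 by (rule if_not_P)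
      with less.prems(1) \<open>r = 0\<close> show False by simp
    qed
    obtain x where "x \<in> S" using less.prems(3) by blast
    hence x: "S = {x}" "p x = x" using * by blast+
    have "complexity S p = 2" by (simp add: complexity_def cycles_def x)
    thus ?thesis using 0 by simp
  next
    case (Suc r')
    from fin less.prems(3) show ?thesis
    proof (cases rule: Max_singleton_or)
      case (1 x)
      thus ?thesis using less.prems(1) Suc by (simp add: monotone_walks_singleton_Suc)
    next
      case (2 m)
      from less.prems(1) obtain v where "v \<in> monotone_walks S (Suc r') p" using Suc by blast
      then obtain s w where s: "s \<in> S - {m}"
        and "w \<in> monotone_walks S r' (p \<circ> transp s m) \<union>
         (\<Union>A\<in>separators S m s. split_walks S A r' (p \<circ> transp s m))"
        unfolding monotone_walks_Suc[OF fin 2] by (elim UN_E imageE) (rule that)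
      hence or: "monotone_walks S r' (p \<circ> transp s m) \<noteq> {} \<or>
         (\<exists>A. A \<subseteq> S \<and> m \<in> A \<and> s \<notin> A \<and> split_walks S A r' (p \<circ> transp s m) \<noteq> {})"
        by blast
      define q where "q = p \<circ> transp s m"
      have q: "stable_perm S q" unfolding q_def using stable_perm_comp less.prems(2) s 2(1) by simp
      note step = complexity_step[OF less.prems(2) 2(1), of s, folded q_def]
      from or[folded q_def] show ?thesis
      proof (elim disjE exE conjE)
        assume "monotone_walks S r' q \<noteq> {}"
        from less.IH[OF _ this q less.prems(3)] have "complexity S q \<le> r' + 2 \<and> even (r' + complexity S q)"
          using Suc by simp
        moreover have "complexity S q = Suc (complexity S p) \<or> Suc (complexity S q) = complexity S p"
          using step s by auto
        moreover have "b \<le> Suc k + 2 \<and> even (Suc k + b)" if "a \<le> k + 2 \<and> even (k + a)" "a = Suc b \<or> Suc a = b" for a b k :: nat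
          using that by presburger
        ultimately show ?thesis unfolding Suc by blast
      next
        fix A assume A: "A \<subseteq> S" "m \<in> A" "s \<notin> A" "split_walks S A r' q \<noteq> {}"
        have "card (split_walks S A r' q) \<noteq> 0" using A(4) fin finite_split_walks by simp
        hence "\<exists>k\<in>{..r'}. card (monotone_walks A k q) * card (monotone_walks (S - A) (r' - k) q) \<noteq> 0"
          unfolding card_split_walks[OF fin A(1)] by (rule sum.not_neutral_contains_not_neutral) blast
        then obtain k where "k \<le> r'" and k: "monotone_walks A k q \<noteq> {}" "monotone_walks (S - A) (r' - k) q \<noteq> {}"
          by (metis atMost_iff card.empty mult_zero_left mult_zero_right)
        then obtain j where r': "r' = k + j" using le_Suc_ex by blast
        with k have k: "monotone_walks A k q \<noteq> {}" "monotone_walks (S - A) j q \<noteq> {}" by simp_all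
        have ne: "A \<noteq> {}" "S - A \<noteq> {}" "k < r" "j < r" using A s r' Suc by auto
        have spA: "stable_perm A q" using stable_perm_subset[OF q A(1)] monotone_walks_stable[OF k(1)] by blast
        have spB: "stable_perm (S - A) q" using stable_perm_Diff[OF q spA] .
        have "complexity A q \<le> k + 2 \<and> even (k + complexity A q)"
          using less.IH[OF ne(3) k(1) spA ne(1)] .
        moreover have "complexity (S - A) q \<le> j + 2 \<and> even (j + complexity (S - A) q)"
          using less.IH[OF ne(4) k(2) spB ne(2)] .
        moreover have "complexity A q + complexity (S - A) q = complexity S q"
          by (rule complexity_split[OF q spA A(1)])
        moreover have "s \<notin> orbit q m" using stable_perm_orbit[OF spA A(2)] A(3) by auto
        hence "complexity S q = Suc (complexity S p)" using step s by auto
        moreover have "d \<le> Suc (k + j) + 2 \<and> even (Suc (k + j) + d)"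
          if "a \<le> k + 2 \<and> even (k + a)" "b \<le> j + 2 \<and> even (j + b)" "a + b = c" "c = Suc d" for a b c d k j :: nat
          using that by presburger
        ultimately show ?thesis unfolding Suc r' by blast
      qed
    qed
  qed
qed

section \<open>Counting walks by genus\<close>

definition genus_count :: "nat \<Rightarrow> nat set \<Rightarrow> (nat \<Rightarrow> nat) \<Rightarrow> nat" where
  "genus_count g S p = card (monotone_walks S (2 * g + complexity S p - 2) p)"

lemma genus_count_eq: "r + 2 = 2 * g + complexity S p \<Longrightarrow> genus_count g S p = card (monotone_walks S r p)"
  by (metis add_diff_cancel_right' genus_count_def)

lemma sum_walks_eq_sum_genus:
  assumes q: "stable_perm S q" and A: "stable_perm A q" "A \<subseteq> S" "A \<noteq> {}" "S - A \<noteq> {}"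
    and r: "r + 4 = 2 * g + complexity S q"
  shows "(\<Sum>k\<le>r. card (monotone_walks A k q) * card (monotone_walks (S - A) (r - k) q))
     = (\<Sum>h\<le>g. genus_count h A q * genus_count (g - h) (S - A) q)"
proof -
  define B where "B = S - A"
  have B: "stable_perm B q" unfolding B_def by (rule stable_perm_Diff[OF q A(1)])
  define u v where "u = complexity A q - 2" and "v = complexity B q - 2"
  have u: "complexity A q = u + 2" using complexity_ge[OF A(1,3)] by (simp add: u_def)
  have v: "complexity B q = v + 2" using complexity_ge[OF B] A(4) by (simp add: v_def B_def)
  have ruv: "r = 2 * g + u + v"
    using r complexity_split[OF q A(1,2), folded B_def] u v by simp
  define f where "f k = card (monotone_walks A k q) * card (monotone_walks B (r - k) q)" for k
  define \<phi> where "\<phi> h = 2 * h + u" for h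
  have "sum f {..r} = sum f (\<phi> ` {..g})"
  proof (rule sum.mono_neutral_right)
    show "\<phi> ` {..g} \<subseteq> {..r}" by (auto simp: \<phi>_def ruv)
    show "\<forall>k\<in>{..r} - \<phi> ` {..g}. f k = 0"
    proof (rule ballI, rule ccontr)
      fix k assume k: "k \<in> {..r} - \<phi> ` {..g}" "f k \<noteq> 0"
      hence "monotone_walks A k q \<noteq> {}" "monotone_walks B (r - k) q \<noteq> {}" by (auto simp: f_def)
      from monotone_walks_length[OF this(1) A(1,3)] monotone_walks_length[OF this(2) B] A(4)
      have uk: "u \<le> k" and ev: "even (k + u)" and vk: "v \<le> r - k"
        by (simp_all add: B_def[symmetric] u v)
      from ev obtain c where "k + u = 2 * c" by (rule evenE)
      hence "k = \<phi> (c - u)" "c - u \<le> g" using uk vk k(1) by (auto simp: \<phi>_def ruv)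
      thus False using k(1) by auto
    qed
  qed simp
  also have "\<dots> = (\<Sum>h\<le>g. f (\<phi> h))"
    by (subst sum.reindex) (auto simp: inj_on_def \<phi>_def)
  also have "\<dots> = (\<Sum>h\<le>g. genus_count h A q * genus_count (g - h) B q)"
  proof (rule sum.cong[OF refl])
    fix h assume h: "h \<in> {..g}"
    have "genus_count h A q = card (monotone_walks A (\<phi> h) q)" by (rule genus_count_eq) (simp add: \<phi>_def u)
    moreover have "genus_count (g - h) B q = card (monotone_walks B (r - \<phi> h) q)"
      using h by (intro genus_count_eq) (simp add: \<phi>_def v ruv)
    ultimately show "f (\<phi> h) = genus_count h A q * genus_count (g - h) B q" by (simp add: f_def)
  qed
  finally show ?thesis by (simp add: f_def B_def)
qed

lemma genus_count_join_step:
  assumes sp: "stable_perm S p" and m: "m \<in> S" and D: "D \<in> cycles S p - {orbit p m}" "s \<in> D"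
    and r: "r + 3 = 2 * g + complexity S p"
  defines "q \<equiv> p \<circ> transp s m"
  shows "card (monotone_walks S r q) + (\<Sum>A\<in>separators S m s.
        \<Sum>k\<le>r. card (monotone_walks A k q) * card (monotone_walks (S - A) (r - k) q)) = genus_count g S q"
proof -
  note join = cycles_join[OF sp m _ _ D(2), folded q_def]
  have q: "stable_perm S q" unfolding q_def using stable_perm_comp[OF sp] join(3) m D(1) by simp
  have "(\<Sum>k\<le>r. card (monotone_walks A k q) * card (monotone_walks (S - A) (r - k) q)) = 0"
    if "A \<in> separators S m s" for A
  proof -
    from that have A: "A \<subseteq> S" "m \<in> A" "s \<notin> A" by auto
    have "monotone_walks A k q = {}" for k
    proof (rule ccontr)
      assume "monotone_walks A k q \<noteq> {}"
      hence "stable_perm A q" using stable_perm_subset[OF q A(1)] monotone_walks_stable by blast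
      from stable_perm_orbit[OF this A(2)] show False using join(2) D(1) A(3) by auto
    qed
    thus ?thesis by simp
  qed
  hence "(\<Sum>A\<in>separators S m s.
        \<Sum>k\<le>r. card (monotone_walks A k q) * card (monotone_walks (S - A) (r - k) q)) = 0"
    by (rule sum.neutral[OF ballI])
  moreover have "card (monotone_walks S r q) = genus_count g S q"
    using join(5) D(1) r by (intro genus_count_eq[symmetric]) (simp add: complexity_def)
  ultimately show ?thesis by simp
qed

lemma cycles_cut_insert:
  assumes sp: "stable_perm S p" and m: "m \<in> S" and k: "0 < k" "k < card (orbit p m)"
  defines "s \<equiv> (p ^^ k) m"
  defines "q \<equiv> p \<circ> transp s m"
  shows "cycles S q = insert (orbit q m) (insert (orbit q s) (cycles S p - {orbit p m}))"
proof -
  have "orbit q m \<in> cycles S q" using m by (simp add: cycles_def)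
  hence "cycles S q = insert (orbit q m) (cycles S q - {orbit q m})" by blast
  thus ?thesis unfolding cycles_cut(7)[OF sp m k, folded s_def q_def] .
qed

lemma cut_components:
  assumes sp: "stable_perm S p" and m: "m \<in> S" and k: "0 < k" "k < card (orbit p m)"
  defines "s \<equiv> (p ^^ k) m"
  defines "q \<equiv> p \<circ> transp s m"
  defines "I \<equiv> cycles S p - {orbit p m}"
  assumes J: "J \<subseteq> I"
  defines "A \<equiv> orbit q m \<union> \<Union>J"
  shows "A \<subseteq> S" "m \<in> A" "s \<notin> A" "stable_perm A q" "stable_perm (S - A) q"
    "cycles A q = insert (orbit q m) J" "cycles (S - A) q = insert (orbit q s) (I - J)"
proof -
  define O1 where "O1 = orbit q m"
  note cut = cycles_cut[OF sp m k, folded s_def q_def, folded I_def O1_def]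
  have q: "stable_perm S q" unfolding q_def using stable_perm_comp[OF sp cut(1) m] .
  have cycq: "cycles S q = insert O1 (insert (orbit q s) I)"
    unfolding O1_def I_def q_def s_def by (rule cycles_cut_insert[OF sp m k])
  have mO: "m \<in> O1" using stable_perm_self[OF q] by (simp add: O1_def)
  have sO2: "s \<in> orbit q s" using stable_perm_self[OF q] .
  have disj: "X = Y" if "X \<in> cycles S q" "Y \<in> cycles S q" "x \<in> X" "x \<in> Y" for X Y x
    using cycles_disjoint[OF q that(1,2)] that(3,4) by blast
  have O2J: "orbit q s \<notin> J" using cut(9) J by blast
  have sJ: "s \<notin> \<Union>J"
  proof
    assume "s \<in> \<Union>J"
    then obtain D where D: "D \<in> J" "s \<in> D" by blast
    hence "D = orbit q s" using J disj[of D "orbit q s"] sO2 unfolding cycq by blast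
    thus False using O2J D(1) by simp
  qed
  have CS: "C \<subseteq> S" if "C \<in> cycles S q" for C using Union_cycles[OF q] that by blast
  have J': "insert O1 J \<subseteq> cycles S q" unfolding cycq using J by blast
  have AJ: "A = \<Union>(insert O1 J)" unfolding A_def O1_def by simp
  show AS: "A \<subseteq> S" unfolding AJ using J' CS by blast
  show "m \<in> A" unfolding AJ using mO by simp
  show "s \<notin> A" unfolding AJ using cut(4) sJ by blast
  have "q x \<in> A" if "x \<in> A" for x
  proof -
    from that obtain C where C: "x \<in> C" "C \<subseteq> A" "C \<in> cycles S q" unfolding AJ using J' by blast
    have "q x \<in> orbit q x" by (rule orbit.base)
    thus ?thesis using cycles_memD[OF q C(3,1)] C(2) by auto
  qed
  thus spA: "stable_perm A q" using stable_perm_subset[OF q AS] by blast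
  thus "stable_perm (S - A) q" by (rule stable_perm_Diff[OF q])
  have cA: "cycles A q = insert O1 J"
    unfolding cycles_subset[OF q spA AS]
  proof (intro equalityI subsetI)
    fix C assume C: "C \<in> {C \<in> cycles S q. C \<subseteq> A}"
    then obtain x where x: "x \<in> C" using cycles_nonempty[OF q] by blast
    then obtain D where "D \<in> insert O1 J" "x \<in> D" using C unfolding AJ by blast
    thus "C \<in> insert O1 J" using disj[of C D x] C x J' by blast
  qed (use J' AJ in blast)
  thus "cycles A q = insert (orbit q m) J" by (simp add: O1_def)
  have "O1 \<noteq> orbit q s" using cut(4) sO2 by blast
  thus "cycles (S - A) q = insert (orbit q s) (I - J)"
    unfolding cycles_Diff[OF q spA AS] cA cycq using cut(8) O2J by blast
qed

lemma genus_count_cut_step: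
  assumes sp: "stable_perm S p" and m: "m \<in> S" and k: "0 < k" "k < card (orbit p m)"
    and r: "r + 3 = 2 * g + complexity S p"
  defines "s \<equiv> (p ^^ k) m"
  defines "q \<equiv> p \<circ> transp s m"
  shows "card (monotone_walks S r q) + (\<Sum>A\<in>separators S m s.
        \<Sum>k\<le>r. card (monotone_walks A k q) * card (monotone_walks (S - A) (r - k) q))
     = (if g = 0 then 0 else genus_count (g - 1) S q) +
       (\<Sum>J\<in>Pow (cycles S p - {orbit p m}). \<Sum>h\<le>g.
          genus_count h (orbit q m \<union> \<Union>J) q * genus_count (g - h) (S - (orbit q m \<union> \<Union>J)) q)"
proof -
  define I where "I = cycles S p - {orbit p m}"
  define O1 where "O1 = orbit q m"
  note cut = cycles_cut[OF sp m k, folded s_def q_def, folded I_def O1_def]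
  have fin: "finite S" using sp by (simp add: stable_perm_def)
  have q: "stable_perm S q" unfolding q_def using stable_perm_comp[OF sp cut(1) m] .
  have cq: "complexity S q = Suc (complexity S p)" using cut(10) by (simp add: complexity_def)
  have W: "card (monotone_walks S r q) = (if g = 0 then 0 else genus_count (g - 1) S q)"
  proof (cases "g = 0")
    case True
    have "monotone_walks S r q = {}"
    proof (rule ccontr)
      assume "monotone_walks S r q \<noteq> {}"
      from monotone_walks_length[OF this q] m have "complexity S q \<le> r + 2" by blast
      thus False using cq r True by simp
    qed
    thus ?thesis using True by simp
  next
    case False
    thus ?thesis using r cq by (auto intro!: genus_count_eq[symmetric])
  qed
  define T where "T A = (\<Sum>k\<le>r. card (monotone_walks A k q) * card (monotone_walks (S - A) (r - k) q))" for A
  define G where "G A = (\<Sum>h\<le>g. genus_count h A q * genus_count (g - h) (S - A) q)" for A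
  define \<A> where "\<A> = (\<lambda>J. O1 \<union> \<Union>J) ` Pow I"
  have cycq: "cycles S q = insert O1 (insert (orbit q s) I)"
    unfolding O1_def I_def q_def s_def by (rule cycles_cut_insert[OF sp m k])
  have sO2: "s \<in> orbit q s" using stable_perm_self[OF q] .
  have disj: "X \<inter> Y = {}" if "X \<in> cycles S q" "Y \<in> cycles S q" "X \<noteq> Y" for X Y
    using cycles_disjoint[OF q that] .
  have sub: "A \<subseteq> S" "m \<in> A" "s \<notin> A" "stable_perm A q" if "A \<in> \<A>" for A
  proof -
    from that obtain J where J: "J \<subseteq> I" "A = O1 \<union> \<Union>J" unfolding \<A>_def by blast
    from cut_components(1-4)[OF sp m k, folded s_def q_def, folded I_def O1_def, OF J(1)]
    show "A \<subseteq> S" "m \<in> A" "s \<notin> A" "stable_perm A q" unfolding J by blast+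
  qed
  have "sum T (separators S m s) = sum T \<A>"
  proof (rule sum.mono_neutral_right)
    show "finite (separators S m s)" using fin by simp
    show "\<A> \<subseteq> separators S m s" using sub by blast
    show "\<forall>A\<in>separators S m s - \<A>. T A = 0"
    proof (rule ballI)
      fix A assume "A \<in> separators S m s - \<A>"
      hence A: "A \<subseteq> S" "m \<in> A" "s \<notin> A" "A \<notin> \<A>" by auto
      have "monotone_walks A k q = {}" for k
      proof (rule ccontr)
        assume "monotone_walks A k q \<noteq> {}"
        hence spA: "stable_perm A q" using stable_perm_subset[OF q A(1)] monotone_walks_stable by blast
        have cA: "cycles A q = {C \<in> cycles S q. C \<subseteq> A}" by (rule cycles_subset[OF q spA A(1)])
        have "O1 \<in> cycles A q" using A(2) by (simp add: cycles_def O1_def)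
        moreover have "orbit q s \<notin> cycles A q" using sO2 A(3) unfolding cA by blast
        ultimately have "cycles A q = insert O1 {C \<in> I. C \<subseteq> A}" unfolding cA cycq by blast
        hence "A = O1 \<union> \<Union>{C \<in> I. C \<subseteq> A}" using Union_cycles[OF spA] by simp
        moreover have "{C \<in> I. C \<subseteq> A} \<in> Pow I" by blast
        ultimately show False using A(4) unfolding \<A>_def by blast
      qed
      thus "T A = 0" by (simp add: T_def)
    qed
  qed
  also have "sum T \<A> = sum G \<A>"
  proof (rule sum.cong[OF refl])
    fix A assume "A \<in> \<A>"
    note A = sub[OF this]
    show "T A = G A" unfolding T_def G_def
    proof (rule sum_walks_eq_sum_genus[OF q A(4,1)])
      show "A \<noteq> {}" "S - A \<noteq> {}" using A(2,3) cut(1) by blast+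
      show "r + 4 = 2 * g + complexity S q" using r cq by simp
    qed
  qed
  also have "\<dots> = (\<Sum>J\<in>Pow I. G (O1 \<union> \<Union>J))"
    unfolding \<A>_def
  proof (rule sum.reindex_cong[OF _ refl refl])
    show "inj_on (\<lambda>J. O1 \<union> \<Union>J) (Pow I)"
    proof (rule inj_onI)
      fix J K assume JK: "J \<in> Pow I" "K \<in> Pow I" "O1 \<union> \<Union>J = O1 \<union> \<Union>K"
      have *: "X \<subseteq> Y" if "X \<in> Pow I" "Y \<in> Pow I" "O1 \<union> \<Union>X = O1 \<union> \<Union>Y" for X Y
      proof
        fix C assume C: "C \<in> X"
        hence CI: "C \<in> I" "C \<in> cycles S q" "C \<noteq> O1" using that(1) cut(8) unfolding cycq by blast+
        obtain x where x: "x \<in> C" using cycles_nonempty[OF q CI(2)] by blast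
        have "O1 \<in> cycles S q" unfolding cycq by blast
        hence "x \<notin> O1" using disj[OF CI(2) _ CI(3)] x by blast
        moreover have "x \<in> O1 \<union> \<Union>Y" using that(3) x C by blast
        ultimately obtain D where D: "D \<in> Y" "x \<in> D" by blast
        hence "D \<in> cycles S q" unfolding cycq using that(2) by blast
        hence "D = C" using disj[of D C] D x CI by blast
        thus "C \<in> Y" using D by simp
      qed
      show "J = K" using *[OF JK] *[OF JK(2,1) JK(3)[symmetric]] by (rule equalityI)
    qed
  qed
  finally show ?thesis unfolding W T_def G_def I_def O1_def by simp
qed

theorem genus_count_rec:
  assumes sp: "stable_perm S p" and m: "m \<in> S" "\<forall>x\<in>S. x \<le> m" "S \<noteq> {m}"
  shows "genus_count g S p = (\<Sum>D\<in>cycles S p - {orbit p m}. \<Sum>s\<in>D. genus_count g S (p \<circ> transp s m))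
    + (\<Sum>k\<in>{1..<card (orbit p m)}. let q = p \<circ> transp ((p ^^ k) m) m in
        (if g = 0 then 0 else genus_count (g - 1) S q) +
       (\<Sum>J\<in>Pow (cycles S p - {orbit p m}). \<Sum>h\<le>g.
          genus_count h (orbit q m \<union> \<Union>J) q * genus_count (g - h) (S - (orbit q m \<union> \<Union>J)) q))"
proof -
  have fin: "finite S" and p: "permutation p" using sp by (auto simp: stable_perm_def)
  define C where "C = orbit p m"
  define I where "I = cycles S p - {C}"
  have CC: "C \<in> cycles S p" using m by (auto simp: cycles_def C_def)
  have mC: "m \<in> C" using stable_perm_self[OF sp] by (simp add: C_def)
  have "card S \<noteq> 1" using m(1,3) by (auto simp: card_1_singleton_iff)
  moreover have "card S > 0" "card (cycles S p) > 0" using m(1) fin CC finite_cycles[OF sp] by (auto simp: card_gt_0_iff)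
  ultimately have "complexity S p \<ge> 3" by (simp add: complexity_def)
  then obtain r where r: "r + 3 = 2 * g + complexity S p"
    by (metis add.commute le_Suc_ex trans_le_add2)
  define F where "F s = (let q = p \<circ> transp s m in card (monotone_walks S r q) +
      (\<Sum>A\<in>separators S m s.
        \<Sum>k\<le>r. card (monotone_walks A k q) * card (monotone_walks (S - A) (r - k) q)))" for s
  have "genus_count g S p = card (monotone_walks S (Suc r) p)" using r by (intro genus_count_eq) simp
  also have "\<dots> = sum F (S - {m})"
    unfolding F_def by (rule card_monotone_walks_Suc[OF fin m])
  also have "S - {m} = (C - {m}) \<union> \<Union>I"
    using Union_cycles[OF sp] CC mC cycles_disjoint[OF sp CC] unfolding I_def by fastforce
  also have "sum F \<dots> = sum F (C - {m}) + sum F (\<Union>I)"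
  proof (rule sum.union_disjoint)
    show "finite (C - {m})" using cycles_finite_mem[OF sp CC] by simp
    show "finite (\<Union>I)" using cycles_finite_mem[OF sp] finite_cycles[OF sp] by (auto simp: I_def)
    show "(C - {m}) \<inter> \<Union>I = {}" using cycles_disjoint[OF sp CC] unfolding I_def by blast
  qed
  also have "sum F (\<Union>I) = (\<Sum>D\<in>I. sum F D)"
    using cycles_finite_mem[OF sp] cycles_disjoint[OF sp] by (subst sum.Union_disjoint) (simp_all add: I_def)
  also have "\<dots> = (\<Sum>D\<in>I. \<Sum>s\<in>D. genus_count g S (p \<circ> transp s m))"
    unfolding F_def Let_def I_def C_def by (intro sum.cong refl genus_count_join_step[OF sp m(1) _ _ r])
  also have "sum F (C - {m}) = (\<Sum>k\<in>{1..<card C}. F ((p ^^ k) m))"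
  proof (rule sum.reindex_cong)
    note en = orbit_enum[OF p, of m, folded C_def]
    show inj: "inj_on (\<lambda>k. (p ^^ k) m) {1..<card C}" by (rule inj_on_subset[OF en(3)]) auto
    have eq: "{1..card C} = insert (card C) {1..<card C}" using en(2) by auto
    have ne: "(p ^^ k) m \<noteq> m" if "k \<in> {1..<card C}" for k
      using inj_onD[OF en(3), of k "card C"] en(1) that by auto
    have "C = insert m ((\<lambda>k. (p ^^ k) m) ` {1..<card C})"
      using en(4) unfolding eq image_insert en(1) .
    moreover have "m \<notin> (\<lambda>k. (p ^^ k) m) ` {1..<card C}"
    proof
      assume "m \<in> (\<lambda>k. (p ^^ k) m) ` {1..<card C}"
      then obtain k where "k \<in> {1..<card C}" "m = (p ^^ k) m" by (rule imageE)
      hence "k \<in> {1..<card C}" "(p ^^ k) m = m" by simp_all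
      with ne show False by blast
    qed
    ultimately show "C - {m} = (\<lambda>k. (p ^^ k) m) ` {1..<card C}" by blast
  qed simp
  also have "\<dots> = (\<Sum>k\<in>{1..<card (orbit p m)}. let q = p \<circ> transp ((p ^^ k) m) m in
        (if g = 0 then 0 else genus_count (g - 1) S q) +
       (\<Sum>J\<in>Pow (cycles S p - {orbit p m}). \<Sum>h\<le>g.
          genus_count h (orbit q m \<union> \<Union>J) q * genus_count (g - h) (S - (orbit q m \<union> \<Union>J)) q))"
    unfolding C_def
  proof (rule sum.cong[OF refl])
    fix k assume "k \<in> {1..<card (orbit p m)}"
    hence "0 < k" "k < card (orbit p m)" by auto
    from genus_count_cut_step[OF sp m(1) this r]
    show "F ((p ^^ k) m) = (let q = p \<circ> transp ((p ^^ k) m) m in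
        (if g = 0 then 0 else genus_count (g - 1) S q) +
       (\<Sum>J\<in>Pow (cycles S p - {orbit p m}). \<Sum>h\<le>g.
          genus_count h (orbit q m \<union> \<Union>J) q * genus_count (g - h) (S - (orbit q m \<union> \<Union>J)) q))"
      unfolding F_def Let_def .
  qed
  finally show ?thesis unfolding I_def C_def by (rule trans[OF _ add.commute])
qed

definition weight :: "nat set \<Rightarrow> real" where
  "weight C = real (card C) * cbin (card C)"

definition planar_value :: "nat set \<Rightarrow> (nat \<Rightarrow> nat) \<Rightarrow> real" where
  "planar_value S p = fact (2 * card S + card (cycles S p) - 3) / fact (2 * card S) * prod weight (cycles S p)"

lemma weight_pos:
  assumes "stable_perm S p" "C \<in> cycles S p"
  shows "weight C > 0"
proof -
  have "card C > 0" using cycles_nonempty[OF assms] cycles_finite_mem[OF assms] by (simp add: card_gt_0_iff)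
  thus ?thesis using cbin_pos by (simp add: weight_def)
qed

lemma planar_value_pos: "stable_perm S p \<Longrightarrow> planar_value S p > 0"
  unfolding planar_value_def by (intro mult_pos_pos divide_pos_pos fact_gt_zero prod_pos) (simp add: weight_pos)

lemma planar_value_disk:
  assumes "stable_perm S p" "C \<in> cycles S p"
  shows "planar_value S p = prod weight (cycles S p - {C}) * disk_coeff card (cycles S p - {C}) (card C)"
proof -
  define I where "I = cycles S p - {C}"
  have c: "card (cycles S p) = Suc (card I)"
    unfolding I_def using assms finite_cycles by (metis card.remove)
  have s: "card S = card C + sum card I"
    unfolding I_def using sum.remove[OF finite_cycles[OF assms(1)] assms(2), of card] sum_card_cycles[OF assms(1)] by simp
  have p: "prod weight (cycles S p) = weight C * prod weight I"
    unfolding I_def using assms finite_cycles by (intro prod.remove) auto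
  have e: "2 * card S + card (cycles S p) - 3 = 2 * card C + 2 * sum card I + card I - 2"
    unfolding c s by simp
  have e': "2 * card S = 2 * card C + 2 * sum card I" unfolding s by simp
  show ?thesis
    unfolding planar_value_def e unfolding disk_coeff_def I_def[symmetric] e' p by (simp add: weight_def)
qed

lemma planar_value_join:
  assumes sp: "stable_perm S p" and m: "m \<in> S" and D: "D \<in> cycles S p - {orbit p m}"
  shows "(\<Sum>s\<in>D. planar_value S (p \<circ> transp s m)) = prod weight (cycles S p - {orbit p m}) *
    (disk_coeff card (cycles S p - {orbit p m} - {D}) (card D + card (orbit p m)) / cbin (card D))"
proof -
  define I where "I = cycles S p - {orbit p m}"
  define d where "d = disk_coeff card (I - {D}) (card D + card (orbit p m))"
  have DD: "D \<in> cycles S p" "D \<noteq> orbit p m" using D by auto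
  have one: "planar_value S (p \<circ> transp s m) = prod weight (I - {D}) * d" if s: "s \<in> D" for s
  proof -
    define q where "q = p \<circ> transp s m"
    note join = cycles_join[OF sp m DD s, folded q_def I_def]
    have q: "stable_perm S q" unfolding q_def by (rule stable_perm_comp[OF sp join(3) m])
    have "orbit q m \<in> cycles S q" using m by (simp add: cycles_def)
    from planar_value_disk[OF q this] show ?thesis
      unfolding q_def[symmetric] join(1,4,6) d_def by (simp add: add.commute)
  qed
  have "card D > 0" using cycles_nonempty[OF sp DD(1)] cycles_finite_mem[OF sp DD(1)] by (simp add: card_gt_0_iff)
  moreover have "prod weight I = weight D * prod weight (I - {D})"
    using D finite_cycles[OF sp] by (intro prod.remove) (auto simp: I_def)
  ultimately have "prod weight I * (d / cbin (card D)) = real (card D) * (prod weight (I - {D}) * d)"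
    using cbin_pos[of "card D"] by (simp add: weight_def)
  moreover have "(\<Sum>s\<in>D. planar_value S (p \<circ> transp s m)) = real (card D) * (prod weight (I - {D}) * d)"
    using one by simp
  ultimately show ?thesis by (simp add: I_def d_def)
qed

lemma planar_value_cut:
  assumes sp: "stable_perm S p" and m: "m \<in> S" and k: "0 < k" "k < card (orbit p m)"
  defines "q \<equiv> p \<circ> transp ((p ^^ k) m) m" and "I \<equiv> cycles S p - {orbit p m}"
  assumes J: "J \<subseteq> I"
  defines "A \<equiv> orbit q m \<union> \<Union>J"
  shows "planar_value A q * planar_value (S - A) q = prod weight I *
    (disk_coeff card J (card (orbit p m) - k) * disk_coeff card (I - J) k)"
proof -
  define s where "s = (p ^^ k) m"
  note comp = cut_components[OF sp m k, folded q_def I_def, OF J, folded A_def s_def]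
  note cut = cycles_cut[OF sp m k, folded q_def I_def s_def]
  have cA: "cycles A q - {orbit q m} = J" unfolding comp(6) using cut(8) J by blast
  have cB: "cycles (S - A) q - {orbit q s} = I - J" unfolding comp(7) using cut(9) by blast
  have "planar_value A q = prod weight J * disk_coeff card J (card (orbit p m) - k)"
  proof -
    have "orbit q m \<in> cycles A q" unfolding comp(6) by simp
    from planar_value_disk[OF comp(4) this] show ?thesis unfolding cA cut(2) .
  qed
  moreover have "planar_value (S - A) q = prod weight (I - J) * disk_coeff card (I - J) k"
  proof -
    have "orbit q s \<in> cycles (S - A) q" unfolding comp(7) by simp
    from planar_value_disk[OF comp(5) this] show ?thesis unfolding cB cut(3) .
  qed
  moreover have "prod weight I = prod weight (I - J) * prod weight J"
    using J finite_cycles[OF sp] by (intro prod.subset_diff) (auto simp: I_def)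
  ultimately show ?thesis by simp
qed

theorem planar_value_rec:
  assumes sp: "stable_perm S p" and m: "m \<in> S" "S \<noteq> {m}"
  shows "planar_value S p = (\<Sum>D\<in>cycles S p - {orbit p m}. \<Sum>s\<in>D. planar_value S (p \<circ> transp s m))
    + (\<Sum>k\<in>{1..<card (orbit p m)}. let q = p \<circ> transp ((p ^^ k) m) m in
       (\<Sum>J\<in>Pow (cycles S p - {orbit p m}).
          planar_value (orbit q m \<union> \<Union>J) q * planar_value (S - (orbit q m \<union> \<Union>J)) q))"
proof -
  define I where "I = cycles S p - {orbit p m}"
  define a where "a = card (orbit p m)"
  have fin: "finite I" using finite_cycles[OF sp] by (simp add: I_def)
  have CC: "orbit p m \<in> cycles S p" using m by (simp add: cycles_def)
  have a: "a \<ge> 1" using cycles_nonempty[OF sp CC] cycles_finite_mem[OF sp CC]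
    by (simp add: a_def Suc_le_eq card_gt_0_iff)
  have nt: "\<not> (I = {} \<and> a = 1)"
  proof
    assume *: "I = {} \<and> a = 1"
    hence "S = orbit p m" using Union_cycles[OF sp] CC by (auto simp: I_def)
    hence "card S = 1" using * by (simp add: a_def)
    thus False using m by (auto simp: card_1_singleton_iff)
  qed
  have "planar_value S p = prod weight I * disk_coeff card I a"
    unfolding I_def a_def by (rule planar_value_disk[OF sp CC])
  also have "disk_coeff card I a = (\<Sum>D\<in>I. disk_coeff card (I - {D}) (card D + a) / cbin (card D))
     + (\<Sum>J\<in>Pow I. \<Sum>i\<in>{1..<a}. disk_coeff card J i * disk_coeff card (I - J) (a - i))"
    using disk_coeff_rec[OF fin a, of card] nt by simp
  also have "(\<Sum>J\<in>Pow I. \<Sum>i\<in>{1..<a}. disk_coeff card J i * disk_coeff card (I - J) (a - i))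
    = (\<Sum>i\<in>{1..<a}. \<Sum>J\<in>Pow I. disk_coeff card J i * disk_coeff card (I - J) (a - i))"
    by (rule sum.swap)
  also have "\<dots> = (\<Sum>k\<in>{1..<a}. \<Sum>J\<in>Pow I. disk_coeff card J (a - k) * disk_coeff card (I - J) k)"
    by (rule sum.reindex_bij_witness[of _ "\<lambda>k. a - k" "\<lambda>k. a - k"]) auto
  finally have "planar_value S p = (\<Sum>D\<in>I. prod weight I * (disk_coeff card (I - {D}) (card D + a) / cbin (card D)))
     + (\<Sum>k\<in>{1..<a}. \<Sum>J\<in>Pow I. prod weight I * (disk_coeff card J (a - k) * disk_coeff card (I - J) k))"
    by (simp only: distrib_left sum_distrib_left)
  also have "(\<Sum>D\<in>I. prod weight I * (disk_coeff card (I - {D}) (card D + a) / cbin (card D)))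
     = (\<Sum>D\<in>I. \<Sum>s\<in>D. planar_value S (p \<circ> transp s m))"
    unfolding I_def a_def by (rule sum.cong[OF refl]) (simp only: planar_value_join[OF sp m(1)])
  also have "(\<Sum>k\<in>{1..<a}. \<Sum>J\<in>Pow I. prod weight I * (disk_coeff card J (a - k) * disk_coeff card (I - J) k))
    = (\<Sum>k\<in>{1..<a}. let q = p \<circ> transp ((p ^^ k) m) m in
       (\<Sum>J\<in>Pow I. planar_value (orbit q m \<union> \<Union>J) q * planar_value (S - (orbit q m \<union> \<Union>J)) q))"
    unfolding Let_def
  proof (intro sum.cong refl)
    fix k J assume "k \<in> {1..<a}" "J \<in> Pow I"
    hence "0 < k" "k < card (orbit p m)" "J \<subseteq> cycles S p - {orbit p m}" by (auto simp: a_def I_def)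
    from planar_value_cut[OF sp m(1) this]
    show "prod weight I * (disk_coeff card J (a - k) * disk_coeff card (I - J) k) =
      planar_value (orbit (p \<circ> transp ((p ^^ k) m) m) m \<union> \<Union>J) (p \<circ> transp ((p ^^ k) m) m) *
      planar_value (S - (orbit (p \<circ> transp ((p ^^ k) m) m) m \<union> \<Union>J)) (p \<circ> transp ((p ^^ k) m) m)"
      by (simp add: a_def I_def)
  qed
  finally show ?thesis unfolding I_def a_def .
qed

lemma complexity_cut:
  assumes sp: "stable_perm S p" and m: "m \<in> S" and k: "0 < k" "k < card (orbit p m)"
  defines "q \<equiv> p \<circ> transp ((p ^^ k) m) m"
  assumes J: "J \<subseteq> cycles S p - {orbit p m}"
  defines "A \<equiv> orbit q m \<union> \<Union>J"
  shows "stable_perm S q" "complexity S q = Suc (complexity S p)"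
    "stable_perm A q" "A \<noteq> {}" "stable_perm (S - A) q" "S - A \<noteq> {}"
    "complexity A q + complexity (S - A) q = Suc (complexity S p)" "card A + card (S - A) = card S"
    "complexity A q < complexity S p" "complexity (S - A) q < complexity S p"
proof -
  note cut = cycles_cut[OF sp m k, folded q_def]
  note comp = cut_components[OF sp m k, folded q_def, OF J, folded A_def]
  show q: "stable_perm S q" unfolding q_def by (rule stable_perm_comp[OF sp cut(1) m])
  show cq: "complexity S q = Suc (complexity S p)" using cut(10) by (simp add: complexity_def)
  show A: "stable_perm A q" "stable_perm (S - A) q" "A \<noteq> {}" "S - A \<noteq> {}"
    using comp cut(1) by blast+
  show c: "complexity A q + complexity (S - A) q = Suc (complexity S p)"
    using complexity_split[OF q A(1) comp(1)] cq by simp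
  thus "complexity A q < complexity S p" "complexity (S - A) q < complexity S p"
    using complexity_ge[OF A(1,3)] complexity_ge[OF A(2,4)] by linarith+
  have "finite S" using sp by (simp add: stable_perm_def)
  thus "card A + card (S - A) = card S" using comp(1)
    by (metis card_Diff_subset card_mono finite_subset le_add_diff_inverse)
qed

lemma complexity_join:
  assumes sp: "stable_perm S p" and m: "m \<in> S" and D: "D \<in> cycles S p - {orbit p m}" "s \<in> D"
  defines "q \<equiv> p \<circ> transp s m"
  shows "stable_perm S q" "Suc (complexity S q) = complexity S p"
proof -
  have DD: "D \<in> cycles S p" "D \<noteq> orbit p m" using D by auto
  note join = cycles_join[OF sp m DD D(2), folded q_def]
  show "stable_perm S q" unfolding q_def by (rule stable_perm_comp[OF sp join(3) m])
  show "Suc (complexity S q) = complexity S p" using join(5) by (simp add: complexity_def)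
qed

lemma genus_count_singleton:
  assumes "stable_perm {x} p"
  shows "genus_count g {x} p = (if g = 0 then 1 else 0)" "planar_value {x} p = 1"
proof -
  have px: "p x = x" using assms by (simp add: stable_perm_def)
  have cyc: "cycles {x} p = {{x}}" using px by (simp add: cycles_def orbit_eq_singleton_iff[THEN iffD2])
  have c: "complexity {x} p = 2" by (simp add: complexity_def cyc)
  show "genus_count g {x} p = (if g = 0 then 1 else 0)"
  proof (cases g)
    case 0
    thus ?thesis by (simp add: genus_count_def c monotone_walks_0 px)
  next
    case (Suc h)
    thus ?thesis by (simp add: genus_count_def c monotone_walks_singleton_Suc)
  qed
  show "planar_value {x} p = 1" using cbin_Suc[of 0] by (simp add: planar_value_def cyc weight_def)
qed

theorem genus_count_genus_0:
  assumes "stable_perm S p" "S \<noteq> {}"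
  shows "real (genus_count 0 S p) = planar_value S p"
  using assms
proof (induction "complexity S p" arbitrary: S p rule: less_induct)
  case less
  note sp = less.prems(1)
  have "finite S" using sp by (simp add: stable_perm_def)
  from this less.prems(2) show ?case
  proof (cases rule: Max_singleton_or)
    case (1 x)
    thus ?thesis using genus_count_singleton sp by simp
  next
    case (2 m)
    define I where "I = cycles S p - {orbit p m}"
    have "real (genus_count 0 S p) = (\<Sum>D\<in>I. \<Sum>s\<in>D. real (genus_count 0 S (p \<circ> transp s m)))
    + (\<Sum>k\<in>{1..<card (orbit p m)}. let q = p \<circ> transp ((p ^^ k) m) m in
       (\<Sum>J\<in>Pow I. real (genus_count 0 (orbit q m \<union> \<Union>J) q) * real (genus_count 0 (S - (orbit q m \<union> \<Union>J)) q)))"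
      unfolding genus_count_rec[OF sp 2] I_def by (simp add: Let_def)
    also have "(\<Sum>D\<in>I. \<Sum>s\<in>D. real (genus_count 0 S (p \<circ> transp s m)))
       = (\<Sum>D\<in>I. \<Sum>s\<in>D. planar_value S (p \<circ> transp s m))"
    proof (intro sum.cong refl)
      fix D s assume "D \<in> I" "s \<in> D"
      from complexity_join[OF sp 2(1) this[unfolded I_def]]
      show "real (genus_count 0 S (p \<circ> transp s m)) = planar_value S (p \<circ> transp s m)"
        by (intro less.hyps less.prems(2)) simp_all
    qed
    also have "(\<Sum>k\<in>{1..<card (orbit p m)}. let q = p \<circ> transp ((p ^^ k) m) m in
       (\<Sum>J\<in>Pow I. real (genus_count 0 (orbit q m \<union> \<Union>J) q) * real (genus_count 0 (S - (orbit q m \<union> \<Union>J)) q)))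
       = (\<Sum>k\<in>{1..<card (orbit p m)}. let q = p \<circ> transp ((p ^^ k) m) m in
       (\<Sum>J\<in>Pow I. planar_value (orbit q m \<union> \<Union>J) q * planar_value (S - (orbit q m \<union> \<Union>J)) q))"
      unfolding Let_def
    proof (intro sum.cong refl arg_cong2[where f = "(*)"])
      fix k J assume "k \<in> {1..<card (orbit p m)}" "J \<in> Pow I"
      hence k: "0 < k" "k < card (orbit p m)" and J: "J \<subseteq> cycles S p - {orbit p m}"
        by (auto simp: I_def)
      note c = complexity_cut[OF sp 2(1) k J]
      show "real (genus_count 0 (orbit (p \<circ> transp ((p ^^ k) m) m) m \<union> \<Union>J) (p \<circ> transp ((p ^^ k) m) m))
        = planar_value (orbit (p \<circ> transp ((p ^^ k) m) m) m \<union> \<Union>J) (p \<circ> transp ((p ^^ k) m) m)"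
        by (rule less.hyps[OF c(9,3,4)])
      show "real (genus_count 0 (S - (orbit (p \<circ> transp ((p ^^ k) m) m) m \<union> \<Union>J)) (p \<circ> transp ((p ^^ k) m) m))
        = planar_value (S - (orbit (p \<circ> transp ((p ^^ k) m) m) m \<union> \<Union>J)) (p \<circ> transp ((p ^^ k) m) m)"
        by (rule less.hyps[OF c(10,5,6)])
    qed
    finally show ?thesis unfolding planar_value_rec[OF sp 2(1,3)] I_def .
  qed
qed

lemma cbin_mult_le: "cbin i * cbin j \<le> cbin (i + j)"
proof -
  have "((2 * i) choose i) * ((2 * j) choose j) = (\<lambda>k. ((2 * i) choose k) * ((2 * j) choose (i + j - k))) i" by simp
  also have "\<dots> \<le> (\<Sum>k\<le>i + j. ((2 * i) choose k) * ((2 * j) choose (i + j - k)))"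
    by (rule member_le_sum) auto
  also have "\<dots> = (2 * i + 2 * j) choose (i + j)" by (rule vandermonde)
  finally have "((2 * i) choose i) * ((2 * j) choose j) \<le> (2 * (i + j)) choose (i + j)" by (simp add: distrib_left)
  thus ?thesis unfolding cbin_def by (metis of_nat_le_iff of_nat_mult)
qed

definition excess :: "nat set \<Rightarrow> (nat \<Rightarrow> nat) \<Rightarrow> nat" where
  "excess S p = card S + complexity S p - 2"

lemma excess_ge:
  assumes "stable_perm S p" "S \<noteq> {}"
  shows "card S \<le> excess S p" "1 \<le> excess S p" "excess S p + 2 = card S + complexity S p"
proof -
  have "card S \<ge> 1" using assms by (simp add: stable_perm_def Suc_le_eq card_gt_0_iff)
  thus "card S \<le> excess S p" "1 \<le> excess S p" "excess S p + 2 = card S + complexity S p"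
    using complexity_ge[OF assms] by (simp_all add: excess_def)
qed

lemma planar_value_cut_le:
  assumes sp: "stable_perm S p" and m: "m \<in> S" and k: "0 < k" "k < card (orbit p m)"
  defines "q \<equiv> p \<circ> transp ((p ^^ k) m) m"
  shows "planar_value S q \<le> real (excess S p) ^ 2 * planar_value S p"
proof -
  define s where "s = (p ^^ k) m"
  define C where "C = orbit p m"
  define I where "I = cycles S p - {C}"
  define n where "n = excess S p"
  note cut = cycles_cut[OF sp m k, folded q_def, folded s_def C_def, folded I_def]
  have ne: "S \<noteq> {}" using m by auto
  have fin: "finite I" using finite_cycles[OF sp] by (simp add: I_def)
  have CC: "C \<in> cycles S p" using m by (simp add: cycles_def C_def)
  have cycq: "cycles S q = insert (orbit q m) (insert (orbit q s) I)"
    unfolding I_def C_def s_def q_def by (rule cycles_cut_insert[OF sp m k])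
  have "orbit q m \<noteq> orbit q s"
    using cut(4,5) stable_perm_self[OF sp] cut(7) cut(9)
    by (metis Diff_iff insertI1)
  hence pq: "prod weight (cycles S q) = weight (orbit q m) * (weight (orbit q s) * prod weight I)"
    unfolding cycq using fin cut(8,9) by (simp only: prod.insert finite_insert insert_iff simp_thms)
  have pp: "prod weight (cycles S p) = weight C * prod weight I"
    unfolding I_def using CC finite_cycles[OF sp] by (intro prod.remove) auto
  have aS: "card C \<le> card S" using stable_perm_orbit[OF sp m] sp by (auto simp: C_def stable_perm_def intro: card_mono)
  hence an: "real (card C) \<le> real n" using excess_ge[OF sp ne] by (simp add: n_def)
  have w: "weight (orbit q m) * weight (orbit q s) \<le> real n * weight C"
  proof -
    have "weight (orbit q m) * weight (orbit q s)
       = (real (card C - k) * real k) * (cbin (card C - k) * cbin k)"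
      by (simp add: weight_def cut(2,3))
    also have "\<dots> \<le> (real (card C) * real (card C)) * cbin (card C - k + k)"
      using k cbin_pos[of k] cbin_pos[of "card C - k"]
      by (intro mult_mono cbin_mult_le) (auto simp: C_def less_imp_le)
    also have "\<dots> = real (card C) * weight C" using k by (simp add: weight_def C_def)
    also have "\<dots> \<le> real n * weight C" using an weight_pos[OF sp CC] by (intro mult_right_mono) auto
    finally show ?thesis .
  qed
  have en: "2 * card S + card (cycles S p) - 3 = n - 1" "2 * card S + card (cycles S q) - 3 = n"
    using excess_ge(3)[OF sp ne] cut(10) by (simp_all add: n_def complexity_def)
  have "(fact n :: real) = real n * fact (n - 1)"
    using excess_ge(2)[OF sp ne] by (intro fact_reduce) (simp add: n_def)
  hence "planar_value S q = real n * (fact (n - 1) / fact (2 * card S) * prod weight I) *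
      (weight (orbit q m) * weight (orbit q s))"
    unfolding planar_value_def en pq by simp
  also have "\<dots> \<le> real n * (fact (n - 1) / fact (2 * card S) * prod weight I) * (real n * weight C)"
  proof (rule mult_left_mono[OF w])
    have "prod weight I \<ge> 0" using weight_pos[OF sp] by (intro prod_nonneg) (auto simp: I_def less_imp_le)
    thus "real n * (fact (n - 1) / fact (2 * card S) * prod weight I) \<ge> 0" by simp
  qed
  also have "\<dots> = real n ^ 2 * planar_value S p"
    unfolding planar_value_def en pp by (simp add: power2_eq_square)
  finally show ?thesis by (simp add: n_def)
qed

lemma power_add_le_add_power:
  fixes x y :: real
  assumes "x \<ge> 0" "y \<ge> 0" "e \<ge> 1"
  shows "x ^ e + y ^ e \<le> (x + y) ^ e"
proof -
  obtain d where e: "e = Suc d" using assms(3) by (cases e) auto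
  have "x ^ e + y ^ e = x * x ^ d + y * y ^ d" by (simp add: e)
  also have "\<dots> \<le> x * (x + y) ^ d + y * (x + y) ^ d"
    using assms by (intro add_mono mult_left_mono power_mono) auto
  finally show ?thesis by (simp add: e distrib_right)
qed

lemma sum_genus_split:
  fixes f :: "nat \<Rightarrow> real"
  assumes "g \<ge> 1"
  shows "(\<Sum>h\<le>g. f h) = f 0 + f g + (\<Sum>h\<in>{1..<g}. f h)"
proof -
  have "{..g} = insert 0 (insert g {1..<g})" using assms by auto
  thus ?thesis using assms by simp
qed

lemma genus_count_bound_step:
  fixes M :: real
  assumes g: "g \<ge> 1" and M: "M \<ge> 0"
    and below: "\<And>h S p. h < g \<Longrightarrow> stable_perm S p \<Longrightarrow> S \<noteq> {} \<Longrightarrow>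
       real (genus_count h S p) \<le> M * real (excess S p) ^ (5 * h - 1) * planar_value S p"
    and genus0: "\<And>S p. stable_perm S p \<Longrightarrow> S \<noteq> {} \<Longrightarrow> real (genus_count 0 S p) \<le> planar_value S p"
  defines "K \<equiv> 2 ^ (5 * g - 1) * M + real g * M ^ 2"
  assumes "stable_perm S p" "S \<noteq> {}"
  shows "real (genus_count g S p) \<le> K * real (excess S p) ^ (5 * g - 1) * planar_value S p"
  using assms(6,7)
proof (induction "complexity S p" arbitrary: S p rule: less_induct)
  case less
  note sp = less.prems(1)
  define e where "e = 5 * g - 1"
  have e: "e \<ge> 4" using g by (simp add: e_def)
  have K: "K \<ge> 0" using M by (simp add: K_def)
  have fin: "finite S" using sp by (simp add: stable_perm_def)
  from fin less.prems(2) show ?case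
  proof (cases rule: Max_singleton_or)
    case (1 x)
    thus ?thesis using genus_count_singleton[of x p] sp g K by simp
  next
    case (2 m)
    define C where "C = orbit p m"
    define I where "I = cycles S p - {C}"
    define q where "q k = p \<circ> transp ((p ^^ k) m) m" for k
    define A where "A k J = orbit (q k) m \<union> \<Union>J" for k J
    define n where "n = real (excess S p)"
    have n: "n \<ge> 1" "real (card S) \<le> n" using excess_ge[OF sp less.prems(2)] by (auto simp: n_def)
    define X where "X = K * (n - 1) ^ e + real g * M ^ 2 * n ^ (e - 1)"
    have X0: "K * (n - 1) ^ e \<le> X" using n M by (simp add: X_def)
    have planar_nonneg: "planar_value S p \<ge> 0" if "stable_perm S p" for S p using planar_value_pos[OF that] by simp
    have join: "real (genus_count g S (p \<circ> transp s m)) \<le> X * planar_value S (p \<circ> transp s m)"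
      if "D \<in> I" "s \<in> D" for D s
    proof -
      note c = complexity_join[OF sp 2(1) that[unfolded I_def C_def]]
      have "real (genus_count g S (p \<circ> transp s m)) \<le>
         K * real (excess S (p \<circ> transp s m)) ^ e * planar_value S (p \<circ> transp s m)"
        unfolding e_def using c by (intro less.hyps less.prems(2)) simp_all
      also have "real (excess S (p \<circ> transp s m)) = n - 1"
      proof -
        have "Suc (excess S (p \<circ> transp s m)) = excess S p"
          using c(2) excess_ge(3)[OF sp less.prems(2)] excess_ge(3)[OF c(1) less.prems(2)] by simp
        thus ?thesis by (simp add: n_def flip: of_nat_Suc)
      qed
      also have "K * (n - 1) ^ e * planar_value S (p \<circ> transp s m) \<le> X * planar_value S (p \<circ> transp s m)"
        using X0 planar_nonneg[OF c(1)] by (rule mult_right_mono)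
      finally show ?thesis .
    qed
    have conn: "real (genus_count (g - 1) S (q k)) \<le> M * 2 ^ e * n ^ (e - 2) * planar_value S p" if k: "k \<in> {1..<card C}" for k
    proof -
      have k': "0 < k" "k < card (orbit p m)" using k by (auto simp: C_def)
      note c = complexity_cut(1,2)[OF sp 2(1) k' empty_subsetI, folded q_def]
      define e' where "e' = 5 * (g - 1) - 1"
      have e': "e' \<le> e" "e' + 2 \<le> e - 2" using g by (auto simp: e_def e'_def)
      have "excess S (q k) = Suc (excess S p)"
        using c(2) excess_ge(3)[OF sp less.prems(2)] excess_ge(3)[OF c(1) less.prems(2)] by simp
      hence ex: "real (excess S (q k)) \<le> 2 * n" using n by (simp add: n_def)
      have "real (genus_count (g - 1) S (q k)) \<le> M * real (excess S (q k)) ^ e' * planar_value S (q k)"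
        unfolding e'_def using g c(1) less.prems(2) by (intro below) auto
      also have "\<dots> \<le> M * (2 * n) ^ e' * (n ^ 2 * planar_value S p)"
        using M n ex planar_value_cut_le[OF sp 2(1) k', folded q_def n_def] planar_nonneg[OF c(1)]
        by (intro mult_mono power_mono mult_nonneg_nonneg) auto
      also have "\<dots> = M * 2 ^ e' * n ^ (e' + 2) * planar_value S p"
        by (simp add: power_mult_distrib power_add power2_eq_square)
      also have "\<dots> \<le> M * 2 ^ e * n ^ (e - 2) * planar_value S p"
        using M n e' planar_nonneg[OF sp] by (intro mult_mono mult_nonneg_nonneg power_increasing) auto
      finally show ?thesis .
    qed
    have disc: "(\<Sum>h\<le>g. real (genus_count h (A k J) (q k)) * real (genus_count (g - h) (S - A k J) (q k)))
        \<le> X * (planar_value (A k J) (q k) * planar_value (S - A k J) (q k))" if k: "k \<in> {1..<card C}" and J: "J \<subseteq> I" for k J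
    proof -
      have k': "0 < k" "k < card (orbit p m)" using k by (auto simp: C_def)
      define P Q R where "P = A k J" and "Q = S - A k J" and "R = q k"
      note c = complexity_cut[OF sp 2(1) k' J[unfolded I_def C_def], folded q_def, folded A_def, folded P_def Q_def R_def]
      have QP: "S - P = Q" by (simp add: P_def Q_def)
      note c = c[unfolded QP]
      define u v where "u = real (excess P R)" and "v = real (excess Q R)"
      have u: "u \<ge> 1" and v: "v \<ge> 1" using excess_ge(2) c(3-6) by (auto simp: u_def v_def)
      have "excess P R + excess Q R + 1 = excess S p"
        using excess_ge(3)[OF c(3,4)] excess_ge(3)[OF c(5,6)] excess_ge(3)[OF sp less.prems(2)] c(7,8) by simp
      hence uv: "u + v = n - 1" unfolding u_def v_def n_def by (metis add_diff_cancel_right' of_nat_1 of_nat_add)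
      define G where "G = planar_value P R * planar_value Q R"
      have gP: "planar_value P R \<ge> 0" and gQ: "planar_value Q R \<ge> 0" using planar_nonneg c(3,5) by auto
      have t0: "real (genus_count 0 P R) * real (genus_count g Q R) \<le> K * v ^ e * G"
      proof -
        have "real (genus_count 0 P R) * real (genus_count g Q R) \<le> planar_value P R * (K * v ^ e * planar_value Q R)"
          unfolding v_def e_def using gP by (intro mult_mono genus0[OF c(3,4)] less.hyps[OF c(10,5,6)]) auto
        thus ?thesis by (simp add: G_def mult_ac)
      qed
      have tg: "real (genus_count g P R) * real (genus_count 0 Q R) \<le> K * u ^ e * G"
      proof -
        have "real (genus_count g P R) * real (genus_count 0 Q R) \<le> (K * u ^ e * planar_value P R) * planar_value Q R"
          unfolding u_def e_def using gP K by (intro mult_mono genus0[OF c(5,6)] less.hyps[OF c(9,3,4)]) auto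
        thus ?thesis by (simp add: G_def mult_ac)
      qed
      have th: "real (genus_count h P R) * real (genus_count (g - h) Q R) \<le> M ^ 2 * n ^ (e - 1) * G" if h: "h \<in> {1..<g}" for h
      proof -
        have "real (genus_count h P R) * real (genus_count (g - h) Q R) \<le>
           (M * u ^ (5 * h - 1) * planar_value P R) * (M * v ^ (5 * (g - h) - 1) * planar_value Q R)"
          unfolding u_def v_def using h gP M by (intro mult_mono below c(3-6)) auto
        also have "\<dots> \<le> (M * n ^ (5 * h - 1) * planar_value P R) * (M * n ^ (5 * (g - h) - 1) * planar_value Q R)"
          using M gP gQ u v uv by (intro mult_mono power_mono mult_nonneg_nonneg zero_le_power) auto
        also have "\<dots> = M ^ 2 * n ^ ((5 * h - 1) + (5 * (g - h) - 1)) * G"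
          by (simp add: G_def power_add power2_eq_square)
        also have "(5 * h - 1) + (5 * (g - h) - 1) = e - 1" using h by (auto simp: e_def)
        finally show ?thesis .
      qed
      have "(\<Sum>h\<le>g. real (genus_count h P R) * real (genus_count (g - h) Q R))
         = real (genus_count 0 P R) * real (genus_count g Q R) + real (genus_count g P R) * real (genus_count 0 Q R)
           + (\<Sum>h\<in>{1..<g}. real (genus_count h P R) * real (genus_count (g - h) Q R))"
        using sum_genus_split[OF g, of "\<lambda>h. real (genus_count h P R) * real (genus_count (g - h) Q R)"] by simp
      also have "\<dots> \<le> K * v ^ e * G + K * u ^ e * G + (\<Sum>h\<in>{1..<g}. M ^ 2 * n ^ (e - 1) * G)"
        using t0 tg th by (intro add_mono sum_mono) auto
      also have "\<dots> = (K * (u ^ e + v ^ e) + real (g - 1) * M ^ 2 * n ^ (e - 1)) * G"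
        by (simp add: algebra_simps)
      also have "\<dots> \<le> X * G"
      proof (rule mult_right_mono)
        have "u ^ e + v ^ e \<le> (n - 1) ^ e"
          using power_add_le_add_power[of u v e] u v e uv by simp
        thus "K * (u ^ e + v ^ e) + real (g - 1) * M ^ 2 * n ^ (e - 1) \<le> X"
          unfolding X_def using K M n by (intro add_mono mult_left_mono mult_right_mono) auto
        show "0 \<le> G" unfolding G_def using gP gQ by simp
      qed
      finally show ?thesis by (simp add: G_def P_def Q_def R_def)
    qed
    have card_C: "real (card {1..<card C}) \<le> n"
    proof -
      have "card C \<le> card S" unfolding C_def using stable_perm_orbit[OF sp 2(1)] fin by (rule card_mono[rotated])
      thus ?thesis using n by simp
    qed
    have "real (genus_count g S p) = (\<Sum>D\<in>I. \<Sum>s\<in>D. real (genus_count g S (p \<circ> transp s m)))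
      + ((\<Sum>k\<in>{1..<card C}. real (genus_count (g - 1) S (q k)))
      + (\<Sum>k\<in>{1..<card C}. \<Sum>J\<in>Pow I. \<Sum>h\<le>g. real (genus_count h (A k J) (q k)) * real (genus_count (g - h) (S - A k J) (q k))))"
      unfolding genus_count_rec[OF sp 2] I_def C_def A_def q_def using g by (simp add: Let_def sum.distrib)
    also have "\<dots> \<le> (\<Sum>D\<in>I. \<Sum>s\<in>D. X * planar_value S (p \<circ> transp s m))
      + ((\<Sum>k\<in>{1..<card C}. M * 2 ^ e * n ^ (e - 2) * planar_value S p)
      + (\<Sum>k\<in>{1..<card C}. \<Sum>J\<in>Pow I. X * (planar_value (A k J) (q k) * planar_value (S - A k J) (q k))))"
      by (intro add_mono sum_mono join conn disc) auto
    also have "\<dots> = X * planar_value S p + real (card {1..<card C}) * (M * 2 ^ e * n ^ (e - 2) * planar_value S p)"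
      unfolding planar_value_rec[OF sp 2(1,3)] I_def C_def A_def q_def Let_def
      by (simp only: sum_distrib_left[symmetric] distrib_left sum_constant add_ac)
    also have "\<dots> \<le> X * planar_value S p + n * (M * 2 ^ e * n ^ (e - 2) * planar_value S p)"
      using card_C M n planar_nonneg[OF sp] by (intro add_left_mono mult_right_mono) auto
    also have "\<dots> = (X + 2 ^ e * M * (n * n ^ (e - 2))) * planar_value S p" by (simp add: algebra_simps)
    also have "n * n ^ (e - 2) = n ^ (e - 1)"     proof -
      have "e - 1 = Suc (e - 2)" using e by simp
      thus ?thesis by simp
    qed
    also have "X + 2 ^ e * M * n ^ (e - 1) = K * ((n - 1) ^ e + n ^ (e - 1))"
      unfolding X_def K_def e_def[symmetric] by (simp add: algebra_simps)
    also have "\<dots> * planar_value S p \<le> K * n ^ e * planar_value S p"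
    proof (intro mult_right_mono mult_left_mono K planar_nonneg[OF sp])
      obtain d where d: "e = Suc d" using e by (cases e) auto
      have "(n - 1) ^ e \<le> (n - 1) * n ^ d" unfolding d power_Suc using n by (intro mult_left_mono power_mono) auto
      thus "(n - 1) ^ e + n ^ (e - 1) \<le> n ^ e" by (simp add: d algebra_simps)
    qed
    finally show ?thesis by (simp add: n_def e_def)
  qed
qed

theorem genus_count_bound:
  "\<exists>K\<ge>0. \<forall>S p. stable_perm S p \<longrightarrow> S \<noteq> {} \<longrightarrow>
     real (genus_count g S p) \<le> K * real (excess S p) ^ (5 * g - 1) * planar_value S p"
proof (induction g rule: less_induct)
  case (less g)
  show ?case
  proof (cases "g = 0")
    case True
    thus ?thesis using genus_count_genus_0 by (intro exI[of _ 1]) auto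
  next
    case False
    from less.IH obtain K where K: "\<And>h. h < g \<Longrightarrow> K h \<ge> 0"
      "\<And>h S p. h < g \<Longrightarrow> stable_perm S p \<Longrightarrow> S \<noteq> {} \<Longrightarrow>
         real (genus_count h S p) \<le> K h * real (excess S p) ^ (5 * h - 1) * planar_value S p"
      by metis
    define M where "M = sum K {..<g}"
    have M: "M \<ge> 0" unfolding M_def using K(1) by (intro sum_nonneg) auto
    have KM: "K h \<le> M" if "h < g" for h
      unfolding M_def using K(1) that by (intro member_le_sum) auto
    have below: "real (genus_count h S p) \<le> M * real (excess S p) ^ (5 * h - 1) * planar_value S p"
      if "h < g" "stable_perm S p" "S \<noteq> {}" for h S p
    proof -
      have "K h * real (excess S p) ^ (5 * h - 1) * planar_value S p \<le> M * real (excess S p) ^ (5 * h - 1) * planar_value S p"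
        using KM[OF that(1)] planar_value_pos[OF that(2)] by (intro mult_right_mono) auto
      thus ?thesis using K(2)[OF that] by linarith
    qed
    have "2 ^ (5 * g - 1) * M + real g * M ^ 2 \<ge> 0" using M by simp
    moreover have "real (genus_count g S p) \<le> (2 ^ (5 * g - 1) * M + real g * M ^ 2) * real (excess S p) ^ (5 * g - 1) * planar_value S p"
      if "stable_perm S p" "S \<noteq> {}" for S p
      using False M below that by (intro genus_count_bound_step) (auto simp: genus_count_genus_0)
    ultimately show ?thesis by blast
  qed
qed

section \<open>Reordering colours\<close>

definition closed_walks :: "nat set \<Rightarrow> nat list \<Rightarrow> (nat \<times> nat) list set" where
  "closed_walks S c = {w. map snd w = c \<and> steps_in S w \<and> wprod w = id \<and> linked S w}"

lemma finite_closed_walks: "finite S \<Longrightarrow> finite (closed_walks S c)"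
  by (rule finite_subset[OF _ finite_walks_length[of S "length c"]]) (auto simp: closed_walks_def)

lemma steps_in_append: "steps_in S (u @ v) \<longleftrightarrow> steps_in S u \<and> steps_in S v"
  by (auto simp: steps_in_def)

lemma steps_in_Cons: "steps_in S ((s, t) # w) \<longleftrightarrow> s \<in> S \<and> t \<in> S \<and> s < t \<and> steps_in S w"
  by (auto simp: steps_in_def)

lemma steps_in_Nil: "steps_in S []"
  by (simp add: steps_in_def)

lemma closed_under_append: "closed_under (u @ v) A \<longleftrightarrow> closed_under u A \<and> closed_under v A"
  by (auto simp: closed_under_def)

lemma transpose_conj:
  assumes "s \<noteq> j" "i \<noteq> j"
  shows "transp t j \<circ> transp s i
    = transp s i \<circ> transp (transp s i t) j"
proof
  fix x
  show "(transp t j \<circ> transp s i) x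
    = (transp s i \<circ> transp (transp s i t) j) x"
    using assms by (simp add: Transposition.transpose_def)
qed

fun swap_steps :: "(nat \<times> nat) \<Rightarrow> (nat \<times> nat) \<Rightarrow> (nat \<times> nat) list" where
  "swap_steps (t, j) (s, i) = [(s, i), (transp s i t, j)]"

lemma card_closed_walks_swap:
  assumes "finite S" "i < j"
  shows "card (closed_walks S (u @ j # i # v)) \<le> card (closed_walks S (u @ i # j # v))"
proof -
  define n where "n = length u"
  define f where "f w = take n w @ swap_steps (w ! n) (w ! Suc n) @ drop (Suc (Suc n)) w" for w
  have dec: "\<exists>a t s b. w = a @ (t, j) # (s, i) # b \<and> length a = n \<and> map snd a = u \<and> map snd b = v"
    if "w \<in> closed_walks S (u @ j # i # v)" for w
  proof -
    from that have "map snd w = u @ j # i # v" by (simp add: closed_walks_def)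
    then obtain a w' where a: "w = a @ w'" "map snd a = u" "map snd w' = j # i # v"
      by (auto simp: map_eq_append_conv)
    then obtain e1 w'' where e1: "w' = e1 # w''" "snd e1 = j" "map snd w'' = i # v" by auto
    then obtain e2 b where e2: "w'' = e2 # b" "snd e2 = i" "map snd b = v" by auto
    have "w = a @ (fst e1, j) # (fst e2, i) # b" using a(1) e1(1,2) e2(1,2) by (cases e1; cases e2) simp
    moreover have "length a = n" using arg_cong[OF a(2), of length] by (simp add: n_def)
    ultimately show ?thesis using a(2) e2(3) by blast
  qed
  have fw: "f (a @ (t, j) # (s, i) # b) = a @ (s, i) # (transp s i t, j) # b" if "length a = n" for a t s b
    using that by (simp add: f_def nth_append)
  show ?thesis
  proof (rule card_inj_on_le[of f])
    show "inj_on f (closed_walks S (u @ j # i # v))"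
    proof (rule inj_onI)
      fix w w' assume w: "w \<in> closed_walks S (u @ j # i # v)" "w' \<in> closed_walks S (u @ j # i # v)" and eq: "f w = f w'"
      obtain a t s b where 1: "w = a @ (t, j) # (s, i) # b" "length a = n" using dec[OF w(1)] by blast
      obtain a' t' s' b' where 2: "w' = a' @ (t', j) # (s', i) # b'" "length a' = n" using dec[OF w(2)] by blast
      have "a = a'" "s = s'" "transp s i t = transp s' i t'" "b = b'"
        using eq 1(2) 2(2) unfolding 1(1) 2(1) fw[OF 1(2)] fw[OF 2(2)] by auto
      moreover from this have "t = t'" by (metis transpose_involutory)
      ultimately show "w = w'" unfolding 1(1) 2(1) by simp
    qed
    show "f ` closed_walks S (u @ j # i # v) \<subseteq> closed_walks S (u @ i # j # v)"
    proof (rule image_subsetI)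
      fix w assume w: "w \<in> closed_walks S (u @ j # i # v)"
      obtain a t s b where d: "w = a @ (t, j) # (s, i) # b" "length a = n" "map snd a = u" "map snd b = v"
        using dec[OF w] by blast
      define t' where "t' = transp s i t"
      from w have st: "steps_in S w" and pr: "wprod w = id" and li: "linked S w" by (auto simp: closed_walks_def)
      have S: "s \<in> S" "i \<in> S" "s < i" "t \<in> S" "j \<in> S" "t < j" "steps_in S a" "steps_in S b"
        using st unfolding d(1) steps_in_append steps_in_Cons by blast+
      have "t' \<in> S" unfolding t'_def using transpose_in_iff[of s S i t] S by simp
      moreover have "t' < j" unfolding t'_def using S assms(2) by (auto simp: Transposition.transpose_def)
      ultimately have st': "steps_in S (f w)"
        unfolding d(1) fw[OF d(2)] steps_in_append steps_in_Cons t'_def[symmetric] using S by blast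
      have "transp t j \<circ> transp s i = transp s i \<circ> transp t' j"
        unfolding t'_def using S assms(2) by (intro transpose_conj) auto
      hence "wprod (f w) = wprod w"
        unfolding d(1) fw[OF d(2)] t'_def[symmetric] wprod_append wprod.simps by (metis comp_assoc)
      hence pr': "wprod (f w) = id" using pr by simp
      have "closed_under w B" if "closed_under (f w) B" for B
      proof -
        have cl: "closed_under a B" "s \<in> B \<longleftrightarrow> i \<in> B" "t' \<in> B \<longleftrightarrow> j \<in> B" "closed_under b B"
          using that unfolding d(1) fw[OF d(2)] closed_under_append closed_under_Cons t'_def[symmetric] by blast+
        moreover have "t' \<in> B \<longleftrightarrow> t \<in> B" unfolding t'_def using cl(2) by (rule transpose_in_iff)
        ultimately show ?thesis unfolding d(1) closed_under_append closed_under_Cons by blast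
      qed
      hence li': "linked S (f w)" using li unfolding linked_def by blast
      have "map snd (f w) = u @ i # j # v" unfolding d(1) fw[OF d(2)] using d(3,4) by simp
      thus "f w \<in> closed_walks S (u @ i # j # v)"
        using st' pr' li' by (simp add: closed_walks_def)
    qed
    show "finite (closed_walks S (u @ i # j # v))" using assms(1) by (rule finite_closed_walks)
  qed
qed

lemma card_closed_walks_insort:
  assumes "finite S"
  shows "card (closed_walks S (u @ x # ys)) \<le> card (closed_walks S (u @ insort x ys))"
proof (induction ys arbitrary: u)
  case (Cons y ys)
  show ?case
  proof (cases "x \<le> y")
    case False
    hence "card (closed_walks S (u @ x # y # ys)) \<le> card (closed_walks S (u @ y # x # ys))"
      using assms by (intro card_closed_walks_swap) auto
    also have "\<dots> \<le> card (closed_walks S (u @ y # insort x ys))"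
      using Cons.IH[of "u @ [y]"] by simp
    finally show ?thesis using False by simp
  qed simp
qed simp

lemma card_closed_walks_sort:
  assumes "finite S"
  shows "card (closed_walks S (u @ c)) \<le> card (closed_walks S (u @ sort c))"
proof (induction c arbitrary: u)
  case (Cons x c)
  have "card (closed_walks S (u @ x # c)) \<le> card (closed_walks S (u @ x # sort c))"
    using Cons.IH[of "u @ [x]"] by simp
  also have "\<dots> \<le> card (closed_walks S (u @ insort x (sort c)))"
    by (rule card_closed_walks_insort[OF assms])
  finally show ?case by simp
qed simp

lemma wprod_outside:
  assumes "steps_in S w" "x \<notin> S"
  shows "wprod w x = x"
  using assms(1)
proof (induction w rule: wprod.induct)
  case (2 s t w)
  hence st: "s \<in> S" "t \<in> S" "steps_in S w" by (simp_all add: steps_in_Cons)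
  hence "wprod w x = x" using 2 by simp
  moreover have "x \<noteq> s" "x \<noteq> t" using st assms(2) by auto
  ultimately show ?case by simp
qed simp

lemma wprod_eq_id_iff: "steps_in S w \<Longrightarrow> wprod w = id \<longleftrightarrow> (\<forall>x\<in>S. wprod w x = id x)"
  using wprod_outside by fastforce

definition sorted_colours :: "nat set \<Rightarrow> nat \<Rightarrow> nat list set" where
  "sorted_colours S r = {c. set c \<subseteq> S \<and> length c = r \<and> sorted c}"

lemma finite_sorted_colours: "finite S \<Longrightarrow> finite (sorted_colours S r)"
  by (rule finite_subset[OF _ finite_lists_length_eq[of S r]]) (auto simp: sorted_colours_def)

lemma card_monotone_closed:
  assumes "finite S"
  shows "card (monotone_walks S r id) = (\<Sum>c\<in>sorted_colours S r. card (closed_walks S c))"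
proof -
  have "monotone_walks S r id = (\<Union>c\<in>sorted_colours S r. closed_walks S c)"
  proof (intro equalityI subsetI)
    fix w assume w: "w \<in> monotone_walks S r id"
    hence st: "steps_in S w" by (simp add: monotone_walks_def)
    have "snd e \<in> S" if "e \<in> set w" for e using st that by (simp add: steps_in_def split_beta)
    hence "map snd w \<in> sorted_colours S r" using w by (auto simp: sorted_colours_def monotone_walks_def)
    moreover have "w \<in> closed_walks S (map snd w)"
      using w wprod_eq_id_iff[OF st] by (simp add: closed_walks_def monotone_walks_def)
    ultimately show "w \<in> (\<Union>c\<in>sorted_colours S r. closed_walks S c)" by blast
  next
    fix w assume "w \<in> (\<Union>c\<in>sorted_colours S r. closed_walks S c)"
    then obtain c where c: "c \<in> sorted_colours S r" "w \<in> closed_walks S c" by blast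
    hence "length w = length c" unfolding closed_walks_def by (metis (mono_tags, lifting) length_map mem_Collect_eq)
    thus "w \<in> monotone_walks S r id" using c by (simp add: closed_walks_def sorted_colours_def monotone_walks_def)
  qed
  also have "card \<dots> = (\<Sum>c\<in>sorted_colours S r. card (closed_walks S c))"
  proof (rule card_UN_disjoint)
    show "finite (sorted_colours S r)" "\<forall>c\<in>sorted_colours S r. finite (closed_walks S c)"
      using assms by (simp_all add: finite_sorted_colours finite_closed_walks)
  qed (auto simp: closed_walks_def)
  finally show ?thesis .
qed

definition sandwiches :: "nat set \<Rightarrow> nat \<Rightarrow> ((nat \<times> nat) list \<times> (nat \<times> nat) list \<times> (nat \<times> nat) list) set" where
  "sandwiches S r = {(x, w, y). length (x @ w @ y) = r \<and> steps_in S (x @ w @ y) \<and> wprod (x @ w @ y) = id \<and>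
     linked S (x @ w @ y) \<and> sorted_wrt (<) (map snd x) \<and> sorted (map snd w) \<and> sorted_wrt (<) (rev (map snd y))}"

definition colour_triples :: "nat set \<Rightarrow> nat \<Rightarrow> (nat list \<times> nat list \<times> nat list) set" where
  "colour_triples S r = {(x, w, y). length (x @ w @ y) = r \<and> set (x @ w @ y) \<subseteq> S \<and>
     sorted_wrt (<) x \<and> sorted w \<and> sorted_wrt (<) (rev y)}"

lemma finite_colour_triples:
  assumes "finite S"
  shows "finite (colour_triples S r)"
proof -
  define L where "L = {c. set c \<subseteq> S \<and> length c \<le> r}"
  have "finite L" unfolding L_def by (rule finite_lists_length_le[OF assms])
  moreover have "colour_triples S r \<subseteq> L \<times> L \<times> L" by (auto simp: colour_triples_def L_def)
  ultimately show ?thesis by (meson finite_SigmaI finite_subset)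
qed

lemma card_sandwiches_le:
  assumes "finite S"
  shows "card (sandwiches S r) \<le> 4 ^ card S * card (monotone_walks S r id)"
proof -
  define \<Phi> where "\<Phi> = (\<lambda>(x :: (nat \<times> nat) list, w :: (nat \<times> nat) list, y :: (nat \<times> nat) list). (map snd x, map snd w, map snd y))"
  define N where "N c = card (closed_walks S c)" for c
  define fib where "fib t = {z \<in> sandwiches S r. \<Phi> z = t}" for t
  have fibbound: "card (fib t) \<le> N (sort (fst t @ fst (snd t) @ snd (snd t))) \<and> finite (fib t)" for t
  proof -
    obtain a b c where t: "t = (a, b, c)" by (cases t)
    define h where "h = (\<lambda>(x, w, y). x @ w @ y :: (nat \<times> nat) list)"
    have inj: "inj_on h (fib t)"
    proof (rule inj_onI)
      fix z z' assume z: "z \<in> fib t" "z' \<in> fib t" "h z = h z'"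
      obtain x w y where z1: "z = (x, w, y)" by (cases z)
      obtain x' w' y' where z2: "z' = (x', w', y')" by (cases z')
      have "map snd x = a" "map snd w = b" "map snd x' = a" "map snd w' = b"
        using z(1,2) by (simp_all add: fib_def \<Phi>_def z1 z2 t)
      hence "length x = length x'" "length w = length w'" by (metis length_map)+
      thus "z = z'" using z(3) by (simp add: z1 z2 h_def)
    qed
    have sub: "h ` fib t \<subseteq> closed_walks S (a @ b @ c)"
      by (rule image_subsetI) (auto simp: fib_def sandwiches_def closed_walks_def \<Phi>_def h_def t)
    have fin: "finite (closed_walks S (a @ b @ c))" using assms by (rule finite_closed_walks)
    have "card (fib t) \<le> card (closed_walks S (a @ b @ c))" by (rule card_inj_on_le[OF inj sub fin])
    also have "\<dots> \<le> N (sort (a @ b @ c))"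
      unfolding N_def using card_closed_walks_sort[OF assms, of "[]" "a @ b @ c"] by simp
    finally show ?thesis using inj_on_finite[OF inj sub fin] by (simp add: t)
  qed
  have "\<Phi> z \<in> colour_triples S r" if "z \<in> sandwiches S r" for z
  proof -
    obtain x w y where z: "z = (x, w, y)" by (cases z)
    have st: "steps_in S (x @ w @ y)" using that by (simp add: z sandwiches_def)
    have "snd e \<in> S" if "e \<in> set (x @ w @ y)" for e
      using st that unfolding steps_in_def split_beta by blast
    hence "set (map snd x @ map snd w @ map snd y) \<subseteq> S" by auto
    thus ?thesis using that by (simp add: z sandwiches_def colour_triples_def \<Phi>_def)
  qed
  hence "sandwiches S r = (\<Union>t\<in>colour_triples S r. fib t)" by (auto simp: fib_def)
  hence "card (sandwiches S r) \<le> (\<Sum>t\<in>colour_triples S r. card (fib t))"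
    using finite_colour_triples[OF assms] by (simp add: card_UN_le)
  also have "\<dots> \<le> (\<Sum>t\<in>colour_triples S r. N (sort (fst t @ fst (snd t) @ snd (snd t))))"
    using fibbound by (intro sum_mono) simp
  also have "\<dots> \<le> (\<Sum>u\<in>Pow S \<times> Pow S \<times> sorted_colours S r. N (snd (snd u)))"
  proof -
    define \<Psi> where "\<Psi> = (\<lambda>(x, w, y). (set x, set y, sort (x @ w @ y)) :: nat set \<times> nat set \<times> nat list)"
    have inj: "inj_on \<Psi> (colour_triples S r)"
    proof (rule inj_onI)
      fix t t' assume t: "t \<in> colour_triples S r" "t' \<in> colour_triples S r" "\<Psi> t = \<Psi> t'"
      obtain x w y where t1: "t = (x, w, y)" by (cases t)
      obtain x' w' y' where t2: "t' = (x', w', y')" by (cases t')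
      have s: "sorted_wrt (<) x" "sorted_wrt (<) x'" "sorted_wrt (<) (rev y)" "sorted_wrt (<) (rev y')" "sorted w" "sorted w'"
        using t(1,2) by (simp_all add: t1 t2 colour_triples_def)
      have eq: "set x = set x'" "set y = set y'" "sort (x @ w @ y) = sort (x' @ w' @ y')"
        using t(3) by (simp_all add: \<Psi>_def t1 t2)
      have x: "x = x'" using s(1,2) eq(1) by (metis strict_sorted_equal)
      have "rev y = rev y'" using s(3,4) eq(2) by (metis strict_sorted_equal set_rev)
      hence y: "y = y'" by simp
      have "mset (x @ w @ y) = mset (x' @ w' @ y')" using arg_cong[OF eq(3), of mset] by simp
      hence "mset w = mset w'" by (simp add: x y)
      hence "w = w'" using s(5,6) by (metis properties_for_sort)
      thus "t = t'" by (simp add: t1 t2 x y)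
    qed
    have "(\<Sum>t\<in>colour_triples S r. N (sort (fst t @ fst (snd t) @ snd (snd t))))
       = (\<Sum>t\<in>colour_triples S r. N (snd (snd (\<Psi> t))))"
      by (intro sum.cong refl) (simp add: \<Psi>_def split_beta)
    also have "\<dots> = (\<Sum>u\<in>\<Psi> ` colour_triples S r. N (snd (snd u)))"
      by (simp add: sum.reindex[OF inj])
    also have "\<dots> \<le> (\<Sum>u\<in>Pow S \<times> Pow S \<times> sorted_colours S r. N (snd (snd u)))"
    proof (rule sum_mono2)
      show "finite (Pow S \<times> Pow S \<times> sorted_colours S r)" using assms by (simp add: finite_sorted_colours)
      show "\<Psi> ` colour_triples S r \<subseteq> Pow S \<times> Pow S \<times> sorted_colours S r"
        by (rule image_subsetI) (auto simp: \<Psi>_def colour_triples_def sorted_colours_def)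
    qed simp
    finally show ?thesis .
  qed
  also have "\<dots> = card (Pow S) * (card (Pow S) * (\<Sum>c\<in>sorted_colours S r. N c))"
  proof -
    have "(\<Sum>u\<in>Pow S \<times> Pow S \<times> sorted_colours S r. N (snd (snd u)))
      = (\<Sum>(X, Y, c)\<in>Pow S \<times> Pow S \<times> sorted_colours S r. N c)" by (simp add: split_beta)
    also have "\<dots> = (\<Sum>X\<in>Pow S. \<Sum>Y\<in>Pow S. \<Sum>c\<in>sorted_colours S r. N c)"
      by (simp only: sum.cartesian_product)
    finally show ?thesis by simp
  qed
  also have "\<dots> = 4 ^ card S * card (monotone_walks S r id)"
    unfolding card_monotone_closed[OF assms] N_def card_Pow[OF assms]
    by (simp add: power_mult_distrib[symmetric] mult.assoc[symmetric])
  finally show ?thesis .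
qed

section \<open>Monotone double Hurwitz numbers\<close>

lemma permutes_stable: "finite S \<Longrightarrow> p permutes S \<Longrightarrow> stable_perm S p"
  by (auto simp: stable_perm_def permutation_permutes permutes_in_image)

lemma stable_perm_id: "finite S \<Longrightarrow> stable_perm S id"
  by (intro permutes_stable permutes_id)

lemma orbit_id: "orbit id x = {x}"
  by (simp add: orbit_eq_singleton_iff)

lemma cycles_id: "cycles S id = (\<lambda>x. {x}) ` S"
  by (simp add: cycles_def orbit_id)

lemma card_cycles_id: "card (cycles S id) = card S"
  unfolding cycles_id by (intro card_image) (auto simp: inj_on_def)

lemma steps_in_mono: "steps_in S w \<Longrightarrow> S \<subseteq> T \<Longrightarrow> steps_in T w"
  by (auto simp: steps_in_def)

lemma cycles_insert_fixed:
  assumes "p m = m"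
  shows "cycles (insert m S) p = insert {m} (cycles S p)"
  using assms by (simp add: cycles_def orbit_eq_singleton_iff[THEN iffD2])

lemma strict_factorization:
  assumes "p permutes {1..d}"
  shows "\<exists>w. steps_in {1..d} w \<and> sorted_wrt (<) (map snd w) \<and> wprod w = p \<and> length w + card (cycles {1..d} p) = d"
  using assms
proof (induction d arbitrary: p)
  case 0
  hence "p = id" by simp
  thus ?case by (intro exI[of _ "[]"]) (simp add: steps_in_Nil cycles_def)
next
  case (Suc d)
  define m where "m = Suc d"
  have ins: "{1..Suc d} = insert m {1..d}" by (auto simp: m_def)
  have fixed: "\<exists>w. steps_in {1..d} w \<and> sorted_wrt (<) (map snd w) \<and> wprod w = q \<and> length w + card (cycles {1..Suc d} q) = Suc d"
    if q: "q permutes {1..Suc d}" "q m = m" for q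
  proof -
    have qd: "q permutes {1..d}" using q(1)
    proof (rule permutes_superset)
      fix x assume "x \<in> {1..Suc d} - {1..d}"
      hence "x = m" by (auto simp: m_def)
      thus "q x = x" using q(2) by simp
    qed
    from Suc.IH[OF this] obtain w where w: "steps_in {1..d} w" "sorted_wrt (<) (map snd w)" "wprod w = q"
      "length w + card (cycles {1..d} q) = d" by blast
    have sp: "stable_perm {1..d} q" using qd by (intro permutes_stable) auto
    have "m \<notin> {1..d}" by (simp add: m_def)
    hence "{m} \<notin> cycles {1..d} q" using Union_cycles[OF sp] by blast
    hence "card (cycles {1..Suc d} q) = Suc (card (cycles {1..d} q))"
      unfolding ins cycles_insert_fixed[of q m, OF q(2)] using finite_cycles[OF sp] by simp
    thus ?thesis using w by auto
  qed
  show ?case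
  proof (cases "p m = m")
    case True
    from fixed[OF Suc.prems this] obtain w where w: "steps_in {1..d} w" "sorted_wrt (<) (map snd w)" "wprod w = p"
      "length w + card (cycles {1..Suc d} p) = Suc d" by blast
    moreover have "steps_in {1..Suc d} w" using w(1) by (rule steps_in_mono) auto
    ultimately show ?thesis by blast
  next
    case False
    define s where "s = inv_into UNIV p m"
    have ps: "p s = m" unfolding s_def by (rule permutes_inverses(1)[OF Suc.prems])
    have mS: "m \<in> {1..Suc d}" by (simp add: m_def)
    have sS: "s \<in> {1..Suc d}" using permutes_in_image[OF Suc.prems, of s] ps mS by simp
    have sm: "s \<noteq> m" using False ps by auto
    hence sd: "s \<in> {1..d}" using sS by (auto simp: m_def)
    define q where "q = p \<circ> transp s m"
    have qm: "q m = m" by (simp add: q_def ps)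
    have "transp s m permutes {1..Suc d}" by (rule permutes_swap_id[OF sS mS])
    hence qp: "q permutes {1..Suc d}" unfolding q_def using Suc.prems by (rule permutes_compose)
    from fixed[OF qp qm] obtain w where w: "steps_in {1..d} w" "sorted_wrt (<) (map snd w)" "wprod w = q"
      "length w + card (cycles {1..Suc d} q) = Suc d" by blast
    have sp: "stable_perm {1..Suc d} p" using Suc.prems by (intro permutes_stable) auto
    have "m \<in> orbit p s" unfolding ps[symmetric] by (rule orbit.base)
    hence "orbit p m = orbit p s" by (rule stable_perm_orbit_eq[OF sp])
    hence "s \<in> orbit p m" using stable_perm_self[OF sp, of s] by simp
    hence "complexity {1..Suc d} q = Suc (complexity {1..Suc d} p)"
      using complexity_step[OF sp mS sS sm] unfolding q_def by blast
    hence c: "card (cycles {1..Suc d} q) = Suc (card (cycles {1..Suc d} p))" by (simp add: complexity_def)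
    have "snd e < m" if "e \<in> set w" for e
      using w(1) that unfolding steps_in_def split_beta m_def by (simp add: less_Suc_eq_le)
    hence "sorted_wrt (<) (map snd (w @ [(s, m)]))"
      using w(2) by (simp add: sorted_wrt_append)
    moreover have "wprod (w @ [(s, m)]) = p" by (simp add: wprod_append w(3) q_def comp_assoc)
    moreover have "steps_in {1..Suc d} (w @ [(s, m)])"
      unfolding steps_in_snoc using steps_in_mono[OF w(1), of "{1..Suc d}"] sS mS sd by (auto simp: m_def)
    moreover have "length (w @ [(s, m)]) + card (cycles {1..Suc d} p) = Suc d" using w(4) c by simp
    ultimately show ?thesis by blast
  qed
qed

lemma wprod_rev: "wprod w \<circ> wprod (rev w) = id"
proof (induction w rule: wprod.induct)
  case (2 s t w)
  have "wprod ((s, t) # w) \<circ> wprod (rev ((s, t) # w))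
     = transp s t \<circ> (wprod w \<circ> wprod (rev w)) \<circ> transp s t"
    by (simp add: wprod_append comp_assoc)
  also have "\<dots> = id" unfolding 2 by (rule ext) simp
  finally show ?case .
qed simp

lemma walk_end_eq: "walk_end p w = p \<circ> wprod w"
  unfolding walk_end_def by (induction w arbitrary: p rule: wprod.induct) (simp_all add: comp_assoc)

lemma is_walk_iff: "is_walk d w \<longleftrightarrow> steps_in {1..d} w"
  unfolding is_walk_def steps_in_def split_beta by auto

lemma size_cycle_type: "size (cycle_type d p) = card (cycles {1..d} p)"
  by (simp add: cycle_type_def cycles_def)

lemma wprod_permutes: "steps_in S w \<Longrightarrow> wprod w permutes S"
proof (induction w rule: wprod.induct)
  case (2 s t w)
  hence "wprod w permutes S" "transp s t permutes S"
    by (simp_all add: steps_in_Cons permutes_swap_id)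
  thus ?case unfolding wprod.simps by (rule permutes_compose)
qed (simp add: permutes_id)

lemma generate_sym_group:
  assumes "X \<subseteq> {p. p permutes {1..d}}" "p \<in> generate (sym_group d) X"
  shows "p permutes {1..d}"
proof -
  interpret group "sym_group d" by (rule sym_group_is_group)
  have "X \<subseteq> carrier (sym_group d)" using assms(1) by (auto simp: sym_group_carrier)
  from generate_incl[OF this] assms(2) show ?thesis by (auto simp: sym_group_carrier)
qed

lemma generate_preserves:
  assumes "p \<in> generate (sym_group d) X" "X \<subseteq> {p. p permutes {1..d}}"
    and "\<And>q x. q \<in> X \<Longrightarrow> q x \<in> A \<longleftrightarrow> x \<in> A"
  shows "p x \<in> A \<longleftrightarrow> x \<in> A"
  using assms(1)
proof (induction p arbitrary: x rule: generate.induct)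
  case one
  show ?case by (simp add: sym_group_one)
next
  case (incl h)
  thus ?case using assms(3) by simp
next
  case (inv h)
  hence h: "h permutes {1..d}" using assms(2) by auto
  hence "inv\<^bsub>sym_group d\<^esub> h = inv_into UNIV h" by (simp add: sym_group_carrier)
  thus ?case using assms(3)[OF inv, of "inv_into UNIV h x"] permutes_inverses(1)[OF h] by simp
next
  case (eng h1 h2)
  thus ?case by (simp add: sym_group_mult)
qed

lemma generators_permute:
  assumes "p permutes {1..d}" "steps_in {1..d} w"
  shows "{p, walk_end p w} \<union> (\<lambda>(s,t). transp s t) ` set w \<subseteq> {p. p permutes {1..d}}"
proof -
  have "walk_end p w permutes {1..d}"
    unfolding walk_end_eq by (rule permutes_compose[OF wprod_permutes[OF assms(2)] assms(1)])
  moreover have "transp (fst e) (snd e) permutes {1..d}" if "e \<in> set w" for e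
    using assms(2) that unfolding steps_in_def split_beta by (blast intro: permutes_swap_id)
  ultimately show ?thesis using assms(1) by (auto simp: split_beta)
qed

lemma transitive_imp_linked:
  assumes "transitive_walk d p w" "p permutes {1..d}" "steps_in {1..d} w"
    "wprod x = p" "wprod y = inv_into UNIV (walk_end p w)"
  shows "linked {1..d} (x @ w @ y)"
  unfolding linked_def
proof (intro allI impI)
  fix A assume A: "A \<subseteq> {1..d}" "A \<noteq> {}" "closed_under (x @ w @ y) A"
  then obtain a where a: "a \<in> A" by blast
  let ?X = "{p, walk_end p w} \<union> (\<lambda>(s,t). transp s t) ` set w"
  have cl: "closed_under x A" "closed_under w A" using A(3) by (simp_all add: closed_under_append)
  have px: "p z \<in> A \<longleftrightarrow> z \<in> A" for z using wprod_in_closed[OF cl(1)] assms(4) by simp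
  have gens: "q z \<in> A \<longleftrightarrow> z \<in> A" if "q \<in> ?X" for q z
  proof -
    from that consider "q = p" | "q = walk_end p w" | e where "e \<in> set w" "q = transp (fst e) (snd e)"
      unfolding split_beta by blast
    thus ?thesis
    proof cases
      case 1
      thus ?thesis using px by simp
    next
      case 2
      thus ?thesis using px wprod_in_closed[OF cl(2)] by (simp add: walk_end_eq)
    next
      case 3
      hence "fst e \<in> A \<longleftrightarrow> snd e \<in> A" using cl(2) unfolding closed_under_def split_beta by blast
      thus ?thesis unfolding 3(2) by (rule transpose_in_iff)
    qed
  qed
  have pres: "q z \<in> A \<longleftrightarrow> z \<in> A" if "q \<in> generate (sym_group d) ?X" for q z
    by (rule generate_preserves[OF that generators_permute[OF assms(2,3)]]) (rule gens)
  have "y \<in> A" if "y \<in> {1..d}" for y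
  proof -
    have "a \<in> {1..d}" using a A(1) by blast
    with assms(1)[unfolded transitive_walk_def]
    have "\<forall>y\<in>{1..d}. \<exists>q\<in>generate (sym_group d) ?X. q a = y" by (rule bspec)
    hence "\<exists>q\<in>generate (sym_group d) ?X. q a = y" using that by (rule bspec)
    then obtain q where q: "q \<in> generate (sym_group d) ?X" "q a = y" by (rule bexE)
    show ?thesis using pres[OF q(1), of a] a q(2) by simp
  qed
  thus "A = {1..d}" using A(1) by blast
qed

lemma linked_imp_transitive:
  assumes "linked {1..d} w" "steps_in {1..d} w" "p permutes {1..d}"
  shows "transitive_walk d p w"
  unfolding transitive_walk_def
proof (intro ballI)
  fix x y assume x: "x \<in> {1..d}" and y: "y \<in> {1..d}"
  let ?X = "{p, walk_end p w} \<union> (\<lambda>(s,t). transp s t) ` set w"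
  define A where "A = (\<lambda>q. q x) ` generate (sym_group d) ?X"
  have sub: "A \<subseteq> {1..d}"
  proof
    fix z assume "z \<in> A"
    then obtain q where q: "q \<in> generate (sym_group d) ?X" "z = q x" unfolding A_def by blast
    show "z \<in> {1..d}" using permutes_in_image[OF generate_sym_group[OF generators_permute[OF assms(3,2)] q(1)]] x q(2) by simp
  qed
  have "id \<in> generate (sym_group d) ?X" using generate.one[of "sym_group d" ?X] by (simp add: sym_group_one)
  from imageI[OF this, of "\<lambda>q. q x"] have xA: "x \<in> A" by (simp add: A_def)
  have tr: "transp s t z \<in> A" if st: "(s, t) \<in> set w" and z: "z \<in> A" for s t z
  proof -
    obtain q where q: "q \<in> generate (sym_group d) ?X" "z = q x" using z unfolding A_def by blast
    have "transp s t \<in> ?X" using st by force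
    hence "transp s t \<circ> q \<in> generate (sym_group d) ?X"
      using generate.eng[OF generate.incl q(1)] by (simp add: sym_group_mult)
    from imageI[OF this, of "\<lambda>q. q x"] show ?thesis by (simp add: A_def q(2))
  qed
  have "closed_under w A"
    unfolding closed_under_def
  proof (rule ballI, clarify)
    fix s t assume st: "(s, t) \<in> set w"
    show "s \<in> A \<longleftrightarrow> t \<in> A" using tr[OF st, of s] tr[OF st, of t] by auto
  qed
  hence "A = {1..d}" using linkedD[OF assms(1) sub xA] by blast
  hence "y \<in> A" using y by simp
  thus "\<exists>q\<in>generate (sym_group d) ?X. q x = y" unfolding A_def by blast
qed

definition hurwitz_walks :: "nat \<Rightarrow> nat \<Rightarrow> ((nat \<Rightarrow> nat) \<times> (nat \<times> nat) list) set" where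
  "hurwitz_walks g d = {(p, w). p permutes {1..d} \<and>
     int (length w) = 2 * int g - 2 + int (card (cycles {1..d} p)) + int (card (cycles {1..d} (walk_end p w))) \<and>
     steps_in {1..d} w \<and> sorted (map snd w) \<and> transitive_walk d p w}"

lemma finite_hurwitz_walks: "finite (hurwitz_walks g d)"
proof (rule finite_subset)
  define P where "P = {p. p permutes {1..d}}"
  define L where "L = {w. set w \<subseteq> {1..d} \<times> {1..d} \<and> length w \<le> 2 * g + 2 * d}"
  show "finite (P \<times> L)"
    unfolding P_def L_def by (intro finite_cartesian_product finite_permutations finite_lists_length_le) auto
  show "hurwitz_walks g d \<subseteq> P \<times> L"
  proof
    fix z assume z: "z \<in> hurwitz_walks g d"
    obtain p w where pw: "z = (p, w)" by (cases z)
    have "card (cycles {1..d} q) \<le> d" for q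
      unfolding cycles_def using card_image_le[of "{1..d}" "orbit q"] by simp
    from this[of p] this[of "walk_end p w"] have "length w \<le> 2 * g + 2 * d"
      using z by (simp add: hurwitz_walks_def pw)
    moreover have "set w \<subseteq> {1..d} \<times> {1..d}" using z by (auto simp: hurwitz_walks_def pw steps_in_def)
    ultimately show "z \<in> P \<times> L" using z by (simp add: hurwitz_walks_def pw P_def L_def)
  qed
qed

lemma card_hurwitz_walks_le:
  assumes "d \<ge> 1"
  shows "card (hurwitz_walks g d) \<le> 4 ^ d * genus_count g {1..d} id"
proof -
  define S where "S = {1..d}"
  define r where "r = 2 * g + 2 * d - 2"
  have fin: "finite S" by (simp add: S_def)
  from strict_factorization have "\<forall>p. \<exists>w. p permutes {1..d} \<longrightarrow> steps_in {1..d} w \<and> sorted_wrt (<) (map snd w) \<and>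
     wprod w = p \<and> length w + card (cycles {1..d} p) = d" by blast
  then obtain f where f: "\<And>p. p permutes S \<Longrightarrow> steps_in S (f p)" "\<And>p. p permutes S \<Longrightarrow> sorted_wrt (<) (map snd (f p))"
    "\<And>p. p permutes S \<Longrightarrow> wprod (f p) = p" "\<And>p. p permutes S \<Longrightarrow> length (f p) + card (cycles S p) = d"
    unfolding S_def by metis
  define F where "F = (\<lambda>(p, w). (f p, w, rev (f (walk_end p w))))"
  have inj: "inj_on F (hurwitz_walks g d)"
  proof (rule inj_onI)
    fix z z' assume z: "z \<in> hurwitz_walks g d" "z' \<in> hurwitz_walks g d" "F z = F z'"
    obtain p w where z1: "z = (p, w)" by (cases z)
    obtain p' w' where z2: "z' = (p', w')" by (cases z')
    have "p permutes S" "p' permutes S" using z(1,2) by (simp_all add: hurwitz_walks_def z1 z2 S_def)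
    hence "p = wprod (f p)" "p' = wprod (f p')" by (simp_all add: f(3))
    moreover have "f p = f p'" "w = w'" using z(3) by (simp_all add: F_def z1 z2)
    ultimately show "z = z'" by (simp add: z1 z2)
  qed
  have sub: "F ` hurwitz_walks g d \<subseteq> sandwiches S r"
  proof (rule image_subsetI)
    fix z assume z: "z \<in> hurwitz_walks g d"
    obtain p w where z1: "z = (p, w)" by (cases z)
    define q where "q = walk_end p w"
    from z have p: "p permutes S" and st: "steps_in S w" and so: "sorted (map snd w)" and tr: "transitive_walk d p w"
      and len: "int (length w) = 2 * int g - 2 + int (card (cycles S p)) + int (card (cycles S q))"
      by (simp_all add: hurwitz_walks_def z1 S_def q_def)
    have q: "q permutes S" unfolding q_def walk_end_eq by (rule permutes_compose[OF wprod_permutes[OF st] p])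
    have pr: "q \<circ> wprod (rev (f q)) = id" using wprod_rev[of "f q"] f(3)[OF q] by simp
    hence inv: "wprod (rev (f q)) = inv_into UNIV q" using permutes_inv_o[OF q] by (metis comp_assoc id_comp comp_id)
    have "wprod (f p @ w @ rev (f q)) = id"
      unfolding wprod_append f(3)[OF p] using pr by (simp add: q_def walk_end_eq comp_assoc)
    moreover have "linked S (f p @ w @ rev (f q))"
      using transitive_imp_linked[OF tr p[unfolded S_def] st[unfolded S_def] f(3)[OF p] inv[unfolded q_def]] by (simp add: S_def q_def)
    moreover have "steps_in S (rev (f q))" using f(1)[OF q] by (simp add: steps_in_def)
    hence "steps_in S (f p @ w @ rev (f q))" using f(1)[OF p] st by (simp add: steps_in_append)
    moreover have "length (f p @ w @ rev (f q)) = r"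
      using f(4)[OF p] f(4)[OF q] len by (simp add: r_def)
    ultimately have "(f p, w, rev (f q)) \<in> sandwiches S r"
      using f(2)[OF p] f(2)[OF q] so by (simp add: sandwiches_def rev_map)
    thus "F z \<in> sandwiches S r" by (simp add: F_def z1 q_def)
  qed
  have "finite (sandwiches S r)"
  proof (rule finite_subset)
    define L where "L = {w. set w \<subseteq> S \<times> S \<and> length w \<le> r}"
    show "finite (L \<times> L \<times> L)"
      unfolding L_def using fin by (intro finite_cartesian_product finite_lists_length_le) auto
    show "sandwiches S r \<subseteq> L \<times> L \<times> L"
      by (auto simp: sandwiches_def L_def steps_in_def)
  qed
  hence "card (hurwitz_walks g d) \<le> card (sandwiches S r)" by (rule card_inj_on_le[OF inj sub])
  also have "\<dots> \<le> 4 ^ card S * card (monotone_walks S r id)" by (rule card_sandwiches_le[OF fin])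
  also have "card (monotone_walks S r id) = genus_count g S id"
    using assms by (intro genus_count_eq[symmetric]) (simp add: r_def complexity_def card_cycles_id S_def)
  finally show ?thesis by (simp add: S_def)
qed

lemma monotone_hurwitz_eq:
  assumes "sum_mset \<alpha> = d"
  shows "monotone_hurwitz g \<alpha> \<beta> = card {(p, w) \<in> hurwitz_walks g d. cycle_type d p = \<alpha> \<and> cycle_type d (walk_end p w) = \<beta>}"
proof -
  have "{(\<rho>, w). \<rho> permutes {1..d} \<and> cycle_type d \<rho> = \<alpha> \<and>
        int (length w) = 2 * int g - 2 + int (size \<alpha>) + int (size \<beta>) \<and>
        is_walk d w \<and> monotone_walk w \<and> transitive_walk d \<rho> w \<and> cycle_type d (walk_end \<rho> w) = \<beta>}
     = {(p, w) \<in> hurwitz_walks g d. cycle_type d p = \<alpha> \<and> cycle_type d (walk_end p w) = \<beta>}"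
    unfolding hurwitz_walks_def is_walk_iff monotone_walk_def by (auto simp: size_cycle_type)
  thus ?thesis unfolding monotone_hurwitz_def assms Let_def by simp
qed

lemma finite_partitions_of: "finite (partitions_of d)"
proof (rule finite_subset)
  show "finite (\<Union>n\<in>{..d}. {\<alpha>. set_mset \<alpha> \<subseteq> {1..d} \<and> size \<alpha> = n})"
    using finite_multisets_of_size[of "{1..d}"] unfolding multisets_of_size_def by blast
  show "partitions_of d \<subseteq> (\<Union>n\<in>{..d}. {\<alpha>. set_mset \<alpha> \<subseteq> {1..d} \<and> size \<alpha> = n})"
  proof
    fix \<alpha> assume "\<alpha> \<in> partitions_of d"
    hence pos: "\<forall>k\<in>#\<alpha>. 0 < k" and s: "sum_mset \<alpha> = d" by (simp_all add: partitions_of_def)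
    have "size \<alpha> \<le> sum_mset \<alpha>" using pos by (induction \<alpha>) auto
    moreover have "k \<le> d" if "k \<in># \<alpha>" for k using that s by (metis sum_mset.remove le_add1)
    ultimately show "\<alpha> \<in> (\<Union>n\<in>{..d}. {\<alpha>. set_mset \<alpha> \<subseteq> {1..d} \<and> size \<alpha> = n})"
      using pos s by (auto simp: Suc_le_eq)
  qed
qed

definition hurwitz_total :: "nat \<Rightarrow> nat \<Rightarrow> nat" where
  "hurwitz_total g d = (\<Sum>\<alpha>\<in>partitions_of d. \<Sum>\<beta>\<in>partitions_of d. monotone_hurwitz g \<alpha> \<beta>)"

lemma hurwitz_total_le:
  assumes "d \<ge> 1"
  shows "hurwitz_total g d \<le> 4 ^ d * genus_count g {1..d} id"
proof -
  define fib where "fib = (\<lambda>(\<alpha>, \<beta>). {(p, w) \<in> hurwitz_walks g d. cycle_type d p = \<alpha> \<and> cycle_type d (walk_end p w) = \<beta>})"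
  have "hurwitz_total g d = (\<Sum>\<alpha>\<in>partitions_of d. \<Sum>\<beta>\<in>partitions_of d. card (fib (\<alpha>, \<beta>)))"
    unfolding hurwitz_total_def fib_def by (intro sum.cong refl) (simp add: monotone_hurwitz_eq partitions_of_def)
  also have "\<dots> = (\<Sum>u\<in>partitions_of d \<times> partitions_of d. card (fib u))"
    by (simp add: sum.cartesian_product)
  also have "\<dots> = card (\<Union>u\<in>partitions_of d \<times> partitions_of d. fib u)"
  proof (rule card_UN_disjoint[symmetric])
    show "finite (partitions_of d \<times> partitions_of d)" by (simp add: finite_partitions_of)
    show "\<forall>u\<in>partitions_of d \<times> partitions_of d. finite (fib u)"
    proof
      fix u
      have "fib u \<subseteq> hurwitz_walks g d" unfolding fib_def by (cases u) auto
      thus "finite (fib u)" using finite_hurwitz_walks finite_subset by blast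
    qed
  qed (auto simp: fib_def)
  also have "\<dots> \<le> card (hurwitz_walks g d)"
    by (intro card_mono finite_hurwitz_walks) (auto simp: fib_def)
  also have "\<dots> \<le> 4 ^ d * genus_count g {1..d} id" by (rule card_hurwitz_walks_le[OF assms])
  finally show ?thesis .
qed

lemma cycle_type_id_in: "cycle_type d id \<in> partitions_of d"
proof -
  have "cycle_type d id = image_mset card (mset_set (cycles {1..d} id))"
    by (simp add: cycle_type_def cycles_def)
  moreover have "sum card (cycles {1..d} id) = d"
    using sum_card_cycles[OF stable_perm_id[of "{1..d}"]] by simp
  moreover have "finite (cycles {1..d} id)" by (simp add: cycles_def)
  ultimately show ?thesis
    by (auto simp: partitions_of_def sum_unfold_sum_mset[symmetric] cycles_id)
qed

lemma hurwitz_total_ge: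
  assumes "d \<ge> 1"
  shows "genus_count g {1..d} id \<le> hurwitz_total g d"
proof -
  define \<alpha> where "\<alpha> = cycle_type d id"
  define r where "r = 2 * g + 2 * d - 2"
  have \<alpha>: "\<alpha> \<in> partitions_of d" unfolding \<alpha>_def by (rule cycle_type_id_in)
  have "genus_count g {1..d} id = card (monotone_walks {1..d} r id)"
    using assms by (intro genus_count_eq) (simp add: r_def complexity_def card_cycles_id)
  also have "\<dots> \<le> monotone_hurwitz g \<alpha> \<alpha>"
  proof -
    have s: "sum_mset \<alpha> = d" using \<alpha> by (simp add: partitions_of_def)
    have "w \<in> monotone_walks {1..d} r id \<Longrightarrow> (id, w) \<in> hurwitz_walks g d \<and> walk_end id w = id" for w
    proof -
      assume w: "w \<in> monotone_walks {1..d} r id"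
      hence st: "steps_in {1..d} w" and li: "linked {1..d} w" by (simp_all add: monotone_walks_def)
      have e: "walk_end id w = id"
        unfolding walk_end_eq using w wprod_eq_id_iff[OF st] by (simp add: monotone_walks_def)
      have "int (length w) = 2 * int g - 2 + int d + int d" using w assms by (simp add: monotone_walks_def r_def)
      thus "(id, w) \<in> hurwitz_walks g d \<and> walk_end id w = id"
        using w linked_imp_transitive[OF li st permutes_id]
        by (simp add: hurwitz_walks_def e card_cycles_id permutes_id monotone_walks_def)
    qed
    hence "Pair id ` monotone_walks {1..d} r id
      \<subseteq> {(p, w) \<in> hurwitz_walks g d. cycle_type d p = \<alpha> \<and> cycle_type d (walk_end p w) = \<alpha>}"
      by (auto simp: \<alpha>_def)
    moreover have "finite {(p, w) \<in> hurwitz_walks g d. cycle_type d p = \<alpha> \<and> cycle_type d (walk_end p w) = \<alpha>}"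
      by (rule finite_subset[OF _ finite_hurwitz_walks[of g d]]) auto
    ultimately show ?thesis unfolding monotone_hurwitz_eq[OF s]
      by (intro card_inj_on_le[of "Pair id"]) (auto simp: inj_on_def)
  qed
  also have "\<dots> \<le> (\<Sum>\<beta>\<in>partitions_of d. monotone_hurwitz g \<alpha> \<beta>)"
    using \<alpha> finite_partitions_of by (intro member_le_sum) auto
  also have "\<dots> \<le> hurwitz_total g d"
    unfolding hurwitz_total_def using \<alpha> finite_partitions_of
    by (intro member_le_sum[where f = "\<lambda>\<alpha>. \<Sum>\<beta>\<in>partitions_of d. monotone_hurwitz g \<alpha> \<beta>"]) auto
  finally show ?thesis .
qed

lemma genus_count_id_mono:
  assumes "d \<ge> 2"
  shows "genus_count 0 {1..d} id \<le> genus_count g {1..d} id"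
proof (induction g)
  case (Suc g)
  define S r where "S = {1..d}" and "r = 2 * g + 2 * d - 2"
  have fin: "finite S" by (simp add: S_def)
  have eq: "genus_count g S id = card (monotone_walks S r id)" "genus_count (Suc g) S id = card (monotone_walks S (Suc (Suc r)) id)"
    using assms by (intro genus_count_eq; simp add: r_def complexity_def card_cycles_id S_def)+
  have "card (monotone_walks S r id) \<le> card (monotone_walks S (Suc (Suc r)) id)"
  proof (rule card_inj_on_le[of "\<lambda>w. w @ [(1, d)] @ [(1, d)]"])
    show "(\<lambda>w. w @ [(1, d)] @ [(1, d)]) ` monotone_walks S r id \<subseteq> monotone_walks S (Suc (Suc r)) id"
    proof (rule image_subsetI)
      fix w assume w: "w \<in> monotone_walks S r id"
      hence st: "steps_in S w" by (simp add: monotone_walks_def)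
      have "snd e \<le> d" if "e \<in> set w" for e
        using st that unfolding steps_in_def split_beta S_def by simp
      hence "sorted (map snd (w @ [(1, d)] @ [(1, d)]))" using w by (simp add: monotone_walks_def sorted_append)
      moreover have "steps_in S ((w @ [(1, d)]) @ [(1, d)])"
        unfolding steps_in_snoc using st assms by (simp add: S_def)
      moreover have "linked S ((w @ [(1, d)]) @ [(1, d)])"
        using w by (intro linked_snoc_mono) (simp add: monotone_walks_def)
      moreover have "wprod (w @ [(1, d)] @ [(1, d)]) = wprod w" by (simp add: wprod_append comp_assoc)
      ultimately show "w @ [(1, d)] @ [(1, d)] \<in> monotone_walks S (Suc (Suc r)) id"
        using w by (simp add: monotone_walks_def)
    qed
  qed (simp_all add: inj_on_def finite_monotone_walks fin)
  with Suc.IH show ?case unfolding S_def[symmetric] eq by (rule order_trans)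
qed simp

lemma genus_count_0_id:
  assumes "d \<ge> 1"
  shows "real (genus_count 0 {1..d} id) = fact (3 * d - 3) * 2 ^ d / fact (2 * d)" "planar_value {1..d} id = fact (3 * d - 3) * 2 ^ d / fact (2 * d)"
proof -
  have "prod weight (cycles {1..d} id) = (\<Prod>x\<in>{1..d}. weight {x})"
    unfolding cycles_id by (rule prod.reindex_cong[OF _ refl refl]) (auto simp: inj_on_def)
  also have "\<dots> = 2 ^ d" using cbin_Suc[of 0] by (simp add: weight_def)
  finally show planar_value: "planar_value {1..d} id = fact (3 * d - 3) * 2 ^ d / fact (2 * d)"
    unfolding planar_value_def card_cycles_id by simp
  have "real (genus_count 0 {1..d} id) = planar_value {1..d} id"
    using assms by (intro genus_count_genus_0 stable_perm_id) auto
  thus "real (genus_count 0 {1..d} id) = fact (3 * d - 3) * 2 ^ d / fact (2 * d)" unfolding planar_value .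
qed

section \<open>The radius of convergence\<close>

lemma trinomial_bound: "real ((3 * d) choose d) \<le> (27 / 4) ^ d"
proof -
  have "real ((3 * d) choose d) * (1/3) ^ d * (2/3) ^ (3 * d - d)
      \<le> (\<Sum>k\<le>3 * d. real ((3 * d) choose k) * (1/3) ^ k * (2/3) ^ (3 * d - k))"
    by (rule member_le_sum) auto
  also have "\<dots> = (1/3 + 2/3) ^ (3 * d)" by (rule binomial_ring[symmetric])
  also have "\<dots> = (1 :: real)" by simp
  also have "(3 * d - d) = 2 * d" by simp
  finally have "real ((3 * d) choose d) * ((1/3) ^ d * (2/3) ^ (2 * d)) \<le> 1" by (simp only: mult.assoc)
  also have "(1/3) ^ d * (2/3) ^ (2 * d) = (4/27 :: real) ^ d"
    by (simp add: power_mult power_mult_distrib[symmetric] power2_eq_square)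
  finally have "real ((3 * d) choose d) * (4/27) ^ d * (27/4) ^ d \<le> 1 * (27/4) ^ d"
    by (rule mult_right_mono) simp
  moreover have "(4/27) ^ d * (27/4) ^ d = (1 :: real)" by (simp flip: power_mult_distrib)
  ultimately show ?thesis by (simp add: mult.assoc)
qed

definition simple_coeff :: "nat \<Rightarrow> real" where
  "simple_coeff d = fact (3 * d - 3) * 2 ^ d / fact (2 * d) / fact d"

lemma simple_coeff_nonneg: "simple_coeff d \<ge> 0"
  by (simp add: simple_coeff_def)

lemma simple_coeff_le: "simple_coeff d \<le> (27 / 2) ^ d"
proof -
  have "fact (3 * d - 3) \<le> (fact (3 * d) :: real)" by (rule fact_mono) simp
  hence "simple_coeff d \<le> fact (3 * d) * 2 ^ d / fact (2 * d) / fact d"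
    unfolding simple_coeff_def by (intro divide_right_mono mult_right_mono) auto
  also have "\<dots> = 2 ^ d * (fact (3 * d) / (fact d * fact (3 * d - d)))" by (simp add: mult_ac)
  also have "fact (3 * d) / (fact d * fact (3 * d - d)) = real ((3 * d) choose d)"
    by (subst binomial_fact) auto
  also have "2 ^ d * \<dots> \<le> 2 ^ d * (27 / 4) ^ d" by (intro mult_left_mono trinomial_bound) simp
  also have "\<dots> = (27 / 2) ^ d" by (simp flip: power_mult_distrib)
  finally show ?thesis .
qed

lemma simple_coeff_ratio:
  assumes "d \<ge> 1"
  shows "simple_coeff d / simple_coeff (Suc d)
    = (2 * real d + 2) * (2 * real d + 1) * (real d + 1) / (2 * (3 * real d) * (3 * real d - 1) * (3 * real d - 2))"
proof -
  define k where "k = 3 * d - 3"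
  have k: "3 * d = Suc (Suc (Suc k))" using assms by (simp add: k_def)
  have f3: "(fact (3 * Suc d - 3) :: real) = 3 * real d * (3 * real d - 1) * (3 * real d - 2) * fact (3 * d - 3)"
  proof -
    have "3 * Suc d - 3 = Suc (Suc (Suc k))" using k by simp
    hence "(fact (3 * Suc d - 3) :: real) = fact (Suc (Suc (Suc k)))" by (simp only:)
    also have "\<dots> = real (Suc (Suc (Suc k))) * real (Suc (Suc k)) * real (Suc k) * fact k" by (simp only: fact_Suc mult.assoc of_nat_mult)
    also have "real (Suc (Suc (Suc k))) = 3 * real d" using arg_cong[OF k, of real] by simp
    also have "real (Suc (Suc k)) = 3 * real d - 1" using arg_cong[OF k, of real] by simp
    also have "real (Suc k) = 3 * real d - 2" using arg_cong[OF k, of real] by simp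
    also have "k = 3 * d - 3" using k by simp
    finally show ?thesis .
  qed
  have f2: "(fact (2 * Suc d) :: real) = (2 * real d + 2) * (2 * real d + 1) * fact (2 * d)"
    by (simp add: algebra_simps)
  have f1: "(fact (Suc d) :: real) = (real d + 1) * fact d" by (simp add: algebra_simps)
  have pos: "3 * real d - 1 > 0" "3 * real d - 2 > 0" "real d > 0" using assms by auto
  have aux: "a * t / b / c / (A * a * (2 * t) / (B * b) / (C * c)) = B * C / (2 * A)"
    if "a > 0" "b > 0" "c > 0" "t > 0" "A > 0" "B > 0" "C > 0" for a b c t A B C :: real
  proof -
    have "A * a * (2 * t) / (B * b) / (C * c) = (2 * A / (B * C)) * (a * t / b / c)" by (simp add: mult_ac)
    moreover have "a * t / b / c \<noteq> 0" using that by simp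
    ultimately show ?thesis by simp
  qed
  show ?thesis
    unfolding simple_coeff_def f3 f2 f1 power_Suc
    by (subst aux) (use pos in auto)
qed

lemma conv_radius_simple_coeff: "conv_radius simple_coeff = ereal (2 / 27)"
proof -
  have "(\<lambda>d. (2 * real d + 2) * (2 * real d + 1) * (real d + 1) / (2 * (3 * real d) * (3 * real d - 1) * (3 * real d - 2)))
      \<longlonglongrightarrow> 2 / 27" by real_asymp
  moreover have "\<forall>\<^sub>F d in sequentially. (2 * real d + 2) * (2 * real d + 1) * (real d + 1) / (2 * (3 * real d) * (3 * real d - 1) * (3 * real d - 2))
      = norm (simple_coeff d) / norm (simple_coeff (Suc d))"
    using eventually_ge_at_top[of 1]
    by eventually_elim (simp add: simple_coeff_ratio simple_coeff_nonneg)
  ultimately have "(\<lambda>d. norm (simple_coeff d) / norm (simple_coeff (Suc d))) \<longlonglongrightarrow> 2 / 27"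
    by (rule Lim_transform_eventually)
  thus ?thesis by (intro conv_radius_ratio_limit_nonzero) auto
qed

lemma conv_radius_poly_geometric: "conv_radius (\<lambda>d. C * real d ^ e * 54 ^ d) \<ge> ereal (1 / 54)"
proof (cases "C = 0")
  case False
  have "(\<lambda>d. (real d / real (Suc d)) ^ e * (1 / 54)) \<longlonglongrightarrow> 1 ^ e * (1 / 54)"
    by (intro tendsto_intros tendsto_power) real_asymp
  moreover have "(\<lambda>d. (real d / real (Suc d)) ^ e * (1 / 54))
      = (\<lambda>d. norm (C * real d ^ e * 54 ^ d) / norm (C * real (Suc d) ^ e * 54 ^ Suc d))"
    using False by (auto simp: power_divide abs_mult norm_mult)
  ultimately have "(\<lambda>d. norm (C * real d ^ e * 54 ^ d) / norm (C * real (Suc d) ^ e * 54 ^ Suc d)) \<longlonglongrightarrow> 1 / 54"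
    by simp
  hence "conv_radius (\<lambda>d. C * real d ^ e * 54 ^ d) = ereal (1 / 54)"
    by (intro conv_radius_ratio_limit_nonzero) auto
  thus ?thesis by simp
qed simp

lemma conv_radius_mono:
  fixes f h :: "nat \<Rightarrow> real"
  assumes "\<forall>\<^sub>F n in sequentially. norm (f n) \<le> norm (h n)"
  shows "conv_radius h \<le> conv_radius f"
proof (rule conv_radius_geI_ex)
  fix r :: real assume r: "0 < r" "ereal r < conv_radius h"
  have "summable (\<lambda>n. norm (h n * r ^ n))"
    using r by (intro abs_summable_in_conv_radius) auto
  moreover have "\<forall>\<^sub>F n in sequentially. norm (f n * r ^ n) \<le> norm (h n * r ^ n)"
    using assms by eventually_elim (simp add: abs_mult mult_right_mono)
  ultimately have "summable (\<lambda>n. f n * r ^ n)"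
    by (rule summable_comparison_test_ev[rotated])
  thus "\<exists>z. norm z = r \<and> summable (\<lambda>n. f n * z ^ n)" using r by (intro exI[of _ r]) auto
qed

lemma F_coeff_eq: "d \<ge> 1 \<Longrightarrow> F_coeff g d = real (hurwitz_total g d) / fact d"
  by (simp add: F_coeff_def hurwitz_total_def)

lemma F_coeff_ge:
  assumes "d \<ge> 2"
  shows "simple_coeff d \<le> F_coeff g d"
proof -
  have "simple_coeff d = real (genus_count 0 {1..d} id) / fact d"
    using assms genus_count_0_id(1)[of d] by (simp add: simple_coeff_def)
  also have "\<dots> \<le> real (hurwitz_total g d) / fact d"
    using genus_count_id_mono[OF assms, of g] hurwitz_total_ge[of d g] assms by (intro divide_right_mono) auto
  finally show ?thesis using assms by (simp add: F_coeff_eq)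
qed

lemma F_coeff_le: "\<exists>C\<ge>0. \<forall>d\<ge>1. F_coeff g d \<le> C * real d ^ (5 * g - 1) * 54 ^ d"
proof -
  obtain K where K: "K \<ge> 0" "\<And>S p. stable_perm S p \<Longrightarrow> S \<noteq> {} \<Longrightarrow>
     real (genus_count g S p) \<le> K * real (excess S p) ^ (5 * g - 1) * planar_value S p"
    using genus_count_bound[of g] by blast
  have "F_coeff g d \<le> K * 3 ^ (5 * g - 1) * real d ^ (5 * g - 1) * 54 ^ d" if d: "d \<ge> 1" for d
  proof -
    define e where "e = 5 * g - 1"
    have ex: "excess {1..d} id \<le> 3 * d" by (simp add: excess_def complexity_def card_cycles_id)
    have "real (hurwitz_total g d) \<le> 4 ^ d * real (genus_count g {1..d} id)"
      using hurwitz_total_le[OF d, of g] by (metis of_nat_le_iff of_nat_mult of_nat_numeral of_nat_power)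
    hence "F_coeff g d \<le> 4 ^ d * real (genus_count g {1..d} id) / fact d"
      unfolding F_coeff_eq[OF d] by (intro divide_right_mono) auto
    also have "\<dots> \<le> 4 ^ d * (K * real (excess {1..d} id) ^ e * planar_value {1..d} id) / fact d"
      unfolding e_def using d by (intro divide_right_mono mult_left_mono K(2) stable_perm_id) auto
    also have "\<dots> = 4 ^ d * (K * real (excess {1..d} id) ^ e) * simple_coeff d"
      unfolding genus_count_0_id(2)[OF d] simple_coeff_def by simp
    also have "\<dots> \<le> 4 ^ d * (K * real (3 * d) ^ e) * (27 / 2) ^ d"
      using K(1) ex simple_coeff_nonneg
      by (intro mult_mono simple_coeff_le mult_left_mono power_mono of_nat_mono) auto
    also have "\<dots> = K * 3 ^ e * real d ^ e * (4 ^ d * (27 / 2) ^ d)"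
      by (simp add: power_mult_distrib)
    also have "(4 ^ d * (27 / 2) ^ d :: real) = 54 ^ d" by (simp flip: power_mult_distrib)
    finally show ?thesis by (simp add: e_def)
  qed
  thus ?thesis using K(1) by (intro exI[of _ "K * 3 ^ (5 * g - 1)"]) auto
qed

theorem theorem1p1:
  fixes g :: nat
  shows "ereal (1/54) \<le> conv_radius (F_coeff g) \<and> conv_radius (F_coeff g) \<le> ereal (2/27)"
proof
  have nonneg: "F_coeff g d \<ge> 0" for d by (simp add: F_coeff_def sum_nonneg)
  obtain C where C: "C \<ge> 0" "\<forall>d\<ge>1. F_coeff g d \<le> C * real d ^ (5 * g - 1) * 54 ^ d"
    using F_coeff_le by blast
  have "\<forall>\<^sub>F d in sequentially. norm (F_coeff g d) \<le> norm (C * real d ^ (5 * g - 1) * 54 ^ d)"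
    using eventually_ge_at_top[of 1]
  proof eventually_elim
    case (elim d)
    show ?case using C elim nonneg[of d] by (simp add: abs_mult)
  qed
  from conv_radius_mono[OF this] show "ereal (1/54) \<le> conv_radius (F_coeff g)"
    using conv_radius_poly_geometric[of C "5 * g - 1"] by (rule order_trans[rotated])
  have "\<forall>\<^sub>F d in sequentially. norm (simple_coeff d) \<le> norm (F_coeff g d)"
    using eventually_ge_at_top[of 2]
  proof eventually_elim
    case (elim d)
    show ?case using F_coeff_ge[OF elim, of g] simple_coeff_nonneg[of d] by simp
  qed
  from conv_radius_mono[OF this] show "conv_radius (F_coeff g) \<le> ereal (2/27)"
    unfolding conv_radius_simple_coeff .
qed

end
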